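(* For every $\varepsilon>0$ there is a constant $C_\varepsilon$ such that the following holds. Let $n\ge 1$, let $A=\{a_1,\ldots,a_n\}$ be a set of $n$ distinct real numbers and let $B=\{b_1,\ldots,b_n\}$ be a multiset of $n$ real numbers with $M(B)>0$. If $\pi$ is a uniformly random permutation of $\{1,\ldots,n\}$, then \[Q\Big[\sum_{i=1}^n a_i b_{\pi(i)}\Big]\le \frac{C_\varepsilon\, n^{-1+\varepsilon}}{\sqrt{M(B)}}.\] (In the paper's notation: $Q\big[\sum_i a_i b_{\pi(i)}\big]\le \frac{1}{n^{1-o(1)}\sqrt{M(B)}}$.)
   Context: For a random variable $X$, $Q[X]=\sup_x \mathbb{P}[X=x]$. For a multiset $B$ of $n$ reals, its multiplicity profile $\mu(B)=(\mu_1,\ldots,\mu_\ell)$ is the partition of $n$ such that the $\ell$ distinct elements of $B$ occur with multiplicities $\mu_1\ge\cdots\ge\mu_\ell$, and $M(B)=\sum_{i=1}^{\ell}(i-1)^2\mu_i$. (So $M(B)>0$ iff $B$ has at least two distinct elements.) *)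

theory Defs
  imports "HOL-Probability.Probability"
begin

definition Q :: "'a pmf \<Rightarrow> real" where
  "Q p = (SUP x. pmf p x)"

definition mult_profile :: "'a::linorder multiset \<Rightarrow> nat list" where
  "mult_profile B = rev (sort (map (count B) (sorted_list_of_set (set_mset B))))"

text \<open>M(B) = sum_{i=1}^{l} (i-1)^2 mu_i; with 0-based list index i this is i^2 * mu!i.\<close>
definition M :: "'a::linorder multiset \<Rightarrow> real" where
  "M B = (\<Sum>i<length (mult_profile B). (real i)^2 * real (mult_profile B ! i))"

definition perm_sum_pmf :: "nat \<Rightarrow> (nat \<Rightarrow> real) \<Rightarrow> (nat \<Rightarrow> real) \<Rightarrow> real pmf" where
  "perm_sum_pmf n a b =
     map_pmf (\<lambda>\<pi>. \<Sum>i=1..n. a i * b (\<pi> i)) (pmf_of_set {\<pi>. \<pi> permutes {1..n}})"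

end

theory Submission
  imports Defs "HOL-Real_Asymp.Real_Asymp"
begin

text \<open>Up to a constant and a logarithm, M(B) is at most l^3 m for some 2 l values of multiplicity at least m. Pair the largest
  of them with the smallest ones: this gives N = l m disjoint pairs of entries of B whose differences d take
  l distinct positive values, each m times. Swapping the positions of the entries of a pair p changes the sum
  by d(p) times a difference of two elements of A, so that the permutation sum becomes a random subset sum.

  A random subset sum equals x with probability at most a constant times N^(-1/2) E / N^(2k), where E is the number of
  pairs of k-subsets with equal sums (a combinatorial form of Halasz's inequality). On average over the
  permutation, E / N^(2k) is at most the probability that a sum of many independent bilinear terms a d takes a fixed
  value, and this is at most n^\<epsilon> / (n l): by a Szemeredi--Trotter bound for Cartesian products
  every additional term improves a weak L2 bound for the law of the sum until this level is reached.

  If N is below a small power of n, then so is M(B); hence one value has multiplicity at least n/2, and moving a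
  single other entry already gives the bound 2/n.\<close>

section \<open>Sperner's theorem and central binomial coefficients\<close>

text \<open>The exponents fit together as follows: the Halasz bound contributes
  \<open>N^(-1/2)\<close> with \<open>N = l m\<close>, the averaged energy contributes about
  \<open>1 / (n l)\<close>, and the product is \<open>1 / (n sqrt (l^3 m))\<close>, the shape to
  which M was reduced. One bilinear term is not enough for the second factor: the term
  \<open>d p * |a y - a x|\<close> vanishes for \<open>x = y\<close> whatever p is, so 0 has mass at
  least 1/n. Hence a number of terms proportional to 1/\<epsilon> is summed, each gaining a fixed
  power of n. Pairs of k-subsets that differ in few elements yield too few terms for this and are
  counted trivially. That is harmless only if k is a large constant and N at least a small power of
  n, which is why small N is treated separately. The values of a random permutation at the positions
  involved are not independent, but the positions are boundedly many, so independent samples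
  dominate them up to a constant factor.\<close>

lemma lym_inequality:
  fixes G :: "'a set set"
  assumes "finite U" "G \<subseteq> Pow U" "\<And>X Y. X \<in> G \<Longrightarrow> Y \<in> G \<Longrightarrow> X \<subseteq> Y \<Longrightarrow> X = Y"
  shows "(\<Sum>X\<in>G. 1 / real (card U choose card X)) \<le> 1"
  using assms
proof (induction "card U" arbitrary: U G)
  case 0
  then have "G \<subseteq> {{}}" by auto
  then have "G = {} \<or> G = {{}}" by auto
  then show ?case by (auto simp: 0(1)[symmetric])
next
  case (Suc n)
  show ?case
  proof (cases "U \<in> G")
    case True
    then have "G = {U}" using Suc.prems by blast
    then show ?thesis by simp
  next
    case False
    have finG: "finite G" using finite_subset[OF Suc.prems(2)] Suc.prems(1) by simp
    have fin: "finite X" and lt: "card X \<le> n" if "X \<in> G" for X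
    proof -
      have "X \<subset> U" using that False Suc.prems(2) by auto
      then have "card X < card U" by (rule psubset_card_mono[OF Suc.prems(1)])
      then show "card X \<le> n" using Suc.hyps(2) by linarith
      show "finite X" using \<open>X \<subset> U\<close> Suc.prems(1) finite_subset[of X U] by blast
    qed
    \<comment> \<open>Deleting a point i leaves those members of \<open>G\<close> that miss i as an
      antichain of an n-element set. A set X survives the deletion of exactly
      \<open>Suc n - card X\<close> points, and this is the factor that relates the two binomial
      weights, so summing over all i gives the claim.\<close>
    have each: "(\<Sum>X\<in>{X\<in>G. i \<notin> X}. 1 / real (n choose card X)) \<le> 1" if "i \<in> U" for i
    proof -
      have c: "card (U - {i}) = n" using that Suc.hyps(2) by simp
      have "(\<Sum>X\<in>{X\<in>G. i \<notin> X}. 1 / real (card (U - {i}) choose card X)) \<le> 1"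
      proof (rule Suc.hyps(1))
        show "X = Y" if "X \<in> {X \<in> G. i \<notin> X}" "Y \<in> {X \<in> G. i \<notin> X}" "X \<subseteq> Y" for X Y
          using Suc.prems(3)[of X Y] that by blast
      qed (use Suc.prems(1,2) c in auto)
      then show ?thesis using c by simp
    qed
    have "(\<Sum>X\<in>G. real (Suc n) / real (Suc n choose card X))
        = (\<Sum>X\<in>G. real (Suc n - card X) / real (n choose card X))"
    proof (rule sum.cong[OF refl])
      fix X assume "X \<in> G"
      then have le: "card X \<le> n" using lt by auto
      have "(Suc n - card X) * (Suc n choose card X) = Suc n * (n choose card X)"
        using binomial_absorb_comp[of "Suc n" "card X"] by simp
      then have "real (Suc n - card X) * real (Suc n choose card X) = real (Suc n) * real (n choose card X)"
        by (metis of_nat_mult)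
      moreover have "real (Suc n choose card X) > 0" "real (n choose card X) > 0" using le by auto
      ultimately show "real (Suc n) / real (Suc n choose card X) = real (Suc n - card X) / real (n choose card X)"
        by (simp add: frac_eq_eq)
    qed
    also have "\<dots> = (\<Sum>X\<in>G. \<Sum>i\<in>{i\<in>U. i \<notin> X}. 1 / real (n choose card X))"
    proof (rule sum.cong[OF refl])
      fix X assume X: "X \<in> G"
      have "{i\<in>U. i \<notin> X} = U - X" by auto
      moreover have "card (U - X) = Suc n - card X"
        using X Suc.prems(1,2) Suc.hyps(2) fin by (subst card_Diff_subset) auto
      ultimately show "real (Suc n - card X) / real (n choose card X) = (\<Sum>i\<in>{i\<in>U. i \<notin> X}. 1 / real (n choose card X))"
        by simp
    qed
    also have "\<dots> = (\<Sum>i\<in>U. \<Sum>X\<in>{X\<in>G. i \<notin> X}. 1 / real (n choose card X))"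
      by (rule sum.swap_restrict) (use finG Suc.prems(1) in auto)
    also have "\<dots> \<le> (\<Sum>i\<in>U. 1)" by (rule sum_mono) (use each in auto)
    also have "\<dots> = real (Suc n)" using Suc.hyps(2) by simp
    finally have "real (Suc n) * (\<Sum>X\<in>G. 1 / real (Suc n choose card X)) \<le> real (Suc n) * 1"
      by (simp add: sum_distrib_left)
    then have "(\<Sum>X\<in>G. 1 / real (Suc n choose card X)) \<le> 1" by (rule mult_left_le_imp_le) simp
    then show ?thesis using Suc.hyps(2) by simp
  qed
qed

lemma sperner:
  fixes G :: "'a set set"
  assumes "finite U" "G \<subseteq> Pow U" "\<And>X Y. X \<in> G \<Longrightarrow> Y \<in> G \<Longrightarrow> X \<subseteq> Y \<Longrightarrow> X = Y"
  shows "card G \<le> card U choose (card U div 2)"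
proof -
  define c where "c = card U choose (card U div 2)"
  have c0: "c > 0" unfolding c_def by simp
  have "(\<Sum>X\<in>G. 1 / real c) \<le> (\<Sum>X\<in>G. 1 / real (card U choose card X))"
  proof (rule sum_mono)
    fix X assume "X \<in> G"
    then have "card X \<le> card U" using assms(1,2) by (auto intro: card_mono)
    moreover have "card U choose card X \<le> c" unfolding c_def by (rule binomial_maximum)
    ultimately show "1 / real c \<le> 1 / real (card U choose card X)"
      by (intro divide_left_mono) (auto simp: c0)
  qed
  also have "\<dots> \<le> 1" by (rule lym_inequality[OF assms])
  finally have "real (card G) \<le> real c" using c0 by (simp add: field_simps)
  then show ?thesis by (simp add: c_def)
qed

text \<open>The factor \<open>2 * real m + 1\<close> is chosen so that the induction closes:
  consecutive central coefficients have the ratio \<open>2 (2m + 1) / (m + 1)\<close>, and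
  \<open>(2m + 1) (2m + 3)\<close> is at most \<open>4 (m + 1)^2\<close>. Squaring avoids
  roots.\<close>

lemma central_binomial_even: "real ((2*m) choose m) ^ 2 * (2 * real m + 1) \<le> 16 ^ m"
proof (induction m)
  case (Suc m)
  have e: "real (Suc m) * real ((2 * Suc m) choose Suc m) = 2 * (2 * real m + 1) * real ((2*m) choose m)"
  proof -
    have "Suc m * ((2 * Suc m) choose Suc m) = (2 * Suc m) * ((2*m+1) choose m)"
      using binomial_absorption[of m "2 * Suc m"] by (simp del: binomial_Suc_Suc)
    moreover have "(2*m+1 - m) * ((2*m+1) choose m) = (2*m+1) * ((2*m) choose m)"
      using binomial_absorb_comp[of "2*m+1" m] by (simp del: binomial_Suc_Suc)
    then have "Suc m * ((2*m+1) choose m) = (2*m+1) * ((2*m) choose m)" by (simp del: binomial_Suc_Suc)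
    ultimately have "Suc m * ((2 * Suc m) choose Suc m) = 2 * ((2*m+1) * ((2*m) choose m))" by (metis mult.assoc)
    then have "real (Suc m * ((2 * Suc m) choose Suc m)) = real (2 * ((2*m+1) * ((2*m) choose m)))" by (simp only:)
    then show ?thesis unfolding of_nat_mult by (simp add: algebra_simps)
  qed
  define x where "x = real ((2*m) choose m)"
  define y where "y = real ((2 * Suc m) choose Suc m)"
  have "real (Suc m) ^ 2 * (y ^ 2 * (2 * real m + 3)) = (real (Suc m) * y) ^ 2 * (2 * real m + 3)"
    by (simp add: power_mult_distrib)
  also have "\<dots> = 4 * ((2 * real m + 1) * (2 * real m + 3)) * (x ^ 2 * (2 * real m + 1))"
    unfolding e[folded x_def y_def] by (simp only: power_mult_distrib) (simp add: power2_eq_square algebra_simps)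
  also have "\<dots> \<le> 4 * ((2 * real m + 1) * (2 * real m + 3)) * 16 ^ m"
    using Suc.IH by (intro mult_left_mono) (auto simp: x_def)
  also have "\<dots> \<le> 4 * (4 * real (Suc m) ^ 2) * 16 ^ m"
    by (intro mult_right_mono mult_left_mono) (auto simp: power2_eq_square algebra_simps)
  finally have "real (Suc m) ^ 2 * (y ^ 2 * (2 * real m + 3)) \<le> real (Suc m) ^ 2 * 16 ^ Suc m" by simp
  then have "y ^ 2 * (2 * real m + 3) \<le> 16 ^ Suc m" by (rule mult_left_le_imp_le) simp
  then show ?case by (simp add: y_def add.commute)
qed simp

lemma central_binomial_upper: "real (n choose (n div 2)) \<le> 2 ^ n / sqrt (real n + 1)"
proof -
  have even: "real ((2*m) choose m) \<le> 4 ^ m / sqrt (2 * real m + 1)" for m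
  proof -
    have "(real ((2*m) choose m) * sqrt (2 * real m + 1)) ^ 2 \<le> (4 ^ m) ^ 2"
    proof -
      have "(4 ^ m) ^ 2 = (16::real) ^ m" by (simp add: power2_eq_square flip: power_mult_distrib)
      then show ?thesis using central_binomial_even[of m] by (simp add: power_mult_distrib)
    qed
    then have "real ((2*m) choose m) * sqrt (2 * real m + 1) \<le> 4 ^ m"
      by (rule power2_le_imp_le) simp
    then show ?thesis by (simp add: pos_le_divide_eq)
  qed
  show ?thesis
  proof (cases "even n")
    case True
    then obtain m where "n = 2 * m" by auto
    then show ?thesis using even[of m] by (simp add: power_mult)
  next
    case False
    then obtain m where n: "n = 2 * m + 1" by (auto elim: oddE)
    \<comment> \<open>An odd row has two equal middle entries, whose sum is the middle entry of the
      next even row.\<close>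
    have "(2 * Suc m) choose (Suc m) = ((2*m+1) choose m) + ((2*m+1) choose (Suc m))" by simp
    also have "(2*m+1) choose (Suc m) = (2*m+1) choose m"
      using binomial_symmetric[of m "2*m+1"] by (simp)
    finally have "2 * real ((2*m+1) choose m) = real ((2 * Suc m) choose (Suc m))" by simp
    also have "\<dots> \<le> 4 ^ Suc m / sqrt (2 * real (Suc m) + 1)" by (rule even)
    also have "\<dots> \<le> 4 ^ Suc m / sqrt (2 * real m + 2)" by (intro divide_left_mono) auto
    also have "\<dots> = 2 * (2 ^ n / sqrt (real n + 1))"
    proof -
      have "real n + 1 = 2 * real m + 2" "(2::real) ^ n = 2 * 4 ^ m"
        using n by (simp_all add: power_mult)
      then show ?thesis by simp
    qed
    finally have "2 * real (n choose m) \<le> 2 * (2 ^ n / sqrt (real n + 1))"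
      unfolding n .
    then show ?thesis using n by (simp del: binomial_Suc_Suc)
  qed
qed

text \<open>Erdos's argument for the Littlewood--Offord problem. Cut the window into half-open
  intervals of length t: the sets with sums in one interval form an antichain, since an additional
  element raises the sum by at least t. The last of the \<open>k + 1\<close> intervals is there for
  the right endpoint.\<close>

lemma card_subsets_in_window:
  fixes c :: "'a \<Rightarrow> real"
  assumes "finite H" "t > 0" "\<And>q. q \<in> H \<Longrightarrow> t \<le> c q"
  shows "card {X. X \<subseteq> H \<and> y \<le> sum c X \<and> sum c X \<le> y + real k * t}
    \<le> (k + 1) * (card H choose (card H div 2))"
proof -
  define G where "G i = {X. X \<subseteq> H \<and> y + real i * t \<le> sum c X \<and> sum c X < y + (real i + 1) * t}" for i :: nat
  have G: "card (G i) \<le> card H choose (card H div 2)" for i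
  proof (rule sperner[OF assms(1)])
    show "G i \<subseteq> Pow H" by (auto simp: G_def)
    fix X Y assume XY: "X \<in> G i" "Y \<in> G i" "X \<subseteq> Y"
    show "X = Y"
    proof (rule ccontr)
      assume "X \<noteq> Y"
      then obtain q where q: "q \<in> Y" "q \<notin> X" using XY by auto
      have fY: "finite Y" "Y \<subseteq> H" using XY assms(1) finite_subset by (auto simp: G_def)
      have "sum c X + c q = sum c (insert q X)"
        using q XY fY finite_subset by (subst sum.insert) (auto)
      also have "\<dots> \<le> sum c Y"
      proof (rule sum_mono2)
        show "0 \<le> c b" if "b \<in> Y - insert q X" for b
          using assms(3)[of b] that fY assms(2) by auto
      qed (use q XY fY in auto)
      finally have "sum c X + t \<le> sum c Y" using assms(3)[of q] q fY by auto
      moreover have "sum c Y - sum c X < t" using XY unfolding G_def by (auto simp: algebra_simps)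
      ultimately show False by simp
    qed
  qed
  have "{X. X \<subseteq> H \<and> y \<le> sum c X \<and> sum c X \<le> y + real k * t} \<subseteq> (\<Union>i\<in>{..k}. G i)"
  proof
    fix X assume "X \<in> {X. X \<subseteq> H \<and> y \<le> sum c X \<and> sum c X \<le> y + real k * t}"
    then have X: "X \<subseteq> H" "y \<le> sum c X" "sum c X \<le> y + real k * t" by auto
    define r where "r = (sum c X - y) / t"
    have r: "0 \<le> r" "r \<le> real k" using X assms(2) by (auto simp: r_def field_simps)
    define i where "i = nat \<lfloor>r\<rfloor>"
    have i: "real i \<le> r" "r < real i + 1" "i \<le> k" using r unfolding i_def by linarith+
    have "sum c X = y + r * t" using assms(2) by (simp add: r_def)
    then have "X \<in> G i" using i X assms(2) by (auto simp: G_def intro: mult_right_mono)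
    then show "X \<in> (\<Union>i\<in>{..k}. G i)" using i by auto
  qed
  moreover have fG: "finite (G i)" for i
    by (rule finite_subset[of _ "Pow H"]) (auto simp: G_def assms(1))
  ultimately have "card {X. X \<subseteq> H \<and> y \<le> sum c X \<and> sum c X \<le> y + real k * t} \<le> card (\<Union>i\<in>{..k}. G i)"
    by (intro card_mono) auto
  also have "\<dots> \<le> (\<Sum>i\<in>{..k}. card (G i))" by (rule card_UN_le) simp
  also have "\<dots> \<le> (\<Sum>i\<in>{..k}. card H choose (card H div 2))" by (intro sum_mono G)
  finally show ?thesis by simp
qed

section \<open>Random subset sums\<close>

lemma exists_lower_subset:
  fixes c :: "'a \<Rightarrow> real"
  assumes "finite P" "h \<le> card P"
  obtains L where "L \<subseteq> P" "card L = h" "\<And>p q. p \<in> L \<Longrightarrow> q \<in> P - L \<Longrightarrow> c p \<le> c q"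
proof -
  have "\<exists>L\<subseteq>P. card L = h \<and> (\<forall>p\<in>L. \<forall>q\<in>P - L. c p \<le> c q)"
    using assms(2)
  proof (induction h)
    case (Suc h)
    then obtain L where L: "L \<subseteq> P" "card L = h" "\<forall>p\<in>L. \<forall>q\<in>P - L. c p \<le> c q" by auto
    have "P - L \<noteq> {}" 
    proof
      assume "P - L = {}"
      then have "L = P" using L by auto
      then show False using L Suc.prems by simp
    qed
    have fin: "finite (c ` (P - L))" using assms(1) by simp
    then have "Min (c ` (P - L)) \<in> c ` (P - L)" using \<open>P - L \<noteq> {}\<close> by (intro Min_in) auto
    then obtain x where x: "x \<in> P - L" "c x = Min (c ` (P - L))" by auto
    have x2: "\<forall>q\<in>P - L. c x \<le> c q" unfolding x(2) using fin by (auto intro: Min_le)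
    have "card (insert x L) = Suc h" using L x assms(1) finite_subset[OF L(1)] by simp
    then show ?case using L x(1) x2 by (intro exI[of _ "insert x L"]) auto
  qed (auto intro: exI[of _ "{}"])
  then show ?thesis using that by blast
qed

definition subset_energy :: "('a \<Rightarrow> real) \<Rightarrow> 'a set \<Rightarrow> nat \<Rightarrow> nat" where
  "subset_energy c P k = card {(S, S'). S \<subseteq> P \<and> S' \<subseteq> P \<and> card S = k \<and> card S' = k \<and> sum c S = sum c S'}"

text \<open>Cauchy--Schwarz turns a small energy into a large upper shadow, obtained by adding k elements of L.
  The shadow has its sums in an interval of length k t while every element outside L has weight at
  least t, so Sperner's theorem bounds it.\<close>
lemma card_equal_sums_via_shadow:
  fixes c :: "'a \<Rightarrow> real" and x :: real
  assumes fin: "finite P" and L: "L \<subseteq> P" and pos: "\<And>p. p \<in> P \<Longrightarrow> c p > 0"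
    and t: "t > 0" "\<And>p. p \<in> L \<Longrightarrow> c p \<le> t" "\<And>q. q \<in> P - L \<Longrightarrow> t \<le> c q"
  defines "F \<equiv> {X. X \<subseteq> P \<and> sum c X = x \<and> card L \<le> 2 * card (L - X)}"
  shows "card F * (((card L + 1) div 2) choose k) ^ 2
     \<le> 2 ^ card L * ((k + 1) * (card (P - L) choose (card (P - L) div 2))) * subset_energy c P k"
proof -
  define \<beta> where "\<beta> = ((card L + 1) div 2) choose k"
  define up where "up X = {S. S \<subseteq> L - X \<and> card S = k}" for X
  define U where "U = {Y. Y \<subseteq> P \<and> x \<le> sum c Y \<and> sum c Y \<le> x + real k * t}"
  define R where "R = (SIGMA X:F. up X)"
  define E where "E = {(S, S'). S \<subseteq> P \<and> S' \<subseteq> P \<and> card S = k \<and> card S' = k \<and> sum c S = sum c S'}"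
  have finL: "finite L" by (rule finite_subset[OF _ fin]) (use L in auto)
  have finF: "finite F" by (rule finite_subset[of _ "Pow P"]) (auto simp: F_def fin)
  have finU: "finite U" by (rule finite_subset[of _ "Pow P"]) (auto simp: U_def fin)
  have finup: "finite (up X)" for X by (rule finite_subset[of _ "Pow L"]) (auto simp: up_def finL)
  have finE: "finite E" by (rule finite_subset[of _ "Pow P \<times> Pow P"]) (auto simp: E_def fin)
  have finR: "finite R" using finF finup by (auto simp: R_def)
  have cup: "card (up X) \<ge> \<beta>" if "X \<in> F" for X
  proof -
    have "card (up X) = card (L - X) choose k" unfolding up_def using finL by (intro n_subsets) auto
    moreover have "(card L + 1) div 2 \<le> card (L - X)" using that by (auto simp: F_def)
    ultimately show ?thesis by (simp add: \<beta>_def binomial_right_mono)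
  qed
  have cR: "card F * \<beta> \<le> card R"
  proof -
    have "card F * \<beta> = (\<Sum>X\<in>F. \<beta>)" by simp
    also have "\<dots> \<le> (\<Sum>X\<in>F. card (up X))" by (intro sum_mono cup)
    also have "\<dots> = card R" using finF finup by (simp add: R_def)
    finally show ?thesis .
  qed
  have sumU: "sum c (X \<union> S) = x + sum c S" if "X \<in> F" "S \<in> up X" for X S
  proof -
    have "finite X" "finite S" "X \<inter> S = {}" "sum c X = x"
      using that finite_subset[OF _ finL, of S] finite_subset[OF _ fin, of X] by (auto simp: F_def up_def)
    then show ?thesis by (simp add: sum.union_disjoint)
  qed
  define f :: "'a set \<times> 'a set \<Rightarrow> 'a set" where "f = (\<lambda>(X, S). X \<union> S)"
  have fR: "f ` R \<subseteq> U"
  proof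
    fix Y assume "Y \<in> f ` R"
    then obtain X S where XS: "X \<in> F" "S \<in> up X" "Y = X \<union> S" by (auto simp: f_def R_def)
    have S: "S \<subseteq> L" "card S = k" "finite S" using XS finite_subset[OF _ finL, of S] by (auto simp: up_def)
    have "sum c S \<ge> 0" using S L pos by (intro sum_nonneg) (auto intro: less_imp_le)
    moreover have "sum c S \<le> of_nat (card S) * t" using S t(2) by (intro sum_bounded_above) auto
    ultimately show "Y \<in> U" using sumU[OF XS(1,2)] XS S L by (auto simp: U_def F_def)
  qed
  define r where "r Y = card {z\<in>R. f z = Y}" for Y
  have cR2: "card R = (\<Sum>Y\<in>U. r Y)"
    unfolding r_def using sum.group[OF finR finU fR, of "\<lambda>_. 1::nat"] by simp
  \<comment> \<open>The second moment of \<open>r\<close> counts pairs of representations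
    \<open>X \<union> S = X' \<union> S'\<close> of one set Y. Both X and X' have sum x, so S and S'
    have equal sums; and X' is recovered as Y minus S', so that X, S and S' determine
    everything.\<close>
  have "(\<Sum>Y\<in>U. r Y ^ 2) = card (SIGMA Y:U. {z\<in>R. f z = Y} \<times> {z\<in>R. f z = Y})"
    using finU finR by (simp add: r_def card_cartesian_product power2_eq_square)
  also have "\<dots> \<le> card (F \<times> E)"
  proof (rule card_inj_on_le)
    let ?g = "\<lambda>(Y :: 'a set, ((X :: 'a set, S :: 'a set), (X' :: 'a set, S' :: 'a set))). (X, (S, S'))"
    show "inj_on ?g (SIGMA Y:U. {z\<in>R. f z = Y} \<times> {z\<in>R. f z = Y})"
    proof (rule inj_onI)
      fix p q
      assume p: "p \<in> (SIGMA Y:U. {z\<in>R. f z = Y} \<times> {z\<in>R. f z = Y})"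
        and q: "q \<in> (SIGMA Y:U. {z\<in>R. f z = Y} \<times> {z\<in>R. f z = Y})" and g: "?g p = ?g q"
      obtain Y X S X' S' where p': "p = (Y, (X, S), (X', S'))" by (metis surj_pair)
      obtain Z W T W' T' where q': "q = (Z, (W, T), (W', T'))" by (metis surj_pair)
      have a: "Y = X \<union> S" "Y = X' \<union> S'" "X' \<inter> S' = {}" using p by (auto simp: p' f_def R_def up_def)
      have b: "Z = W \<union> T" "Z = W' \<union> T'" "W' \<inter> T' = {}" using q by (auto simp: q' f_def R_def up_def)
      have c: "X = W" "S = T" "S' = T'" using g by (auto simp: p' q')
      have "X' = Y - S'" "W' = Z - T'" using a b by auto
      then show "p = q" using a b c by (simp add: p' q')
    qed
    show "?g ` (SIGMA Y:U. {z\<in>R. f z = Y} \<times> {z\<in>R. f z = Y}) \<subseteq> F \<times> E"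
    proof
      fix u assume "u \<in> ?g ` (SIGMA Y:U. {z\<in>R. f z = Y} \<times> {z\<in>R. f z = Y})"
      then obtain X S X' S' where u: "u = (X, (S, S'))" and
        m: "X \<in> F" "S \<in> up X" "X' \<in> F" "S' \<in> up X'" "X \<union> S = X' \<union> S'"
        by (auto simp: f_def R_def)
      have "sum c S = sum c S'" using sumU[OF m(1,2)] sumU[OF m(3,4)] m(5) by simp
      then show "u \<in> F \<times> E" using m L by (auto simp: u E_def up_def)
    qed
    show "finite (F \<times> E)" using finF finE by simp
  qed
  finally have sq: "(\<Sum>Y\<in>U. r Y ^ 2) \<le> card F * card E" by (simp add: card_cartesian_product)
  \<comment> \<open>Once the trace of Y on \<open>L\<close> is fixed, the rest of Y has its sum in a
    window of length \<open>k * t\<close> and consists of weights at least t.\<close>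
  have cU: "card U \<le> 2 ^ card L * ((k + 1) * (card (P - L) choose (card (P - L) div 2)))"
  proof -
    have "card U \<le> card (SIGMA Z:Pow L. {X. X \<subseteq> P - L \<and> x - sum c Z \<le> sum c X \<and> sum c X \<le> (x - sum c Z) + real k * t})"
    proof (rule card_inj_on_le)
      show "inj_on (\<lambda>Y. (Y \<inter> L, Y - L)) U" by (auto simp: inj_on_def)
      show "(\<lambda>Y. (Y \<inter> L, Y - L)) ` U
         \<subseteq> (SIGMA Z:Pow L. {X. X \<subseteq> P - L \<and> x - sum c Z \<le> sum c X \<and> sum c X \<le> (x - sum c Z) + real k * t})"
      proof
        fix z assume "z \<in> (\<lambda>Y. (Y \<inter> L, Y - L)) ` U"
        then obtain Y where Y: "Y \<in> U" "z = (Y \<inter> L, Y - L)" by auto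
        then have "finite Y" using finite_subset[OF _ fin, of Y] by (simp add: U_def)
        then have "sum c Y = sum c (Y \<inter> L) + sum c (Y - L)" by (rule sum.Int_Diff)
        moreover have "x \<le> sum c Y" "sum c Y \<le> x + real k * t" "Y \<subseteq> P" using Y by (auto simp: U_def)
        ultimately show "z \<in> (SIGMA Z:Pow L. {X. X \<subseteq> P - L \<and> x - sum c Z \<le> sum c X \<and> sum c X \<le> (x - sum c Z) + real k * t})"
          unfolding Y(2) by auto
      qed
      show "finite (SIGMA Z:Pow L. {X. X \<subseteq> P - L \<and> x - sum c Z \<le> sum c X \<and> sum c X \<le> (x - sum c Z) + real k * t})"
        by (rule finite_subset[of _ "Pow L \<times> Pow (P - L)"]) (auto simp: fin finL)
    qed
    also have "\<dots> = (\<Sum>Z\<in>Pow L. card {X. X \<subseteq> P - L \<and> x - sum c Z \<le> sum c X \<and> sum c X \<le> (x - sum c Z) + real k * t})"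
      using fin finL by (intro card_SigmaI) auto
    also have "\<dots> \<le> (\<Sum>Z\<in>Pow L. (k + 1) * (card (P - L) choose (card (P - L) div 2)))"
      by (intro sum_mono card_subsets_in_window) (use fin t in auto)
    finally show ?thesis by (simp add: card_Pow finL)
  qed
  have "(card F * \<beta>) ^ 2 \<le> card R ^ 2" using cR by (rule power_mono) simp
  also have "\<dots> \<le> card U * (card F * card E)"
  proof -
    have "(\<Sum>Y\<in>U. real (r Y) * 1)\<^sup>2 \<le> (\<Sum>Y\<in>U. (real (r Y))\<^sup>2) * (\<Sum>Y\<in>U. 1\<^sup>2)"
      by (rule Cauchy_Schwarz_ineq_sum)
    then have "real (card R ^ 2) \<le> real ((\<Sum>Y\<in>U. r Y ^ 2) * card U)" using cR2 by simp
    then have "card R ^ 2 \<le> (\<Sum>Y\<in>U. r Y ^ 2) * card U" by (simp only: of_nat_le_iff)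
    also have "\<dots> \<le> (card F * card E) * card U" by (rule mult_right_mono[OF sq]) simp
    finally show ?thesis by (simp add: mult.commute)
  qed
  finally have "card F * (card F * \<beta> ^ 2) \<le> card F * (card U * card E)"
    by (simp add: power2_eq_square algebra_simps)
  then have "card F = 0 \<or> card F * \<beta> ^ 2 \<le> card U * card E" by (cases "card F = 0") auto
  then have "card F * \<beta> ^ 2 \<le> card U * card E" by auto
  also have "\<dots> \<le> 2 ^ card L * ((k + 1) * (card (P - L) choose (card (P - L) div 2))) * card E"
    by (rule mult_right_mono[OF cU]) simp
  finally show ?thesis by (simp add: \<beta>_def E_def subset_energy_def)
qed

text \<open>\<open>L\<close> is the lighter half of P and \<open>t\<close> its largest weight. A set
  or its complement misses at least half of \<open>L\<close>, and complements replace x by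
  \<open>sum c P - x\<close>; two applications of the shadow bound therefore suffice, which turns
  its constant 2 into 4. The factor \<open>(8 * real k) ^ (2 * k)\<close> comes from squaring the
  lower bound \<open>(N / (8 k))^k\<close> for the number of k-subsets of a set with at least N/8
  elements.\<close>

lemma card_equal_sums_pos:
  fixes c :: "'a \<Rightarrow> real"
  assumes fin: "finite P" and N: "card P = N" "N \<ge> 4 * k" "k \<ge> 1" and pos: "\<And>p. p \<in> P \<Longrightarrow> c p > 0"
  shows "card {X. X \<subseteq> P \<and> sum c X = x}
     \<le> 4 * (real k + 1) * (8 * real k) ^ (2 * k) * 2 ^ N / sqrt N * (subset_energy c P k / real N ^ (2 * k))"
proof -
  define h where "h = N div 2"
  obtain L where L: "L \<subseteq> P" "card L = h" "\<And>p q. p \<in> L \<Longrightarrow> q \<in> P - L \<Longrightarrow> c p \<le> c q"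
    using exists_lower_subset[OF fin, of h c] N by (auto simp: h_def)
  have finL: "finite L" by (rule finite_subset[OF _ fin]) (use L in auto)
  have cH: "card (P - L) = N - h" using L fin N finL by (simp add: card_Diff_subset)
  have h1: "h \<ge> 1" "N - h \<ge> 1" using N by (auto simp: h_def)
  have Lne: "L \<noteq> {}" using L(2) h1 by auto
  define t where "t = Max (c ` L)"
  have t: "t > 0" "\<And>p. p \<in> L \<Longrightarrow> c p \<le> t" "\<And>q. q \<in> P - L \<Longrightarrow> t \<le> c q"
  proof -
    have "t \<in> c ` L" unfolding t_def using Lne finL by (intro Max_in) auto
    then show "t > 0" "\<And>q. q \<in> P - L \<Longrightarrow> t \<le> c q" using L pos by auto
    show "\<And>p. p \<in> L \<Longrightarrow> c p \<le> t" unfolding t_def using finL by (intro Max_ge) auto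
  qed
  define F where "F y = {X. X \<subseteq> P \<and> sum c X = y \<and> card L \<le> 2 * card (L - X)}" for y
  define \<beta> where "\<beta> = ((h + 1) div 2) choose k"
  have finF: "finite (F y)" for y by (rule finite_subset[of _ "Pow P"]) (auto simp: F_def fin)
  have \<beta>: "real \<beta> \<ge> (real N / (8 * real k)) ^ k"
  proof -
    have "(real N / (8 * real k)) ^ k \<le> (real ((h + 1) div 2) / real k) ^ k"
    proof (intro power_mono)
      have "N \<le> 8 * ((h + 1) div 2)"
      proof -
        have "N \<ge> 4" using N(2,3) by linarith
        then have "N \<le> 2 * h + 1" "h \<ge> 2" unfolding h_def by linarith+
        then show ?thesis by linarith
      qed
      then have "real N \<le> 8 * real ((h + 1) div 2)" by linarith
      then show "real N / (8 * real k) \<le> real ((h + 1) div 2) / real k" using N(3) by (simp add: field_simps)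
    qed simp
    also have "\<dots> \<le> real \<beta>" unfolding \<beta>_def
      by (rule binomial_ge_n_over_k_pow_k) (use N(2) h_def in linarith)
    finally show ?thesis .
  qed
  have Fb: "real (card (F y)) \<le> 2 * (real k + 1) * (8 * real k) ^ (2 * k) * 2 ^ N / sqrt N * (subset_energy c P k / real N ^ (2 * k))" for y
  proof -
    have b0: "(real N / (8 * real k)) ^ (2 * k) > 0" using N by simp
    have "card (F y) * \<beta> ^ 2 \<le> 2 ^ h * ((k + 1) * ((N - h) choose ((N - h) div 2))) * subset_energy c P k"
      using card_equal_sums_via_shadow[OF fin L(1) pos t, where x = y and k = k]
      unfolding F_def \<beta>_def L(2) cH .
    then have "real (card (F y) * \<beta> ^ 2) \<le> real (2 ^ h * ((k + 1) * ((N - h) choose ((N - h) div 2))) * subset_energy c P k)"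
      by (simp only: of_nat_le_iff)
    also have "\<dots> = 2 ^ h * ((real k + 1) * real ((N - h) choose ((N - h) div 2))) * subset_energy c P k"
      by (simp add: algebra_simps)
    also have "\<dots> \<le> 2 ^ h * ((real k + 1) * (2 ^ (N - h) * 2 / sqrt N)) * subset_energy c P k"
    proof (intro mult_right_mono mult_left_mono)
      have "real ((N - h) choose ((N - h) div 2)) \<le> 2 ^ (N - h) / sqrt (real (N - h) + 1)"
        by (rule central_binomial_upper)
      also have "\<dots> \<le> 2 ^ (N - h) / (sqrt N / 2)"
      proof (intro divide_left_mono)
        have "sqrt N / 2 = sqrt (N / 4)" by (simp add: real_sqrt_divide)
        also have "\<dots> \<le> sqrt (real (N - h) + 1)" by (simp add: h_def)
        finally show "sqrt N / 2 \<le> sqrt (real (N - h) + 1)" .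
      qed (use N in auto)
      finally show "real ((N - h) choose ((N - h) div 2)) \<le> 2 ^ (N - h) * 2 / sqrt N" by simp
    qed auto
    also have "\<dots> = 2 * (real k + 1) * 2 ^ N / sqrt N * subset_energy c P k"
    proof -
      have "(2::real) ^ h * 2 ^ (N - h) = 2 ^ N" by (simp add: h_def flip: power_add)
      then show ?thesis by (simp add: field_simps)
    qed
    finally have "real (card (F y)) * real \<beta> ^ 2 \<le> 2 * (real k + 1) * 2 ^ N / sqrt N * subset_energy c P k" by simp
    moreover have "real (card (F y)) * (real N / (8 * real k)) ^ (2 * k) \<le> real (card (F y)) * real \<beta> ^ 2"
    proof (intro mult_left_mono)
      have "((real N / (8 * real k)) ^ k) ^ 2 \<le> real \<beta> ^ 2" by (intro power_mono \<beta>) simp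
      then show "(real N / (8 * real k)) ^ (2 * k) \<le> real \<beta> ^ 2" unfolding power_mult[symmetric] by (simp only: mult.commute)
    qed simp
    ultimately have "real (card (F y)) * (real N / (8 * real k)) ^ (2 * k) \<le> 2 * (real k + 1) * 2 ^ N / sqrt N * subset_energy c P k"
      by linarith
    then have "real (card (F y)) \<le> 2 * (real k + 1) * 2 ^ N / sqrt N * subset_energy c P k / (real N / (8 * real k)) ^ (2 * k)"
      using b0 by (simp only: pos_le_divide_eq)
    also have "\<dots> = 2 * (real k + 1) * (8 * real k) ^ (2 * k) * 2 ^ N / sqrt N * (subset_energy c P k / real N ^ (2 * k))"
    proof -
      have "a / (u / v) = v * a / u" "v * b * c = b * v * c" for a b c u v :: real by simp_all
      then show ?thesis unfolding power_divide by (simp only: times_divide_eq_right times_divide_eq_left mult.assoc)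
    qed
    finally show ?thesis .
  qed
  have "{X. X \<subseteq> P \<and> sum c X = x} \<subseteq> F x \<union> (\<lambda>X. P - X) ` F (sum c P - x)"
  proof
    fix X assume "X \<in> {X. X \<subseteq> P \<and> sum c X = x}"
    then have X: "X \<subseteq> P" "sum c X = x" by auto
    show "X \<in> F x \<union> (\<lambda>X. P - X) ` F (sum c P - x)"
    proof (cases "card L \<le> 2 * card (L - X)")
      case True then show ?thesis using X by (auto simp: F_def)
    next
      case False
      have "card (L - X) + card (L \<inter> X) = card L" using card_Int_Diff[OF finL, of X] by simp
      moreover have "L - (P - X) = L \<inter> X" using L by auto
      ultimately have "card L \<le> 2 * card (L - (P - X))" using False by simp
      moreover have "sum c (P - X) = sum c P - x" using sum_diff[OF fin X(1), of c] X(2) by simp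
      ultimately have "P - X \<in> F (sum c P - x)" by (simp add: F_def)
      moreover have "X = P - (P - X)" using X by auto
      ultimately show ?thesis by blast
    qed
  qed
  then have "card {X. X \<subseteq> P \<and> sum c X = x} \<le> card (F x \<union> (\<lambda>X. P - X) ` F (sum c P - x))"
    using finF by (intro card_mono) auto
  also have "\<dots> \<le> card (F x) + card ((\<lambda>X. P - X) ` F (sum c P - x))" by (rule card_Un_le)
  also have "\<dots> \<le> card (F x) + card (F (sum c P - x))" using finF by (intro add_mono card_image_le) auto
  finally have "real (card {X. X \<subseteq> P \<and> sum c X = x}) \<le> real (card (F x)) + real (card (F (sum c P - x)))" by linarith
  also have "\<dots> \<le> 2 * (2 * (real k + 1) * (8 * real k) ^ (2 * k) * 2 ^ N / sqrt N * (subset_energy c P k / real N ^ (2 * k)))"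
    using add_mono[OF Fb[of x] Fb[of "sum c P - x"]] by (simp only: mult_2)
  finally show ?thesis by (simp only: times_divide_eq_right mult.assoc[symmetric])
qed

text \<open>Flipping the membership of every element of negative weight replaces w by its absolute value.\<close>
lemma card_equal_sums:
  fixes w :: "'a \<Rightarrow> real"
  assumes fin: "finite P" and N: "card P = N" "N \<ge> 4 * k" "k \<ge> 1" and nz: "\<And>p. p \<in> P \<Longrightarrow> w p \<noteq> 0"
  shows "card {X. X \<subseteq> P \<and> sum w X = x}
     \<le> 4 * (real k + 1) * (8 * real k) ^ (2 * k) * 2 ^ N / sqrt N
        * (subset_energy (\<lambda>p. \<bar>w p\<bar>) P k / real N ^ (2 * k))"
proof -
  define Z where "Z = {p \<in> P. w p < 0}"
  define y where "y = x - sum w Z"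
  have "card {X. X \<subseteq> P \<and> sum w X = x} \<le> card {X. X \<subseteq> P \<and> (\<Sum>p\<in>X. \<bar>w p\<bar>) = y}"
  proof (rule card_inj_on_le)
    show "inj_on (\<lambda>X. (X - Z) \<union> (Z - X)) {X. X \<subseteq> P \<and> sum w X = x}" by (auto simp: inj_on_def)
    show "(\<lambda>X. (X - Z) \<union> (Z - X)) ` {X. X \<subseteq> P \<and> sum w X = x} \<subseteq> {X. X \<subseteq> P \<and> (\<Sum>p\<in>X. \<bar>w p\<bar>) = y}"
    proof
      fix Y assume "Y \<in> (\<lambda>X. (X - Z) \<union> (Z - X)) ` {X. X \<subseteq> P \<and> sum w X = x}"
      then obtain X where X: "X \<subseteq> P" "sum w X = x" and Y: "Y = (X - Z) \<union> (Z - X)" by auto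
      have f: "finite X" "finite Z" using finite_subset[OF X(1) fin] fin by (auto simp: Z_def)
      have "(\<Sum>p\<in>(X - Z) \<union> (Z - X). \<bar>w p\<bar>) = (\<Sum>p\<in>X - Z. \<bar>w p\<bar>) + (\<Sum>p\<in>Z - X. \<bar>w p\<bar>)"
        using f by (intro sum.union_disjoint) auto
      also have "(\<Sum>p\<in>X - Z. \<bar>w p\<bar>) = sum w (X - Z)" using X by (intro sum.cong) (auto simp: Z_def)
      also have "(\<Sum>p\<in>Z - X. \<bar>w p\<bar>) = - sum w (Z - X)"
        unfolding sum_negf[symmetric] by (intro sum.cong) (auto simp: Z_def)
      also have "sum w (X - Z) + - sum w (Z - X) = sum w X - sum w Z"
        using sum.Int_Diff[OF f(1), of w Z] sum.Int_Diff[OF f(2), of w X] by (simp add: Int_commute)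
      finally show "Y \<in> {X. X \<subseteq> P \<and> (\<Sum>p\<in>X. \<bar>w p\<bar>) = y}"
        using X by (auto simp: Z_def Y y_def)
    qed
    show "finite {X. X \<subseteq> P \<and> (\<Sum>p\<in>X. \<bar>w p\<bar>) = y}" using fin by simp
  qed
  then have "real (card {X. X \<subseteq> P \<and> sum w X = x}) \<le> real (card {X. X \<subseteq> P \<and> (\<Sum>p\<in>X. \<bar>w p\<bar>) = y})" by simp
  also have "\<dots> \<le> 4 * (real k + 1) * (8 * real k) ^ (2 * k) * 2 ^ N / sqrt N
        * (subset_energy (\<lambda>p. \<bar>w p\<bar>) P k / real N ^ (2 * k))"
    by (rule card_equal_sums_pos[OF fin N]) (use nz in auto)
  finally show ?thesis .
qed

section \<open>Incidences of lines with Cartesian products\<close>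

text \<open>One element is chosen in every fibre of \<open>h\<close>; every other element forms a
  colliding pair with the chosen one.\<close>

lemma card_le_card_image_plus_collisions:
  assumes "finite X"
  shows "card X \<le> card (h ` X) + card {(x, x'). x \<in> X \<and> x' \<in> X \<and> x \<noteq> x' \<and> h x = h x'}"
proof -
  define r where "r = inv_into X h"
  have r: "r (h x) \<in> X" "h (r (h x)) = h x" if "x \<in> X" for x
    using that by (auto simp: r_def inv_into_into f_inv_into_f)
  let ?C = "{(x, x'). x \<in> X \<and> x' \<in> X \<and> x \<noteq> x' \<and> h x = h x'}"
  have fC: "finite ?C" by (rule finite_subset[of _ "X \<times> X"]) (auto simp: assms)
  have "X \<subseteq> r ` h ` X \<union> fst ` ?C"
  proof
    fix x assume x: "x \<in> X"
    show "x \<in> r ` h ` X \<union> fst ` ?C"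
    proof (cases "x = r (h x)")
      case True then show ?thesis using x by auto
    next
      case False
      then have "(x, r (h x)) \<in> ?C" using r[OF x] x by auto
      then show ?thesis by force
    qed
  qed
  then have "card X \<le> card (r ` h ` X \<union> fst ` ?C)" using fC assms by (intro card_mono) auto
  also have "\<dots> \<le> card (r ` h ` X) + card (fst ` ?C)" by (rule card_Un_le)
  also have "\<dots> \<le> card (h ` X) + card ?C" using fC assms by (intro add_mono card_image_le) auto
  finally show ?thesis .
qed

text \<open>Ranks replace real coordinates: \<open>rank_in A x div u\<close> cuts A into consecutive
  blocks of at most u elements, however A is spaced, and respects the order.\<close>

definition rank_in :: "real set \<Rightarrow> real \<Rightarrow> nat" where
  "rank_in A x = card {a \<in> A. a < x}"

lemma rank_in_mono: "finite A \<Longrightarrow> x \<le> y \<Longrightarrow> rank_in A x \<le> rank_in A y"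
  unfolding rank_in_def by (rule card_mono) auto

lemma rank_in_less: "finite A \<Longrightarrow> x \<in> A \<Longrightarrow> rank_in A x < card A"
  unfolding rank_in_def by (rule psubset_card_mono) auto

lemma rank_in_strict: "finite A \<Longrightarrow> x \<in> A \<Longrightarrow> x < y \<Longrightarrow> rank_in A x < rank_in A y"
  unfolding rank_in_def by (rule psubset_card_mono) auto

lemma inj_on_rank_in: "finite A \<Longrightarrow> inj_on (rank_in A) A"
  by (rule inj_onI) (metis rank_in_strict linorder_neq_iff)

lemma card_rank_block:
  assumes "finite A" "u \<ge> 1"
  shows "card {x \<in> A. rank_in A x div u = q} \<le> u"
proof -
  have "card {x \<in> A. rank_in A x div u = q} = card (rank_in A ` {x \<in> A. rank_in A x div u = q})"
    by (rule card_image[symmetric]) (use inj_on_rank_in[OF assms(1)] in \<open>auto simp: inj_on_def\<close>)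
  also have "\<dots> \<le> card {q * u ..< q * u + u}"
  proof (intro card_mono subsetI)
    fix y assume "y \<in> rank_in A ` {x \<in> A. rank_in A x div u = q}"
    then have "y div u = q" by auto
    then have "y = q * u + y mod u" by (metis div_mult_mod_eq)
    moreover have "y mod u < u" using assms(2) by simp
    ultimately show "y \<in> {q * u ..< q * u + u}" by auto
  qed simp
  finally show ?thesis by simp
qed

text \<open>A Szemeredi--Trotter bound for the lines y = z + d x and a Cartesian product of points.
  A line of positive slope is monotone, hence traverses the cells of the grid of rank blocks of
  size u by w along a staircase; two points of one cell determine the line.\<close>
lemma grid_incidence_bound:
  fixes A S D V :: "real set" and u w :: nat
  assumes fin: "finite A" "finite S" "finite D" "finite V" and u: "u \<ge> 1" and w: "w \<ge> 1"
    and D: "\<And>d. d \<in> D \<Longrightarrow> d > 0"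
  shows "card {(z, d, x). z \<in> S \<and> d \<in> D \<and> x \<in> A \<and> z + d * x \<in> V}
     \<le> card S * card D * (card A div u + card V div w + 1) + card A * card V * u * w"
proof -
  define X where "X = (\<lambda>(z, d). {x \<in> A. z + d * x \<in> V})"
  \<comment> \<open>The sum of both block indices. Along a line of positive slope the two indices
    grow together, so equal sums mean equal cells, and at most
    \<open>card A div u + card V div w + 1\<close> values occur.\<close>
  define h where "h = (\<lambda>(z, d) x. rank_in A x div u + rank_in V (z + d * x) div w)"
  define C where "C l = {(x, x'). x \<in> X l \<and> x' \<in> X l \<and> x \<noteq> x' \<and> h l x = h l x'}" for l
  have fX: "finite (X l)" for l using fin by (auto simp: X_def split: prod.split)
  have fC: "finite (C l)" for l
    by (rule finite_subset[of _ "X l \<times> X l"]) (auto simp: fX C_def)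
  have "{(z, d, x). z \<in> S \<and> d \<in> D \<and> x \<in> A \<and> z + d * x \<in> V}
      = (\<lambda>((z, d), x). (z, d, x)) ` (SIGMA l:S \<times> D. X l)" by (force simp: X_def image_iff)
  then have "card {(z, d, x). z \<in> S \<and> d \<in> D \<and> x \<in> A \<and> z + d * x \<in> V} \<le> card (SIGMA l:S \<times> D. X l)"
    using fin fX by (metis (no_types, lifting) card_image_le finite_SigmaI)
  also have "\<dots> = (\<Sum>l\<in>S \<times> D. card (X l))" using fin fX by (simp)
  also have "\<dots> \<le> (\<Sum>l\<in>S \<times> D. (card A div u + card V div w + 1) + card (C l))"
  proof (rule sum_mono)
    fix l assume "l \<in> S \<times> D"
    have "h l ` X l \<subseteq> {..card A div u + card V div w}"
    proof
      fix t assume "t \<in> h l ` X l"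
      then obtain x where x: "x \<in> X l" "t = h l x" by auto
      obtain z d where l: "l = (z, d)" by force
      have "rank_in A x \<le> card A" "rank_in V (z + d * x) \<le> card V"
        using rank_in_less[OF fin(1), of x] rank_in_less[OF fin(4), of "z + d * x"] x l by (auto simp: X_def)
      then show "t \<in> {..card A div u + card V div w}" using x l
        by (auto simp: h_def intro!: add_mono div_le_mono)
    qed
    then have "card (h l ` X l) \<le> card {..card A div u + card V div w}" by (intro card_mono) auto
    then show "card (X l) \<le> (card A div u + card V div w + 1) + card (C l)"
      using card_le_card_image_plus_collisions[OF fX, of l "h l"] unfolding C_def by simp
  qed
  also have "\<dots> = card S * card D * (card A div u + card V div w + 1) + (\<Sum>l\<in>S \<times> D. card (C l))"
    by (subst sum.distrib) (simp add: card_cartesian_product)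
  also have "(\<Sum>l\<in>S \<times> D. card (C l)) = card (SIGMA l:S \<times> D. C l)" using fin fC by simp
  also have "card (SIGMA l:S \<times> D. C l) \<le> card (SIGMA p:A \<times> V.
      {x' \<in> A. rank_in A x' div u = rank_in A (fst p) div u} \<times> {v \<in> V. rank_in V v div w = rank_in V (snd p) div w})"
    (is "_ \<le> card ?T")
  proof (rule card_inj_on_le)
    \<comment> \<open>Two points with distinct abscissas lie on one line only. A collision is thus
      determined by an ordered pair of points of the same cell.\<close>
    show "inj_on (\<lambda>((z, d), (x, x')). ((x, z + d * x), (x', z + d * x'))) (SIGMA l:S \<times> D. C l)"
    proof (rule inj_onI)
      fix p q assume pq: "p \<in> (SIGMA l:S \<times> D. C l)" "q \<in> (SIGMA l:S \<times> D. C l)"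
        "(\<lambda>((z, d), (x, x')). ((x, z + d * x), (x', z + d * x'))) p
          = (\<lambda>((z, d), (x, x')). ((x, z + d * x), (x', z + d * x'))) q"
      obtain z d x x' where p: "p = ((z, d), (x, x'))" by (metis surj_pair)
      obtain z2 d2 y y' where q: "q = ((z2, d2), (y, y'))" by (metis surj_pair)
      have e: "y = x" "y' = x'" "z + d * x = z2 + d2 * x" "z + d * x' = z2 + d2 * x'"
        using pq(3) by (auto simp: p q)
      have "(d - d2) * (x - x') = 0" using e by (simp add: algebra_simps)
      then have "d = d2" using pq(1) by (auto simp: p C_def)
      then show "p = q" using e by (simp add: p q)
    qed
    show "(\<lambda>((z, d), (x, x')). ((x, z + d * x), (x', z + d * x'))) ` (SIGMA l:S \<times> D. C l) \<subseteq> ?T"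
    proof
      fix t assume "t \<in> (\<lambda>((z, d), (x, x')). ((x, z + d * x), (x', z + d * x'))) ` (SIGMA l:S \<times> D. C l)"
      then obtain z d x x' where t: "t = ((x, z + d * x), (x', z + d * x'))"
        and zd: "z \<in> S" "d \<in> D" and c: "(x, x') \<in> C (z, d)" by auto
      have m: "x \<in> A" "x' \<in> A" "z + d * x \<in> V" "z + d * x' \<in> V" and
        e: "rank_in A x div u + rank_in V (z + d * x) div w = rank_in A x' div u + rank_in V (z + d * x') div w"
        using c by (auto simp: C_def X_def h_def)
      have d: "d > 0" using D zd by auto
      have "rank_in A x div u = rank_in A x' div u \<and> rank_in V (z + d * x) div w = rank_in V (z + d * x') div w"
      proof (cases "x \<le> x'")
        case True
        then have "rank_in A x div u \<le> rank_in A x' div u" "rank_in V (z + d * x) div w \<le> rank_in V (z + d * x') div w"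
          using d by (auto intro!: div_le_mono rank_in_mono fin)
        then show ?thesis using e by linarith
      next
        case False
        then have "rank_in A x' div u \<le> rank_in A x div u" "rank_in V (z + d * x') div w \<le> rank_in V (z + d * x) div w"
          using d by (auto intro!: div_le_mono rank_in_mono fin)
        then show ?thesis using e by linarith
      qed
      then show "t \<in> ?T" unfolding t using m by auto
    qed
    show "finite ?T" using fin by auto
  qed
  also have "card ?T = (\<Sum>p\<in>A \<times> V. card {x' \<in> A. rank_in A x' div u = rank_in A (fst p) div u} *
        card {v \<in> V. rank_in V v div w = rank_in V (snd p) div w})"
    using fin by (simp add: card_cartesian_product)
  also have "\<dots> \<le> (\<Sum>p\<in>A \<times> V. u * w)"
    by (intro sum_mono mult_mono card_rank_block fin u w) auto
  also have "\<dots> = card A * card V * u * w" by (simp add: card_cartesian_product)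
  finally show ?thesis by simp
qed

text \<open>The block sizes in \<open>grid_incidence_bound\<close> are chosen so that two of its
  terms are absorbed by the incidences that \<open>rich\<close> provides: \<open>w\<close> near
  \<open>6 s / (\<theta> n)\<close> makes the term with \<open>v / w\<close> at most a sixth of
  them, and \<open>u\<close> near \<open>\<theta> l / (2 w)\<close> makes the term from pairs of
  points at most half. The remaining third bounds \<open>card V\<close>.\<close>

lemma rich_points_bound:
  fixes A S D V :: "real set" and n l :: nat and \<theta> :: real
  assumes fin: "finite A" "finite S" "finite D" "finite V"
    and D: "\<And>d. d \<in> D \<Longrightarrow> d > 0"
    and n: "card A \<le> n" "n \<ge> 1" and l: "card D \<le> l" "l \<ge> 1" and \<theta>: "0 < \<theta>"
    and rich: "\<theta> * n * l * card V \<le> card {(z, d, x). z \<in> S \<and> d \<in> D \<and> x \<in> A \<and> z + d * x \<in> V}"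
  shows "card V \<le> 72 * (real (card S) ^ 2 / (\<theta>^3 * n * l) + card S / (\<theta>^2 * l) + card S / (\<theta> * n))"
proof -
  define s where "s = real (card S)"
  define v where "v = real (card V)"
  define I where "I = {(z, d, x). z \<in> S \<and> d \<in> D \<and> x \<in> A \<and> z + d * x \<in> V}"
  have pos: "real n > 0" "real l > 0" "s \<ge> 0" "v \<ge> 0" using n l by (auto simp: s_def v_def)
  define w where "w = nat \<lfloor>6 * s / (\<theta> * n)\<rfloor> + 1"
  define u where "u = nat \<lfloor>\<theta> * l / (2 * w)\<rfloor>"
  have q0: "6 * s / (\<theta> * n) \<ge> 0" using pos \<theta> by simp
  have w1: "w \<ge> 1" by (simp add: w_def)
  have w2: "real w \<ge> 6 * s / (\<theta> * n)" "real w \<le> 6 * s / (\<theta> * n) + 1"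
    using q0 unfolding w_def by linarith+
  have wp: "real w > 0" using w1 by simp
  have "v \<le> 72 * (s ^ 2 / (\<theta>^3 * n * l) + s / (\<theta>^2 * l) + s / (\<theta> * n))"
  proof (cases "u \<ge> 1")
    case True
    have y1: "\<theta> * l / (2 * w) \<ge> 1" using True unfolding u_def by linarith
    have u1: "real u \<le> \<theta> * l / (2 * w)" and u2: "\<theta> * l / (4 * w) \<le> real u"
    proof -
      show "real u \<le> \<theta> * l / (2 * w)" using y1 unfolding u_def by linarith
      have "y / 2 \<le> real (nat \<lfloor>y\<rfloor>)" if "y \<ge> 1" for y :: real
      proof -
        have "\<lfloor>y\<rfloor> \<ge> 1" using that by simp
        moreover have "y < of_int \<lfloor>y\<rfloor> + 1" by linarith
        moreover have "real (nat \<lfloor>y\<rfloor>) = of_int \<lfloor>y\<rfloor>" using that by simp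
        moreover have "(1::real) \<le> of_int \<lfloor>y\<rfloor>" using that by simp
        ultimately show ?thesis by linarith
      qed
      from this[OF y1] show "\<theta> * l / (4 * w) \<le> real u" unfolding u_def by simp
    qed
    have up: "real u > 0" using True by simp
    have uw: "real u * real w \<le> \<theta> * l / 2" using u1 wp by (simp add: field_simps)
    have "real (card I) \<le> real (card S * card D * (card A div u + card V div w + 1) + card A * card V * u * w)"
      unfolding I_def of_nat_le_iff by (rule grid_incidence_bound) (use fin D True w1 in auto)
    also have "\<dots> = s * card D * (real (card A div u) + real (card V div w) + 1) + card A * v * (real u * real w)"
      by (simp add: s_def v_def algebra_simps)
    also have "\<dots> \<le> s * l * (n / u + v / w + 1) + n * v * (\<theta> * l / 2)"
    proof (intro add_mono mult_mono order_refl)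
      show "real (card A div u) \<le> n / u"
        using n(1) up of_nat_div_le_of_nat[of "card A" u, where ?'a = real]
        by (meson divide_right_mono of_nat_0_le_iff of_nat_le_iff order_trans)
      show "real (card V div w) \<le> v / w" unfolding v_def by (rule of_nat_div_le_of_nat)
    qed (use pos l n uw wp up in auto)
    finally have "\<theta> * n * l * v \<le> s * l * (n / u + v / w + 1) + n * v * (\<theta> * l / 2)"
      using rich by (simp add: I_def v_def)
    then have "l * (\<theta> * n * v) \<le> l * (s * (n / u + v / w + 1) + n * v * (\<theta> / 2))" by (simp add: algebra_simps)
    then have "\<theta> * n * v \<le> s * (n / u + v / w + 1) + n * v * (\<theta> / 2)" by (rule mult_left_le_imp_le) (use pos in simp)
    moreover have "s * (n / u + v / w + 1) + n * v * (\<theta> / 2) = s * n / u + s * v / w + s + \<theta> * n * v / 2"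
      by (simp add: algebra_simps)
    ultimately have a1: "\<theta> * n * v / 2 \<le> s * n / u + s * v / w + s" by linarith
    have a2: "s * v / w \<le> \<theta> * n * v / 6"
    proof -
      have "6 * s \<le> w * (\<theta> * n)" using w2(1) pos \<theta> by (simp add: pos_divide_le_eq)
      then have "6 * s * v \<le> w * (\<theta> * n) * v" by (rule mult_right_mono) (use pos in simp)
      then show ?thesis using wp by (simp add: field_simps)
    qed
    have a3: "s * n / u \<le> s * n * (4 * w / (\<theta> * l))"
    proof -
      have "1 / real u \<le> 4 * w / (\<theta> * l)" using u2 up wp \<theta> pos by (simp add: field_simps)
      then have "s * n * (1 / real u) \<le> s * n * (4 * w / (\<theta> * l))" by (rule mult_left_mono) (use pos in simp)
      then show ?thesis by simp
    qed
    have "\<theta> * n * v \<le> 3 * (s * n * (4 * w / (\<theta> * l))) + 3 * s" using a1 a2 a3 by linarith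
    then have "v \<le> (3 * (s * n * (4 * w / (\<theta> * l))) + 3 * s) / (\<theta> * n)"
      using \<theta> pos by (simp add: pos_le_divide_eq mult.commute)
    also have "\<dots> = 12 * s / (\<theta>^2 * l) * w + 3 * s / (\<theta> * n)"
      using \<theta> pos by (simp add: field_simps power2_eq_square)
    also have "\<dots> \<le> 12 * s / (\<theta>^2 * l) * (6 * s / (\<theta> * n) + 1) + 3 * s / (\<theta> * n)"
      by (intro add_mono mult_left_mono w2) (use pos in auto)
    also have "\<dots> = 72 * (s ^ 2 / (\<theta>^3 * n * l)) + 12 * (s / (\<theta>^2 * l)) + 3 * (s / (\<theta> * n))"
      using \<theta> pos by (simp add: field_simps power2_eq_square power3_eq_cube)
    also have "\<dots> \<le> 72 * (s ^ 2 / (\<theta>^3 * n * l)) + 72 * (s / (\<theta>^2 * l)) + 72 * (s / (\<theta> * n))"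
      using pos \<theta> by (intro add_mono mult_right_mono) auto
    finally show ?thesis by (simp add: algebra_simps)
  next
    \<comment> \<open>No positive block size \<open>u\<close> fits. In this case
      \<open>\<theta> * l\<close> is less than \<open>2 * w\<close>, and the trivial count of at
      most \<open>card S * l * n\<close> incidences gives the claim.\<close>
    case False
    then have "\<theta> * l / (2 * w) < 1" unfolding u_def by linarith
    then have "\<theta> * l < 2 * w" using wp by (simp add: field_simps)
    then have "\<theta> * l \<le> 12 * s / (\<theta> * n) + 2"
    proof -
      have "12 * s / (\<theta> * n) = 2 * (6 * s / (\<theta> * n))" by simp
      then show ?thesis using w2(2) \<open>\<theta> * l < 2 * w\<close> by simp
    qed
    then have b: "1 \<le> (12 * s / (\<theta> * n) + 2) / (\<theta> * l)" using \<theta> pos by (simp add: pos_le_divide_eq)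
    have "card I \<le> card (S \<times> D \<times> A)" unfolding I_def by (intro card_mono) (use fin in auto)
    also have "\<dots> \<le> card S * (l * n)"
      unfolding card_cartesian_product by (intro mult_mono) (use n l in auto)
    finally have "real (card I) \<le> s * (l * n)" unfolding s_def by (metis of_nat_le_iff of_nat_mult)
    then have "\<theta> * n * l * v \<le> s * (l * n)" using rich by (simp add: I_def v_def)
    then have "(n * l) * (\<theta> * v) \<le> (n * l) * s" by (simp add: algebra_simps)
    then have "\<theta> * v \<le> s" by (rule mult_left_le_imp_le) (use pos in simp)
    then have "v \<le> s / \<theta> * 1" using \<theta> by (simp add: field_simps)
    also have "\<dots> \<le> s / \<theta> * ((12 * s / (\<theta> * n) + 2) / (\<theta> * l))"
      by (intro mult_left_mono b) (use pos \<theta> in auto)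
    also have "\<dots> = 12 * (s ^ 2 / (\<theta>^3 * n * l)) + 2 * (s / (\<theta>^2 * l))"
      using \<theta> pos by (simp add: field_simps power2_eq_square power3_eq_cube)
    also have "\<dots> \<le> 72 * (s ^ 2 / (\<theta>^3 * n * l)) + 72 * (s / (\<theta>^2 * l)) + 72 * (s / (\<theta> * n))"
    proof -
      have "s ^ 2 / (\<theta>^3 * n * l) \<ge> 0" "s / (\<theta>^2 * l) \<ge> 0" "s / (\<theta> * n) \<ge> 0" using pos \<theta> by auto
      moreover have "12 * x + 2 * y \<le> 72 * x + 72 * y + 72 * z" if "x \<ge> 0" "y \<ge> 0" "z \<ge> 0" for x y z :: real
        using that by linarith
      ultimately show ?thesis by blast
    qed
    finally show ?thesis by (simp add: algebra_simps)
  qed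
  then show ?thesis by (simp add: s_def v_def)
qed

text \<open>Markov's inequality. Finiteness is a separate conclusion because \<open>card\<close> of
  an infinite set is 0, so that the bound alone would say nothing about such a set.\<close>

lemma level_set_bound:
  fixes q :: "'a \<Rightarrow> real"
  assumes "\<And>S. finite S \<Longrightarrow> sum q S \<le> 1" "\<tau> > 0"
  shows "finite {z. q z \<ge> \<tau>}" "\<tau> * card {z. q z \<ge> \<tau>} \<le> 1"
proof -
  have b: "\<tau> * card B \<le> 1" if "finite B" "B \<subseteq> {z. q z \<ge> \<tau>}" for B
  proof -
    have "\<tau> * card B = (\<Sum>z\<in>B. \<tau>)" by simp
    also have "\<dots> \<le> sum q B" by (rule sum_mono) (use that in auto)
    finally show ?thesis using assms(1)[OF that(1)] by linarith
  qed
  show "finite {z. q z \<ge> \<tau>}"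
  proof (rule ccontr)
    assume "infinite {z. q z \<ge> \<tau>}"
    then obtain B where B: "finite B" "card B = nat \<lceil>1 / \<tau>\<rceil> + 1" "B \<subseteq> {z. q z \<ge> \<tau>}"
      using infinite_arbitrarily_large by blast
    have "real (card B) > 1 / \<tau>" unfolding B(2) by linarith
    then have "\<tau> * card B > 1" using assms(2) by (simp add: field_simps)
    then show False using b[OF B(1,3)] by simp
  qed
  then show "\<tau> * card {z. q z \<ge> \<tau>} \<le> 1" using b by blast
qed

lemma dyadic_level:
  fixes t x :: real
  assumes "t \<le> x" "x < 2 ^ J * t"
  obtains j where "j < J" "2 ^ j * t \<le> x" "x < 2 * (2 ^ j * t)"
proof -
  have "\<exists>j<J. 2 ^ j * t \<le> x \<and> x < 2 * (2 ^ j * t)"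
    using assms
  proof (induction J)
    case (Suc J)
    show ?case
    proof (cases "x < 2 ^ J * t")
      case True
      then show ?thesis using Suc.IH[OF Suc.prems(1)] less_Suc_eq by blast
    next
      case False
      then show ?thesis using Suc.prems(2) by (intro exI[of _ J]) (auto simp: mult.assoc)
    qed
  qed auto
  then show ?thesis using that by blast
qed

text \<open>The incidence bound converts a weak L2 bound for the law of Z into a better one for the law of
  Z + a d; the gain fails only below the target level 1/(n l).\<close>
lemma weak_L2_step:
  fixes q q' :: "real \<Rightarrow> real" and A D :: "real set" and n l J :: nat and \<tau> \<tau>0 \<Phi> :: real
  assumes fin: "finite A" "finite D" and D: "\<And>d. d \<in> D \<Longrightarrow> d > 0"
    and n: "card A \<le> n" "n \<ge> 1" and l: "card D \<le> l" "l \<ge> 1"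
    and q: "\<And>z. q z \<ge> 0" "\<And>S. finite S \<Longrightarrow> sum q S \<le> 1"
    and q': "\<And>v. q' v \<le> 2 / (real n * real l) * (\<Sum>a\<in>A. \<Sum>d\<in>D. q (v - d * a))"
    and \<tau>0: "\<tau>0 > 0" and lev: "\<And>\<tau>::real. \<tau> \<ge> \<tau>0 \<Longrightarrow> \<tau>^2 * card {z. q z \<ge> \<tau>} \<le> \<Phi>"
    and \<tau>: "\<tau> \<ge> 4 * \<tau>0" and J: "J \<ge> 1" "2 ^ J * (\<tau> / 4) > 1"
  shows "\<tau>^2 * card {v. q' v \<ge> \<tau>} \<le> 36864 * real J^3 * \<Phi> * (1 / (\<tau> * n * l) + 1 / l + 1 / n)"
proof -
  define V where "V = {v. q' v \<ge> \<tau>}"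
  \<comment> \<open>Values of \<open>q\<close> below \<tau>/4 can be ignored: with the factor
    \<open>2 / (n l)\<close> and at most n l summands they contribute at most \<tau>/2 to
    \<open>q' v\<close>. The hypothesis on \<open>J\<close> puts level J above 1, which no value of
    \<open>q\<close> exceeds.\<close>
  define T where "T j = 2 ^ j * (\<tau> / 4)" for j :: nat
  define S where "S j = {z. T j \<le> q z \<and> q z < 2 * T j}" for j
  have \<tau>p: "\<tau> > 0" using \<tau> \<tau>0 by linarith
  have np: "real n > 0" "real l > 0" "real J \<ge> 1" using n l J by auto
  have \<Phi>: "\<Phi> \<ge> 0" 
    by (rule order_trans[OF _ lev[OF order_refl]]) simp
  have Tp: "T j > 0" "T j \<ge> \<tau> / 4" "T j \<ge> \<tau>0" for j
  proof -
    have "1 * (\<tau> / 4) \<le> 2 ^ j * (\<tau> / 4)" by (rule mult_right_mono) (use \<tau>p in auto)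
    then show "T j \<ge> \<tau> / 4" by (simp add: T_def)
    then show "T j > 0" "T j \<ge> \<tau>0" using \<tau>p \<tau> by linarith+
  qed
  have fS: "finite (S j)" for j
    by (rule finite_subset[OF _ level_set_bound(1)[OF q(2) Tp(1)[of j]]]) (auto simp: S_def)
  have cS: "card (S j) \<le> card {z. q z \<ge> T j}" for j
    by (rule card_mono[OF level_set_bound(1)[OF q(2) Tp(1)[of j]]]) (auto simp: S_def)
  have s1: "T j * card (S j) \<le> 1" for j
    by (rule order_trans[OF _ level_set_bound(2)[OF q(2) Tp(1)[of j]]])
      (use cS[of j] Tp(1)[of j] in auto)
  have s2: "T j ^ 2 * card (S j) \<le> \<Phi>" for j
    by (rule order_trans[OF _ lev[OF Tp(3)[of j]]]) (use cS[of j] in \<open>auto intro: mult_left_mono\<close>)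
  show ?thesis
  proof (cases "finite V")
    \<comment> \<open>An infinite \<open>V\<close> has \<open>card V = 0\<close>, and the claim
      reduces to the nonnegativity of the right side.\<close>
    case False
    then show ?thesis using \<Phi> \<tau>p np by (simp add: V_def)
  next
    case finV: True
    define I where "I j = {(z, d, x). z \<in> S j \<and> d \<in> D \<and> x \<in> A \<and> z + d * x \<in> V}" for j
    have fI: "finite (I j)" for j
      by (rule finite_subset[of _ "S j \<times> D \<times> A"]) (use fin fS in \<open>auto simp: I_def\<close>)
    have decomp: "q z \<le> \<tau> / 4 + (\<Sum>j<J. 2 * T j * of_bool (z \<in> S j))" for z
    proof (cases "q z < \<tau> / 4")
      case True
      moreover have "(\<Sum>j<J. 2 * T j * of_bool (z \<in> S j)) \<ge> 0"
        by (intro sum_nonneg mult_nonneg_nonneg) (use less_imp_le[OF Tp(1)] in auto)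
      ultimately show ?thesis by linarith
    next
      case False
      have "q z \<le> 1" using q(2)[of "{z}"] by simp
      then have "q z < 2 ^ J * (\<tau> / 4)" "\<tau> / 4 \<le> q z" using J(2) False by linarith+
      then obtain j where j: "j < J" "T j \<le> q z" "q z < 2 * T j"
        using dyadic_level[of "\<tau> / 4" "q z" J] unfolding T_def by metis
      have "q z \<le> 2 * T j * of_bool (z \<in> S j)" using j by (simp add: S_def)
      also have "\<dots> \<le> (\<Sum>j<J. 2 * T j * of_bool (z \<in> S j))"
        by (rule member_le_sum) (use j less_imp_le[OF Tp(1)] in \<open>auto intro!: mult_nonneg_nonneg\<close>)
      finally show ?thesis using \<tau>p by linarith
    qed
    have pt: "\<tau> * (n * l) / 8 \<le> (\<Sum>j<J. T j * (\<Sum>a\<in>A. \<Sum>d\<in>D. of_bool (v - d * a \<in> S j)))" (is "_ \<le> ?R")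
      if "v \<in> V" for v
    proof -
      have "(\<Sum>a\<in>A. \<Sum>d\<in>D. q (v - d * a)) \<le> (\<Sum>a\<in>A. \<Sum>d\<in>D. \<tau> / 4 + (\<Sum>j<J. 2 * T j * of_bool (v - d * a \<in> S j)))"
        by (intro sum_mono decomp)
      also have "\<dots> = card A * (card D * (\<tau> / 4)) + (\<Sum>a\<in>A. \<Sum>d\<in>D. \<Sum>j<J. 2 * T j * of_bool (v - d * a \<in> S j))"
        by (simp add: sum.distrib)
      also have "(\<Sum>a\<in>A. \<Sum>d\<in>D. \<Sum>j<J. 2 * T j * of_bool (v - d * a \<in> S j)) = 2 * ?R"
      proof -
        have "(\<Sum>a\<in>A. \<Sum>d\<in>D. \<Sum>j<J. 2 * T j * of_bool (v - d * a \<in> S j))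
           = (\<Sum>a\<in>A. \<Sum>j<J. \<Sum>d\<in>D. 2 * T j * of_bool (v - d * a \<in> S j))"
          by (intro sum.cong refl sum.swap)
        also have "\<dots> = (\<Sum>j<J. \<Sum>a\<in>A. \<Sum>d\<in>D. 2 * T j * of_bool (v - d * a \<in> S j))" by (rule sum.swap)
        finally show ?thesis by (simp add: sum_distrib_left mult.assoc)
      qed
      also have "card A * (card D * (\<tau> / 4)) \<le> n * (l * (\<tau> / 4))"
        by (intro mult_mono) (use n l \<tau>p in auto)
      finally have "(\<Sum>a\<in>A. \<Sum>d\<in>D. q (v - d * a)) \<le> n * (l * (\<tau> / 4)) + 2 * ?R" by simp
      then have "2 / (real n * real l) * (\<Sum>a\<in>A. \<Sum>d\<in>D. q (v - d * a)) \<le> 2 / (real n * real l) * (n * (l * (\<tau> / 4)) + 2 * ?R)"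
        by (rule mult_left_mono) (use np in auto)
      then have "\<tau> \<le> 2 / (real n * real l) * (n * (l * (\<tau> / 4)) + 2 * ?R)"
        using q'[of v] that by (simp add: V_def)
      also have "\<dots> = \<tau> / 2 + 4 * ?R / (n * l)" using np by (simp add: field_simps)
      finally have "\<tau> / 2 \<le> 4 * ?R / (n * l)" by simp
      then show ?thesis using np by (simp add: field_simps)
    qed
    have inc: "(\<Sum>v\<in>V. \<Sum>a\<in>A. \<Sum>d\<in>D. of_bool (v - d * a \<in> S j)) \<le> real (card (I j))" for j
    proof -
      have "(\<Sum>v\<in>V. \<Sum>a\<in>A. \<Sum>d\<in>D. of_bool (v - d * a \<in> S j)) =
         (\<Sum>(v, a, d)\<in>V \<times> A \<times> D. of_bool (v - d * a \<in> S j) :: real)"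
        by (simp add: sum.cartesian_product)
      also have "\<dots> = (\<Sum>t\<in>V \<times> A \<times> D. of_bool (fst t - snd (snd t) * fst (snd t) \<in> S j) :: real)"
        by (intro sum.cong) auto
      also have "\<dots> = real (card ((V \<times> A \<times> D) \<inter> {t. fst t - snd (snd t) * fst (snd t) \<in> S j}))"
        by (subst sum_of_bool_eq) (use fin finV in auto)
      also have "card ((V \<times> A \<times> D) \<inter> {t. fst t - snd (snd t) * fst (snd t) \<in> S j}) \<le> card (I j)"
        by (rule card_inj_on_le[of "\<lambda>(v, a, d). (v - d * a, d, a)"])
           (use fI in \<open>auto simp: I_def inj_on_def\<close>)
      finally show ?thesis by simp
    qed
    have "card V * (\<tau> * (n * l) / 8) = (\<Sum>v\<in>V. \<tau> * (n * l) / 8)" by simp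
    also have "\<dots> \<le> (\<Sum>v\<in>V. \<Sum>j<J. T j * (\<Sum>a\<in>A. \<Sum>d\<in>D. of_bool (v - d * a \<in> S j)))"
      by (intro sum_mono pt)
    also have "\<dots> = (\<Sum>j<J. T j * (\<Sum>v\<in>V. \<Sum>a\<in>A. \<Sum>d\<in>D. of_bool (v - d * a \<in> S j)))"
      by (subst sum.swap) (simp add: sum_distrib_left)
    also have "\<dots> \<le> (\<Sum>j<J. T j * card (I j))"
      by (intro sum_mono mult_left_mono inc) (use less_imp_le[OF Tp(1)] in auto)
    finally have tot: "card V * (\<tau> * (n * l) / 8) \<le> (\<Sum>j<J. T j * card (I j))" .
    \<comment> \<open>Pigeonhole: one dyadic level carries at least a 1/J share of the weighted
      incidences. This is the origin of \<open>J^3\<close>, since \<theta> below contains 1/J and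
      enters \<open>rich_points_bound\<close> with exponents down to -3.\<close>
    have "\<exists>j<J. T j * card (I j) \<ge> card V * (\<tau> * (n * l) / 8) / J"
    proof (rule ccontr)
      assume "\<not> (\<exists>j<J. T j * card (I j) \<ge> card V * (\<tau> * (n * l) / 8) / J)"
      then have "(\<Sum>j<J. T j * card (I j)) < (\<Sum>j<J. card V * (\<tau> * (n * l) / 8) / J)"
        by (intro sum_strict_mono) (use J(1) in \<open>auto simp: not_le lessThan_empty_iff\<close>)
      then show False using tot np by simp
    qed
    then obtain j where j: "T j * card (I j) \<ge> card V * (\<tau> * (n * l) / 8) / J" by blast
    define \<theta> where "\<theta> = \<tau> / (8 * real J * T j)"
    define s where "s = real (card (S j))"
    have \<theta>p: "\<theta> > 0" using \<tau>p Tp(1)[of j] np by (simp add: \<theta>_def)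
    have rich: "\<theta> * n * l * card V \<le> card (I j)"
      using j Tp(1)[of j] np by (simp add: \<theta>_def field_simps)
    have Vb: "card V \<le> 72 * (s ^ 2 / (\<theta>^3 * n * l) + s / (\<theta>^2 * l) + s / (\<theta> * n))"
      unfolding s_def
      by (rule rich_points_bound[OF fin(1) fS fin(2) finV _ n l \<theta>p rich[unfolded I_def]]) (rule D)
    have J3: "real J \<le> real J ^ 3" "real J ^ 2 \<le> real J ^ 3"
      using np power_increasing[of 1 3 "real J"] power_increasing[of 2 3 "real J"] by auto
    \<comment> \<open>One factor s is paid for by the total mass, the other by the weak L2 bound.
      This is the term that brings a gain only above the level 1/(n l).\<close>
    have b1: "\<tau>^2 * (s ^ 2 / (\<theta>^3 * n * l)) \<le> 512 * real J^3 * \<Phi> * (1 / (\<tau> * n * l))"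
    proof -
      have "\<tau>^2 * (s ^ 2 / (\<theta>^3 * n * l)) = 512 * real J^3 * ((T j ^ 2 * s) * (T j * s)) * (1 / (\<tau> * n * l))"
        using Tp(1)[of j] \<tau>p np by (simp add: \<theta>_def field_simps power2_eq_square power3_eq_cube)
      also have "(T j ^ 2 * s) * (T j * s) \<le> \<Phi> * 1"
        by (intro mult_mono) (use s1[of j] s2[of j] Tp(1)[of j] \<Phi> in \<open>auto simp: s_def\<close>)
      finally show ?thesis using \<tau>p np by (simp add: mult_left_mono mult_right_mono divide_right_mono)
    qed
    have b2: "\<tau>^2 * (s / (\<theta>^2 * l)) \<le> 512 * real J^3 * \<Phi> * (1 / l)"
    proof -
      have "\<tau>^2 * (s / (\<theta>^2 * l)) = 64 * real J^2 * (T j ^ 2 * s) * (1 / l)"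
        using Tp(1)[of j] \<tau>p np by (simp add: \<theta>_def field_simps power2_eq_square)
      also have "\<dots> \<le> 512 * real J^3 * \<Phi> * (1 / l)"
        by (intro mult_right_mono mult_mono) (use s2[of j] J3 Tp(1)[of j] \<Phi> in \<open>auto simp: s_def\<close>)
      finally show ?thesis .
    qed
    have b3: "\<tau>^2 * (s / (\<theta> * n)) \<le> 512 * real J^3 * \<Phi> * (1 / n)"
    proof -
      have "\<tau>^2 * (s / (\<theta> * n)) = 8 * real J * (\<tau> * T j * s) * (1 / n)"
        using Tp(1)[of j] \<tau>p np by (simp add: \<theta>_def field_simps power2_eq_square)
      also have "\<tau> * T j * s \<le> 4 * T j * T j * s"
        by (intro mult_right_mono) (use Tp[of j] in \<open>auto simp: s_def\<close>)
      also have "\<dots> \<le> 4 * \<Phi>" using s2[of j] by (simp add: s_def power2_eq_square algebra_simps)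
      finally have "\<tau>^2 * (s / (\<theta> * n)) \<le> 8 * real J * (4 * \<Phi>) * (1 / n)"
        using np by (simp add: mult_left_mono divide_right_mono)
      also have "\<dots> \<le> 512 * real J^3 * \<Phi> * (1 / n)"
      proof (rule mult_right_mono)
        have "real J * \<Phi> \<le> real J^3 * \<Phi>" using J3 \<Phi> by (intro mult_right_mono) auto
        moreover have "0 \<le> real J^3 * \<Phi>" using \<Phi> by simp
        moreover have "8 * real J * (4 * \<Phi>) = 32 * (real J * \<Phi>)" "512 * real J^3 * \<Phi> = 512 * (real J^3 * \<Phi>)" by simp_all
        ultimately show "8 * real J * (4 * \<Phi>) \<le> 512 * real J^3 * \<Phi>" by linarith
      qed simp
      finally show ?thesis .
    qed
    have "\<tau>^2 * card V \<le> \<tau>^2 * (72 * (s ^ 2 / (\<theta>^3 * n * l) + s / (\<theta>^2 * l) + s / (\<theta> * n)))"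
      by (intro mult_left_mono Vb) simp
    also have "\<dots> = 72 * (\<tau>^2 * (s ^ 2 / (\<theta>^3 * n * l)) + \<tau>^2 * (s / (\<theta>^2 * l)) + \<tau>^2 * (s / (\<theta> * n)))"
      by (simp add: algebra_simps)
    also have "\<dots> \<le> 72 * (512 * real J^3 * \<Phi> * (1 / (\<tau> * n * l)) + 512 * real J^3 * \<Phi> * (1 / l) + 512 * real J^3 * \<Phi> * (1 / n))"
      by (rule mult_left_mono[OF add_mono[OF add_mono[OF b1 b2] b3]]) simp
    also have "\<dots> = 36864 * real J^3 * \<Phi> * (1 / (\<tau> * n * l) + 1 / l + 1 / n)" by (simp add: algebra_simps)
    finally show ?thesis by (simp add: V_def)
  qed
qed

section \<open>Sums of independent bilinear terms\<close>

text \<open>The point masses of the sum of independent terms d(p) f(x), one for every f in the list,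
  with p and x uniform in P and X.\<close>
fun bilinear_law :: "'x set \<Rightarrow> 'p set \<Rightarrow> ('p \<Rightarrow> real) \<Rightarrow> ('x \<Rightarrow> real) list \<Rightarrow> real \<Rightarrow> real" where
  "bilinear_law X P d [] v = of_bool (v = 0)"
| "bilinear_law X P d (f # fs) v
     = (\<Sum>x\<in>X. \<Sum>p\<in>P. bilinear_law X P d fs (v - d p * f x)) / (real (card X) * real (card P))"

lemma bilinear_law_nonneg: "bilinear_law X P d fs v \<ge> 0"
  by (induction fs arbitrary: v) (auto intro!: divide_nonneg_nonneg sum_nonneg)

lemma sum_div_card_le:
  fixes g :: "'x \<Rightarrow> 'p \<Rightarrow> real"
  assumes "\<And>x p. x \<in> X \<Longrightarrow> p \<in> P \<Longrightarrow> g x p \<le> B" "B \<ge> 0"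
  shows "(\<Sum>x\<in>X. \<Sum>p\<in>P. g x p) / (real (card X) * real (card P)) \<le> B"
proof -
  have "(\<Sum>x\<in>X. \<Sum>p\<in>P. g x p) \<le> (\<Sum>x\<in>X. \<Sum>p\<in>P. B)" by (intro sum_mono assms)
  also have "\<dots> = (real (card X) * real (card P)) * B" by simp
  \<comment> \<open>If the product of the cardinalities is 0, division by it gives 0; this is where
    \<open>B \<ge> 0\<close> enters.\<close>
  finally show ?thesis using assms(2)
    by (cases "real (card X) * real (card P) = 0") (auto simp: field_simps)
qed

text \<open>Mass is tested on finite sets only, which avoids infinite sums. Fixing the first term
  translates S, and a translate of a finite set is again finite.\<close>

lemma sum_bilinear_law_le_1:
  "finite S \<Longrightarrow> sum (bilinear_law X P d fs) S \<le> 1"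
proof (induction fs arbitrary: S)
  case Nil
  have "sum (bilinear_law X P d []) S = (\<Sum>v\<in>S. if v = 0 then 1 else 0)"
    by (intro sum.cong) auto
  also have "\<dots> \<le> 1" using Nil by (simp add: sum.delta)
  finally show ?case .
next
  case (Cons f fs)
  have "sum (bilinear_law X P d (f # fs)) S
     = (\<Sum>x\<in>X. \<Sum>p\<in>P. \<Sum>v\<in>S. bilinear_law X P d fs (v - d p * f x)) / (real (card X) * real (card P))"
  proof -
    have "(\<Sum>v\<in>S. \<Sum>x\<in>X. \<Sum>p\<in>P. bilinear_law X P d fs (v - d p * f x))
       = (\<Sum>x\<in>X. \<Sum>v\<in>S. \<Sum>p\<in>P. bilinear_law X P d fs (v - d p * f x))" by (rule sum.swap)
    also have "\<dots> = (\<Sum>x\<in>X. \<Sum>p\<in>P. \<Sum>v\<in>S. bilinear_law X P d fs (v - d p * f x))"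
      by (intro sum.cong refl sum.swap)
    finally show ?thesis by (simp flip: sum_divide_distrib)
  qed
  also have "\<dots> \<le> 1"
  proof (rule sum_div_card_le)
    fix x p
    have "(\<Sum>v\<in>S. bilinear_law X P d fs (v - d p * f x)) = sum (bilinear_law X P d fs) ((\<lambda>v. v - d p * f x) ` S)"
      by (subst sum.reindex) (auto simp: inj_on_def)
    also have "\<dots> \<le> 1" by (rule Cons.IH) (use Cons.prems in simp)
    finally show "(\<Sum>v\<in>S. bilinear_law X P d fs (v - d p * f x)) \<le> 1" .
  qed simp
  finally show ?case .
qed

lemma bilinear_law_le_1: "bilinear_law X P d fs v \<le> 1"
  using sum_bilinear_law_le_1[of "{v}" X P d fs] by simp

text \<open>Further independent terms only average translates of the law, so they cannot raise its
  largest point mass. A bound for a list of R functions thus extends to longer lists.\<close>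

lemma bilinear_law_append_le:
  assumes "\<And>v. bilinear_law X P d gs v \<le> B" "B \<ge> 0"
  shows "bilinear_law X P d (fs @ gs) v \<le> B"
proof (induction fs arbitrary: v)
  case (Cons f fs)
  show ?case unfolding append_Cons bilinear_law.simps by (rule sum_div_card_le[OF Cons.IH assms(2)])
qed (use assms in simp)

section \<open>From sums over indices to sums over distinct values\<close>

lemma sum_le_fiber_bound:
  fixes g :: "'b \<Rightarrow> real"
  assumes "finite X" "\<And>y. card {x \<in> X. f x = y} \<le> K" "\<And>y. g y \<ge> 0"
  shows "(\<Sum>x\<in>X. g (f x)) \<le> K * (\<Sum>y\<in>f ` X. g y)"
proof -
  have "(\<Sum>x\<in>X. g (f x)) = (\<Sum>y\<in>f ` X. \<Sum>x\<in>{x. x \<in> X \<and> f x = y}. g (f x))"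
    by (rule sum.image_gen[OF assms(1)])
  also have "\<dots> = (\<Sum>y\<in>f ` X. card {x \<in> X. f x = y} * g y)"
    by (intro sum.cong refl) (auto simp: sum_constant[symmetric] simp del: sum_constant intro!: sum.cong)
  also have "\<dots> \<le> (\<Sum>y\<in>f ` X. K * g y)"
    by (intro sum_mono mult_right_mono) (use assms in auto)
  finally show ?thesis by (simp add: sum_distrib_left)
qed

text \<open>This is the recursive inequality that \<open>weak_L2_step\<close> asks for. The
  multiplicity m of the values of d cancels against \<open>card P = l * m\<close>, and the 2 is the
  bound for the fibres of f.\<close>

lemma bilinear_law_Cons_le:
  assumes fin: "finite X" "finite P" and X: "card X = n" and P: "card P = l * m" "m \<ge> 1"
    and d: "\<And>y. card {p \<in> P. d p = y} \<le> m" and f: "\<And>y. card {x \<in> X. f x = y} \<le> 2"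
  shows "bilinear_law X P d (f # fs) v
     \<le> 2 / (real n * real l) * (\<Sum>a\<in>f ` X. \<Sum>\<delta>\<in>d ` P. bilinear_law X P d fs (v - \<delta> * a))"
proof -
  let ?q = "\<lambda>x y. bilinear_law X P d fs (v - y * x)"
  have "(\<Sum>x\<in>X. \<Sum>p\<in>P. ?q (f x) (d p)) \<le> (\<Sum>x\<in>X. real m * (\<Sum>\<delta>\<in>d ` P. ?q (f x) \<delta>))"
    by (intro sum_mono sum_le_fiber_bound fin d bilinear_law_nonneg)
  also have "\<dots> = real m * (\<Sum>x\<in>X. \<Sum>\<delta>\<in>d ` P. ?q (f x) \<delta>)" by (simp add: sum_distrib_left)
  also have "\<dots> \<le> real m * (real 2 * (\<Sum>a\<in>f ` X. \<Sum>\<delta>\<in>d ` P. ?q a \<delta>))"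
    by (intro mult_left_mono sum_le_fiber_bound[of X f 2 "\<lambda>a. \<Sum>\<delta>\<in>d ` P. ?q a \<delta>"] fin f sum_nonneg bilinear_law_nonneg) auto
  finally have "(\<Sum>x\<in>X. \<Sum>p\<in>P. ?q (f x) (d p)) / (real n * (real l * real m))
     \<le> real m * (2 * (\<Sum>a\<in>f ` X. \<Sum>\<delta>\<in>d ` P. ?q a \<delta>)) / (real n * (real l * real m))"
    by (intro divide_right_mono) auto
  also have "\<dots> = 2 / (real n * real l) * (\<Sum>a\<in>f ` X. \<Sum>\<delta>\<in>d ` P. ?q a \<delta>)"
    using P(2) by simp
  finally show ?thesis by (simp add: X P)
qed

text \<open>For fixed p the points \<open>v - d p * a\<close> are distinct because
  \<open>d p\<close> is not 0, so together they carry mass at most 1. This weak bound serves for l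
  so small that the incidence argument gains nothing.\<close>

lemma bilinear_law_le_2_div_card:
  assumes fin: "finite X" "finite P" and d: "\<And>p. p \<in> P \<Longrightarrow> d p > 0"
    and f: "\<And>y. card {x \<in> X. f x = y} \<le> 2"
  shows "bilinear_law X P d (f # fs) v \<le> 2 / card X"
proof -
  have "(\<Sum>x\<in>X. bilinear_law X P d fs (v - d p * f x)) \<le> 2" if p: "p \<in> P" for p
  proof -
    have "(\<Sum>x\<in>X. bilinear_law X P d fs (v - d p * f x)) \<le> real 2 * (\<Sum>a\<in>f ` X. bilinear_law X P d fs (v - d p * a))"
      by (rule sum_le_fiber_bound[of X f 2 "\<lambda>a. bilinear_law X P d fs (v - d p * a)"])
        (use fin f bilinear_law_nonneg in auto)
    also have "(\<Sum>a\<in>f ` X. bilinear_law X P d fs (v - d p * a))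
        = sum (bilinear_law X P d fs) ((\<lambda>a. v - d p * a) ` f ` X)"
      using d[OF p] by (subst sum.reindex) (auto simp: inj_on_def)
    also have "\<dots> \<le> 1" by (rule sum_bilinear_law_le_1) (use fin in simp)
    finally show ?thesis by simp
  qed
  then have "(\<Sum>p\<in>P. \<Sum>x\<in>X. bilinear_law X P d fs (v - d p * f x)) \<le> (\<Sum>p\<in>P. 2)" by (rule sum_mono)
  then have "(\<Sum>x\<in>X. \<Sum>p\<in>P. bilinear_law X P d fs (v - d p * f x)) \<le> card P * 2"
    by (subst sum.swap) simp
  then have "bilinear_law X P d (f # fs) v \<le> card P * 2 / (real (card X) * real (card P))"
    unfolding bilinear_law.simps by (rule divide_right_mono) simp
  also have "\<dots> \<le> 2 / card X" by (cases "card P = 0") auto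
  finally show ?thesis .
qed

text \<open>Induction on the number of terms, starting with the point mass at 0, whose weak L2 bound
  is 1. Each application of \<open>weak_L2_step\<close> multiplies the lowest admissible level by 4
  and the bound by \<gamma>.\<close>

lemma bilinear_law_weak_L2:
  fixes X :: "'x set" and P :: "'p set" and \<tau>0 \<tau> \<gamma> :: real
  assumes fin: "finite X" "finite P" and X: "card X = n" "n \<ge> 1"
    and P: "card P = l * m" "m \<ge> 1" "l \<ge> 1" "card (d ` P) \<le> l"
    and d: "\<And>y. card {p \<in> P. d p = y} \<le> m" "\<And>p. p \<in> P \<Longrightarrow> d p > 0"
    and fs: "\<And>f y. f \<in> set fs \<Longrightarrow> card {x \<in> X. f x = y} \<le> 2"
    and \<tau>0: "\<tau>0 > 0" and J: "J \<ge> 1" "2 ^ J * \<tau>0 > 1"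
    and \<gamma>: "\<gamma> \<ge> 36864 * real J^3 * (1 / (\<tau>0 * n * l) + 1 / l + 1 / n)"
    and \<tau>: "\<tau> \<ge> 4 ^ length fs * \<tau>0"
  shows "\<tau>^2 * card {v. bilinear_law X P d fs v \<ge> \<tau>} \<le> \<gamma> ^ length fs"
  using fs \<tau>
proof (induction fs arbitrary: \<tau>)
  case Nil
  show ?case
  proof (cases "\<tau> \<le> 1")
    case True
    have "{v. bilinear_law X P d [] v \<ge> \<tau>} \<subseteq> {0}" using Nil \<tau>0 by auto
    then have "card {v. bilinear_law X P d [] v \<ge> \<tau>} \<le> card {0::real}" by (intro card_mono) auto
    moreover have "\<tau>^2 \<le> 1" using True Nil \<tau>0 by (intro power_le_one) auto
    ultimately have "\<tau>^2 * card {v. bilinear_law X P d [] v \<ge> \<tau>} \<le> 1 * 1" by (intro mult_mono) auto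
    then show ?thesis by simp
  next
    case False
    then have "{v. bilinear_law X P d [] v \<ge> \<tau>} = {}" by auto
    then show ?thesis by (metis card.empty mult_zero_right of_nat_0 power_0 zero_le_one list.size(3))
  qed
next
  case (Cons f fs)
  have \<gamma>0: "\<gamma> \<ge> 0" by (rule order_trans[OF _ \<gamma>]) (use \<tau>0 in auto)
  have \<tau>1: "\<tau> \<ge> 4 * (4 ^ length fs * \<tau>0)" using Cons.prems by (simp add: mult.assoc)
  have p0: "4 ^ length fs * \<tau>0 \<ge> 1 * \<tau>0" by (rule mult_right_mono) (use \<tau>0 in auto)
  then have \<tau>2: "\<tau> \<ge> \<tau>0" "\<tau> / 4 \<ge> \<tau>0" using \<tau>1 \<tau>0 by linarith+
  have "\<tau>^2 * card {v. bilinear_law X P d (f # fs) v \<ge> \<tau>}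
     \<le> 36864 * real J^3 * \<gamma> ^ length fs * (1 / (\<tau> * n * l) + 1 / l + 1 / n)"
  proof (rule weak_L2_step[where A = "f ` X" and D = "d ` P" and q = "bilinear_law X P d fs"])
    show "card (f ` X) \<le> n" using card_image_le[OF fin(1), of f] X by simp
    show "bilinear_law X P d (f # fs) v
       \<le> 2 / (real n * real l) * (\<Sum>a\<in>f ` X. \<Sum>\<delta>\<in>d ` P. bilinear_law X P d fs (v - \<delta> * a))" for v
      by (rule bilinear_law_Cons_le[OF fin X(1) P(1,2) d(1)]) (use Cons.prems in auto)
    show "2 ^ J * (\<tau> / 4) > 1"
      using J(2) \<tau>2(2) by (meson less_le_trans mult_left_mono zero_le_numeral zero_le_power)
    show "\<tau>'^2 * card {z. bilinear_law X P d fs z \<ge> \<tau>'} \<le> \<gamma> ^ length fs" if "\<tau>' \<ge> 4 ^ length fs * \<tau>0" for \<tau>'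
      by (rule Cons.IH) (use Cons.prems that in auto)
  qed (use fin X P d \<tau>0 \<tau>1 J in \<open>auto intro: bilinear_law_nonneg sum_bilinear_law_le_1\<close>)
  also have "\<dots> \<le> 36864 * real J^3 * \<gamma> ^ length fs * (1 / (\<tau>0 * n * l) + 1 / l + 1 / n)"
  proof (intro mult_left_mono add_mono order_refl)
    have "0 < \<tau>0 * n * l" using \<tau>0 X P by simp
    moreover have "\<tau>0 * n * l \<le> \<tau> * n * l" using \<tau>2 by (intro mult_right_mono) auto
    ultimately show "1 / (\<tau> * n * l) \<le> 1 / (\<tau>0 * n * l)" by (intro divide_left_mono) auto
  qed (use \<gamma>0 in auto)
  also have "\<dots> = (36864 * real J^3 * (1 / (\<tau>0 * n * l) + 1 / l + 1 / n)) * \<gamma> ^ length fs" by simp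
  also have "\<dots> \<le> \<gamma> * \<gamma> ^ length fs" by (rule mult_right_mono[OF \<gamma>]) (use \<gamma>0 in simp)
  finally show ?case by simp
qed

text \<open>36864 is the constant of \<open>weak_L2_step\<close>, the logarithmic term bounds the
  number of dyadic levels, and 3 counts the summands of the gain, each of which will be at most
  \<open>n powr (-\<epsilon>)\<close>.\<close>

lemma log_cube_eventually_small:
  fixes \<epsilon> :: real
  assumes "\<epsilon> > 0"
  shows "\<forall>\<^sub>F n in sequentially. 36864 * (2 * log 2 (real n) + 2) ^ 3 * 3 \<le> real n powr (\<epsilon> / 2)"
  using assms by real_asymp

text \<open>With \<open>\<tau>0 = n^\<epsilon> / (n l)\<close> every term gains a factor
  \<open>\<gamma> = n^(-\<epsilon>/2)\<close>. After more than 8/\<epsilon> terms the weak L2 bound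
  is below \<open>n^(-4)\<close>, hence below \<open>\<tau>0^2\<close>, and not even a single point
  can have mass \<open>4^R \<tau>0\<close>.\<close>

theorem bilinear_law_bound:
  fixes \<epsilon> :: real
  assumes \<epsilon>: "0 < \<epsilon>" "\<epsilon> \<le> 1"
  obtains R :: nat and C :: real where "R \<ge> 1" "C > 0"
    "\<And>(X :: 'x set) (P :: 'p set) n l m d (fs :: ('x \<Rightarrow> real) list) v.
      finite X \<Longrightarrow> finite P \<Longrightarrow> card X = n \<Longrightarrow> card P = l * m \<Longrightarrow> m \<ge> 1 \<Longrightarrow> l \<ge> 1 \<Longrightarrow> l \<le> n \<Longrightarrow>
      card (d ` P) \<le> l \<Longrightarrow> (\<And>y. card {p \<in> P. d p = y} \<le> m) \<Longrightarrow> (\<And>p. p \<in> P \<Longrightarrow> d p > 0) \<Longrightarrow>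
      (\<And>f y. f \<in> set fs \<Longrightarrow> card {x \<in> X. f x = y} \<le> 2) \<Longrightarrow> length fs \<ge> R \<Longrightarrow>
      bilinear_law X P d fs v \<le> C * real n powr \<epsilon> / (real n * real l)"
proof -
  obtain n0 where n0: "\<And>n. n \<ge> n0 \<Longrightarrow> 36864 * (2 * log 2 (real n) + 2) ^ 3 * 3 \<le> real n powr (\<epsilon> / 2)"
    using log_cube_eventually_small[OF \<epsilon>(1)] unfolding eventually_sequentially by blast
  define R where "R = nat \<lceil>8 / \<epsilon>\<rceil> + 1"
  \<comment> \<open>\<open>4 ^ R\<close> is the loss of level in R steps, the square of
    \<open>n0\<close> makes the claim trivial below \<open>n0\<close>, and 4 serves the cases n = 1
    and \<open>l < n powr \<epsilon>\<close>.\<close>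
  define C :: real where "C = 4 ^ R + real n0 ^ 2 + 4"
  have R: "real R > 8 / \<epsilon>" unfolding R_def by linarith
  have C: "C \<ge> 4 ^ R" "C \<ge> real n0 ^ 2" "C \<ge> 4" by (auto simp: C_def)
  show thesis
  proof (rule that[of R C])
    show "R \<ge> 1" "C > 0" using C by (auto simp: R_def)
    fix X :: "'x set" and P :: "'p set" and n l m :: nat and d :: "'p \<Rightarrow> real" and fs :: "('x \<Rightarrow> real) list" and v
    assume fin: "finite X" "finite P" and X: "card X = n" and P: "card P = l * m" "m \<ge> 1" "l \<ge> 1"
      and ln: "l \<le> n" and dP: "card (d ` P) \<le> l" and d: "\<And>y. card {p \<in> P. d p = y} \<le> m" "\<And>p. p \<in> P \<Longrightarrow> d p > 0"
      and fs: "\<And>f y. f \<in> set fs \<Longrightarrow> card {x \<in> X. f x = y} \<le> 2" and len: "length fs \<ge> R"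
    have n1: "n \<ge> 1" using ln P by simp
    have np: "real n \<ge> 1" "real l \<ge> 1" using n1 P by auto
    have ne: "real n powr \<epsilon> \<ge> 1" using np \<epsilon> by (simp add: ge_one_powr_ge_zero)
    consider "n < n0 \<or> n = 1" | "real l < real n powr \<epsilon>" | "n \<ge> n0" "n \<ge> 2" "real l \<ge> real n powr \<epsilon>"
      using n1 by linarith
    then show "bilinear_law X P d fs v \<le> C * real n powr \<epsilon> / (real n * real l)"
    proof cases
      case 1
      have "real n * real l \<le> real n * real n" using ln by (intro mult_left_mono) auto
      also have "\<dots> \<le> C"
      proof (cases "n = 1")
        case False
        then have "real n ^ 2 \<le> real n0 ^ 2" using 1 by (intro power_mono) auto
        then show ?thesis using C by (simp add: power2_eq_square)
      qed (use C in simp)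
      also have "\<dots> \<le> C * real n powr \<epsilon>" using ne C by simp
      finally have "1 \<le> C * real n powr \<epsilon> / (real n * real l)" using np by (simp add: pos_le_divide_eq)
      then show ?thesis using bilinear_law_le_1 order_trans by blast
    next
      case 2
      obtain g gs where g: "fs = g # gs" using len by (cases fs) (auto simp: R_def)
      have "bilinear_law X P d fs v \<le> 2 / card X"
        unfolding g by (rule bilinear_law_le_2_div_card) (use fin d fs g in auto)
      also have "\<dots> = 2 * real l / (real n * real l)" using X np by simp
      also have "\<dots> \<le> C * real n powr \<epsilon> / (real n * real l)"
        by (intro divide_right_mono mult_mono) (use 2 C in auto)
      finally show ?thesis .
    next
      case 3
      define \<tau>0 where "\<tau>0 = real n powr \<epsilon> / (real n * real l)"
      \<comment> \<open>With this choice \<open>2 ^ J\<close> exceeds \<open>n^2\<close> and hence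
        \<open>1 / \<tau>0\<close>.\<close>
      define J where "J = nat \<lceil>2 * log 2 (real n)\<rceil> + 1"
      define \<gamma> where "\<gamma> = real n powr (- \<epsilon> / 2)"
      have n2: "real n \<ge> 2" using 3 by simp
      have lg: "log 2 (real n) \<ge> 1" using n2 by simp
      have \<tau>0: "\<tau>0 > 0" unfolding \<tau>0_def using np by simp
      have t0: "\<tau>0 \<ge> 1 / real n ^ 2"
      proof -
        have "1 / real n ^ 2 \<le> 1 / (real n * real l)"
          using ln np by (intro divide_left_mono) (auto simp: power2_eq_square intro: mult_left_mono)
        also have "\<dots> \<le> \<tau>0" unfolding \<tau>0_def by (intro divide_right_mono) (use ne np in auto)
        finally show ?thesis .
      qed
      have J1: "J \<ge> 1" "real J \<le> 2 * log 2 (real n) + 2" "real J > 2 * log 2 (real n)"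
        using lg unfolding J_def by (simp, linarith, linarith)
      have "real n ^ 2 = 2 powr (2 * log 2 (real n))"
      proof -
        have "2 powr (2 * log 2 (real n)) = (2 powr log 2 (real n)) powr 2" by (simp add: powr_powr mult.commute)
        then show ?thesis using np by simp
      qed
      also have "\<dots> < 2 powr real J" using J1 by simp
      also have "\<dots> = 2 ^ J" by (simp add: powr_realpow)
      finally have "real n ^ 2 < 2 ^ J" .
      then have "1 < 2 ^ J * (1 / real n ^ 2)" using np by (simp add: field_simps)
      also have "\<dots> \<le> 2 ^ J * \<tau>0" by (intro mult_left_mono t0) auto
      finally have J2: "2 ^ J * \<tau>0 > 1" .
      have inv: "1 / real n powr \<epsilon> = real n powr (- \<epsilon>)" by (simp add: powr_minus field_simps)
      have g1: "\<gamma> \<ge> 36864 * real J^3 * (1 / (\<tau>0 * n * l) + 1 / l + 1 / n)"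
      proof -
        have "1 / (\<tau>0 * n * l) = 1 / real n powr \<epsilon>" using np by (simp add: \<tau>0_def)
        moreover have "1 / real l \<le> 1 / real n powr \<epsilon>" using 3 np by (intro divide_left_mono) auto
        moreover have "1 / real n \<le> 1 / real n powr \<epsilon>"
        proof (intro divide_left_mono)
          show "real n powr \<epsilon> \<le> real n" using powr_mono[OF \<epsilon>(2), of "real n"] np by simp
        qed (use np in auto)
        ultimately have "1 / (\<tau>0 * n * l) + 1 / l + 1 / n \<le> 3 * real n powr (-\<epsilon>)" using inv by linarith
        then have "36864 * real J^3 * (1 / (\<tau>0 * n * l) + 1 / l + 1 / n)
           \<le> 36864 * (2 * log 2 (real n) + 2) ^ 3 * (3 * real n powr (-\<epsilon>))"
          using J1 lg \<tau>0 by (intro mult_mono power_mono) auto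
        also have "\<dots> = (36864 * (2 * log 2 (real n) + 2) ^ 3 * 3) * real n powr (-\<epsilon>)" by simp
        also have "\<dots> \<le> real n powr (\<epsilon> / 2) * real n powr (-\<epsilon>)"
          by (intro mult_right_mono n0) (use 3 in auto)
        also have "\<dots> = \<gamma>" unfolding \<gamma>_def by (simp flip: powr_add)
        finally show ?thesis .
      qed
      have gR: "\<gamma> ^ R < \<tau>0 ^ 2"
      proof -
        have "\<gamma> ^ R = real n powr (- \<epsilon> / 2 * real R)" unfolding \<gamma>_def using np by (simp add: powr_power mult.commute)
        also have "\<dots> < real n powr (- 4)"
        proof (intro powr_less_mono)
          have "8 < \<epsilon> * real R" using R \<epsilon> by (simp add: field_simps)
          then show "- \<epsilon> / 2 * real R < - 4" by simp
        qed (use n2 in simp)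
        also have "\<dots> = (1 / real n ^ 2) ^ 2" using np by (simp add: powr_minus powr_numeral field_simps flip: power_mult)
        also have "\<dots> \<le> \<tau>0 ^ 2" by (intro power_mono t0) simp
        finally show ?thesis .
      qed
      \<comment> \<open>The last R functions form the innermost part of the recursion; the functions
        in front of them only average.\<close>
      define gs where "gs = drop (length fs - R) fs"
      have gs: "length gs = R" "set gs \<subseteq> set fs" "fs = take (length fs - R) fs @ gs"
        using len set_drop_subset[of "length fs - R" fs] by (simp_all add: gs_def)
      have main: "bilinear_law X P d gs v \<le> 4 ^ R * \<tau>0" for v
      proof (rule ccontr)
        assume "\<not> bilinear_law X P d gs v \<le> 4 ^ R * \<tau>0"
        then have big: "v \<in> {v. bilinear_law X P d gs v \<ge> 4 ^ R * \<tau>0}" by simp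
        have "(4 ^ R * \<tau>0)^2 * card {v. bilinear_law X P d gs v \<ge> 4 ^ R * \<tau>0} \<le> \<gamma> ^ length gs"
          by (rule bilinear_law_weak_L2[OF fin X n1 P(1,2,3) dP d _ \<tau>0 J1(1) J2 g1])
            (use gs fs in auto)
        then have a: "(4 ^ R * \<tau>0)^2 * card {v. bilinear_law X P d gs v \<ge> 4 ^ R * \<tau>0} < \<tau>0^2" using gR gs by simp
        have "finite {v. bilinear_law X P d gs v \<ge> 4 ^ R * \<tau>0}"
          by (rule level_set_bound(1)[OF sum_bilinear_law_le_1]) (use \<tau>0 in auto)
        then have "card {v. bilinear_law X P d gs v \<ge> 4 ^ R * \<tau>0} \<ge> 1"
          using big by (metis One_nat_def Suc_leI card_gt_0_iff empty_iff)
        then have "(4 ^ R * \<tau>0)^2 * 1 \<le> (4 ^ R * \<tau>0)^2 * card {v. bilinear_law X P d gs v \<ge> 4 ^ R * \<tau>0}"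
          by (intro mult_left_mono) auto
        moreover have "(1 * \<tau>0)^2 \<le> (4 ^ R * \<tau>0)^2" using \<tau>0 by (intro power_mono mult_right_mono) auto
        ultimately show False using a by simp
      qed
      have "bilinear_law X P d (take (length fs - R) fs @ gs) v \<le> 4 ^ R * \<tau>0"
        by (rule bilinear_law_append_le[OF main]) (use \<tau>0 in auto)
      also have "\<dots> \<le> C * \<tau>0" using C \<tau>0 by (intro mult_right_mono) auto
      finally show ?thesis using gs(3) by (simp add: \<tau>0_def)
    qed
  qed
qed

section \<open>Energies and permutations\<close>

definition lists_of :: "nat \<Rightarrow> 'a set \<Rightarrow> 'a list set" where
  "lists_of q A = {xs. set xs \<subseteq> A \<and> length xs = q}"

lemma finite_lists_of [simp]: "finite A \<Longrightarrow> finite (lists_of q A)"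
  unfolding lists_of_def by (rule finite_lists_length_eq)

lemma card_lists_of [simp]: "finite A \<Longrightarrow> card (lists_of q A) = card A ^ q"
  unfolding lists_of_def by (rule card_lists_length_eq)

text \<open>Lists allow a comparison with independent samples. Distinctness across both halves makes
  the positions \<open>s p\<close> and \<open>s' p\<close> that belong to the entries distinct too,
  so that permutations can be counted by their values there.\<close>

definition list_energy :: "('a \<Rightarrow> real) \<Rightarrow> 'a set \<Rightarrow> nat \<Rightarrow> nat" where
  "list_energy u P r = card {zs \<in> lists_of (2 * r) P. distinct zs \<and>
     sum_list (map u (take r zs)) = sum_list (map u (drop r zs))}"

lemma list_energy_le:
  assumes "finite P" shows "list_energy u P r \<le> card P ^ (2 * r)"
proof -
  have "list_energy u P r \<le> card (lists_of (2 * r) P)"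
    unfolding list_energy_def by (rule card_mono) (use assms in auto)
  then show ?thesis using assms by simp
qed

text \<open>Elements common to both sets cancel, so that only the differences S - S' and S' - S matter.\<close>
lemma subset_energy_le_list_energy:
  assumes fin: "finite P"
  shows "subset_energy u P k \<le> (\<Sum>r\<le>k. card P ^ (k - r) * list_energy u P r)"
proof -
  define lst where "lst S = (SOME xs. set xs = S \<and> distinct xs)" for S :: "'a set"
  have lst: "set (lst S) = S" "distinct (lst S)" if "finite S" for S
    using someI_ex[OF finite_distinct_list[OF that]] by (auto simp: lst_def)
  have len: "length (lst S) = card S" if "finite S" for S
    using distinct_card[OF lst(2)[OF that]] lst(1)[OF that] by simp
  define Z where "Z r = {zs \<in> lists_of (2 * r) P. distinct zs \<and>
     sum_list (map u (take r zs)) = sum_list (map u (drop r zs))}" for r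
  have finZ: "finite (Z r)" for r using fin by (simp add: Z_def)
  define T where "T = (SIGMA r:{..k}. lists_of (k - r) P \<times> Z r)"
  have "subset_energy u P k \<le> card T"
    unfolding subset_energy_def
  proof (rule card_inj_on_le)
    let ?E = "{(S, S'). S \<subseteq> P \<and> S' \<subseteq> P \<and> card S = k \<and> card S' = k \<and> sum u S = sum u S'}"
    \<comment> \<open>Here r is the size of \<open>S - S'\<close>. The common part is recorded as
      one of \<open>card P ^ (k - r)\<close> lists, the two differences as a concatenation that can
      be cut in the middle because both have r elements.\<close>
    let ?g = "\<lambda>(S, S'). (card (S - S'), lst (S \<inter> S'), lst (S - S') @ lst (S' - S))"
    show "inj_on ?g ?E"
    proof (rule inj_onI)
      fix p q assume p: "p \<in> ?E" and q: "q \<in> ?E" and g: "?g p = ?g q"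
      obtain S S' where p': "p = (S, S')" by force
      obtain W W' where q': "q = (W, W')" by force
      have f: "finite S" "finite S'" "finite W" "finite W'"
        using p q finite_subset[OF _ fin] by (auto simp: p' q')
      have e: "card (S - S') = card (W - W')" "lst (S \<inter> S') = lst (W \<inter> W')"
        "lst (S - S') @ lst (S' - S) = lst (W - W') @ lst (W' - W)" using g by (auto simp: p' q')
      have "lst (S - S') = lst (W - W') \<and> lst (S' - S) = lst (W' - W)"
        using e(3) by (rule append_eq_append_conv[THEN iffD1, rotated]) (use e(1) f len in auto)
      then have "S - S' = W - W'" "S' - S = W' - W" "S \<inter> S' = W \<inter> W'"
        using e(2) f lst(1) by (metis finite_Diff, metis finite_Diff, metis finite_Int)
      then show "p = q" unfolding p' q' by blast
    qed
    show "?g ` ?E \<subseteq> T"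
    proof
      fix t assume "t \<in> ?g ` ?E"
      then obtain S S' where S: "S \<subseteq> P" "S' \<subseteq> P" "card S = k" "card S' = k" "sum u S = sum u S'"
        and t: "t = (card (S - S'), lst (S \<inter> S'), lst (S - S') @ lst (S' - S))" by auto
      have f: "finite S" "finite S'" using S(1,2) finite_subset[OF _ fin] by auto
      have c: "card (S - S') + card (S \<inter> S') = k" "card (S' - S) + card (S \<inter> S') = k"
        using card_Int_Diff[OF f(1), of S'] card_Int_Diff[OF f(2), of S] S by (auto simp: Int_commute)
      have s: "sum u (S - S') = sum u (S' - S)"
        using sum.Int_Diff[OF f(1), of u S'] sum.Int_Diff[OF f(2), of u S] S(5) by (simp add: Int_commute)
      have sl: "sum_list (map u (lst A)) = sum u A" if "finite A" for A
        using lst[OF that] by (simp add: sum_list_distinct_conv_sum_set)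
      have "lst (S \<inter> S') \<in> lists_of (k - card (S - S')) P"
        using lst[of "S \<inter> S'"] len[of "S \<inter> S'"] f S c by (auto simp: lists_of_def)
      moreover have "lst (S - S') @ lst (S' - S) \<in> Z (card (S - S'))"
        using lst[of "S - S'"] len[of "S - S'"] lst[of "S' - S"] len[of "S' - S"] f S c s sl
        by (auto simp: Z_def lists_of_def)
      ultimately show "t \<in> T" using c unfolding t T_def by auto
    qed
    show "finite T" unfolding T_def using fin finZ by auto
  qed
  also have "card T = (\<Sum>r\<le>k. card P ^ (k - r) * card (Z r))"
    unfolding T_def using fin finZ by (subst card_SigmaI) (auto simp: card_cartesian_product)
  finally show ?thesis by (simp add: Z_def list_energy_def)
qed

section \<open>Counting solutions of bilinear equations\<close>

fun bilinear_sum :: "('p \<Rightarrow> real) \<Rightarrow> ('x \<Rightarrow> real) list \<Rightarrow> 'x list \<Rightarrow> 'p list \<Rightarrow> real" where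
  "bilinear_sum d (f # fs) (x # xs) (p # ps) = d p * f x + bilinear_sum d fs xs ps"
| "bilinear_sum d _ _ _ = 0"

text \<open>\<open>bilinear_law\<close> is the law of \<open>bilinear_sum\<close> for lists of
  independent uniform entries. In this counting form its bound can be applied to energies.\<close>

lemma card_bilinear_sum_eq:
  assumes fin: "finite X" "finite P" and ne: "X \<noteq> {}" "P \<noteq> {}"
  shows "card {(xs, ps). xs \<in> lists_of (length fs) X \<and> ps \<in> lists_of (length fs) P \<and> bilinear_sum d fs xs ps = v}
     = (real (card X) * real (card P)) ^ length fs * bilinear_law X P d fs v"
proof (induction fs arbitrary: v)
  case Nil
  have "{(xs, ps). xs \<in> lists_of 0 X \<and> ps \<in> lists_of 0 P \<and> bilinear_sum d [] xs ps = v}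
     = (if v = 0 then {([], [])} else {})" by (auto simp: lists_of_def)
  then show ?case by simp
next
  case (Cons f fs)
  let ?q = "length fs"
  let ?A = "\<lambda>v. {(xs, ps). xs \<in> lists_of ?q X \<and> ps \<in> lists_of ?q P \<and> bilinear_sum d fs xs ps = v}"
  have finA: "finite (?A v)" for v
    by (rule finite_subset[of _ "lists_of ?q X \<times> lists_of ?q P"]) (use fin in auto)
  let ?B = "{(xs, ps). xs \<in> lists_of (length (f # fs)) X \<and> ps \<in> lists_of (length (f # fs)) P \<and> bilinear_sum d (f # fs) xs ps = v}"
  let ?S = "SIGMA z:X \<times> P. ?A (v - d (snd z) * f (fst z))"
  have "bij_betw (\<lambda>((x, p), (xs, ps)). (x # xs, p # ps)) ?S ?B"
  proof (rule bij_betwI[where g = "\<lambda>(xs, ps). ((hd xs, hd ps), (tl xs, tl ps))"])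
    show "(\<lambda>((x, p), (xs, ps)). (x # xs, p # ps)) \<in> ?S \<rightarrow> ?B" by (auto simp: lists_of_def)
    show "(\<lambda>(xs, ps). ((hd xs, hd ps), (tl xs, tl ps))) \<in> ?B \<rightarrow> ?S"
    proof
      fix z assume z: "z \<in> ?B"
      obtain xs ps where zz: "z = (xs, ps)" by force
      obtain x xs' p ps' where "xs = x # xs'" "ps = p # ps'"
        using z by (cases xs; cases ps) (auto simp: zz lists_of_def)
      then show "(case z of (xs, ps) \<Rightarrow> ((hd xs, hd ps), (tl xs, tl ps))) \<in> ?S"
        using z by (auto simp: zz lists_of_def)
    qed
  qed (auto simp: lists_of_def length_Suc_conv)
  then have "card ?B = card ?S" by (simp only: bij_betw_same_card)
  also have "\<dots> = (\<Sum>z\<in>X \<times> P. card (?A (v - d (snd z) * f (fst z))))"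
    using fin finA by (intro card_SigmaI) auto
  finally have "real (card ?B) = (\<Sum>z\<in>X \<times> P. real (card (?A (v - d (snd z) * f (fst z)))))" by simp
  also have "\<dots> = (\<Sum>z\<in>X \<times> P. (real (card X) * real (card P)) ^ ?q * bilinear_law X P d fs (v - d (snd z) * f (fst z)))"
    by (simp only: Cons.IH)
  also have "\<dots> = (real (card X) * real (card P)) ^ ?q * (\<Sum>x\<in>X. \<Sum>p\<in>P. bilinear_law X P d fs (v - d p * f x))"
    by (simp add: sum_distrib_left sum.cartesian_product case_prod_beta)
  also have "\<dots> = (real (card X) * real (card P)) ^ length (f # fs) * bilinear_law X P d (f # fs) v"
    using ne fin by simp
  finally show ?case .
qed

text \<open>Given one such permutation \<sigma>, composition with its inverse maps all of them
  injectively to permutations that fix K pointwise.\<close>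

lemma card_permutations_fixed_values:
  assumes "finite U" "K \<subseteq> U"
  shows "card {\<pi>. \<pi> permutes U \<and> (\<forall>i\<in>K. \<pi> i = g i)} \<le> fact (card U - card K)"
proof (cases "{\<pi>. \<pi> permutes U \<and> (\<forall>i\<in>K. \<pi> i = g i)} = {}")
  case False
  then obtain \<sigma> where s: "\<sigma> permutes U" "\<forall>i\<in>K. \<sigma> i = g i" by auto
  have "card {\<pi>. \<pi> permutes U \<and> (\<forall>i\<in>K. \<pi> i = g i)} \<le> card {\<pi>. \<pi> permutes (U - K)}"
  proof (rule card_inj_on_le[of "\<lambda>\<pi>. inv \<sigma> \<circ> \<pi>"])
    show "inj_on (\<lambda>\<pi>. inv \<sigma> \<circ> \<pi>) {\<pi>. \<pi> permutes U \<and> (\<forall>i\<in>K. \<pi> i = g i)}"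
    proof (rule inj_onI)
      fix p q assume "inv \<sigma> \<circ> p = inv \<sigma> \<circ> q"
      then have "\<sigma> \<circ> (inv \<sigma> \<circ> p) = \<sigma> \<circ> (inv \<sigma> \<circ> q)" by simp
      then show "p = q" using permutes_inv_o(1)[OF s(1)] by (simp flip: o_assoc add: comp_assoc[symmetric])
    qed
    show "(\<lambda>\<pi>. inv \<sigma> \<circ> \<pi>) ` {\<pi>. \<pi> permutes U \<and> (\<forall>i\<in>K. \<pi> i = g i)} \<subseteq> {\<pi>. \<pi> permutes (U - K)}"
    proof clarify
      fix \<pi> assume p: "\<pi> permutes U" "\<forall>i\<in>K. \<pi> i = g i"
      have c: "(inv \<sigma> \<circ> \<pi>) permutes U" using p(1) permutes_inv[OF s(1)] by (rule permutes_compose)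
      have "(inv \<sigma> \<circ> \<pi>) i = i" if "i \<in> K" for i
        using that p s permutes_inverses(2)[OF s(1), of i] by auto
      then show "(inv \<sigma> \<circ> \<pi>) permutes (U - K)"
        using permutes_superset[OF c, of "U - K"] by auto
    qed
    show "finite {\<pi>. \<pi> permutes (U - K)}" using assms by (intro finite_permutations) auto
  qed
  also have "\<dots> = fact (card U - card K)"
    using assms by (subst card_permutations) (auto simp: card_Diff_subset finite_subset)
  finally show ?thesis .
next
  case True
  show ?thesis unfolding True by simp
qed

text \<open>The price for replacing j values of a random permutation by independent ones: every
  factor of the falling factorial \<open>n (n - 1) ... (n - j + 1)\<close> is at least n/2.\<close>

lemma half_power_fact_le: "2 * j \<le> n \<Longrightarrow> n ^ j * fact (n - j) \<le> 2 ^ j * (fact n :: nat)"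
proof (induction j)
  case (Suc j)
  have "n - j = Suc (n - Suc j)" using Suc.prems by simp
  then have f: "fact (n - j) = (n - j) * (fact (n - Suc j) :: nat)" by simp
  have "n ^ Suc j * fact (n - Suc j) = n * (n ^ j * fact (n - Suc j))" by simp
  also have "\<dots> \<le> (2 * (n - j)) * (n ^ j * fact (n - Suc j))"
    by (intro mult_right_mono) (use Suc.prems in auto)
  also have "\<dots> = 2 * (n ^ j * fact (n - j))" unfolding f by simp
  also have "\<dots> \<le> 2 * (2 ^ j * fact n)" using Suc by simp
  finally show ?case by simp
qed simp

text \<open>The signs bring the second half of a list to the other side, so that equal sums over
  both halves become one vanishing bilinear sum. The values of \<open>h\<close> are frozen into the
  functions, the values of \<open>g\<close> remain arguments.\<close>

lemma signed_bilinear_sum: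
  assumes "length ys + length zs = length \<sigma>" "\<sigma> = replicate (length ys) 1 @ replicate (length zs) (-1)"
  shows "bilinear_sum d (map (\<lambda>(c, y) x. c * \<bar>a y - a x\<bar>) (zip \<sigma> (map h (ys @ zs)))) (map g (ys @ zs)) (ys @ zs)
    = sum_list (map (\<lambda>p. d p * \<bar>a (h p) - a (g p)\<bar>) ys) - sum_list (map (\<lambda>p. d p * \<bar>a (h p) - a (g p)\<bar>) zs)"
  using assms
proof (induction ys arbitrary: \<sigma>)
  case Nil
  have "bilinear_sum d (map (\<lambda>(c, y) x. c * \<bar>a y - a x\<bar>) (zip (replicate (length zs) (-1)) (map h zs))) (map g zs) zs
    = - sum_list (map (\<lambda>p. d p * \<bar>a (h p) - a (g p)\<bar>) zs)"
    by (induction zs) auto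
  then show ?case using Nil by simp
qed auto

text \<open>A list of 2r distinct pairs involves 4r positions. Freeze the values \<open>ys\<close>
  of the permutation at the positions given by \<open>s'\<close> and let the values
  \<open>xs\<close> at those given by \<open>s\<close> vary together with the list
  \<open>zs\<close>: the equation becomes bilinear, and B bounds its number of solutions. At most
  \<open>fact (n - 4 * r)\<close> permutations take 4r prescribed values, and
  \<open>half_power_fact_le\<close> turns the loss of independence into
  \<open>2 ^ (4 * r)\<close>.\<close>

lemma sum_over_permutations_list_energy:
  fixes a :: "nat \<Rightarrow> real" and d :: "'p \<Rightarrow> real"
  assumes a: "inj_on a U" and U: "finite U" "card U = n" "8 * r \<le> n" "U \<noteq> {}" and P: "finite P" "P \<noteq> {}"
    and s: "inj_on s P" "s ` P \<subseteq> U" and s': "inj_on s' P" "s' ` P \<subseteq> U" and disj: "s ` P \<inter> s' ` P = {}"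
    and B: "\<And>fs v. length fs = 2 * r \<Longrightarrow> (\<And>f y. f \<in> set fs \<Longrightarrow> card {x \<in> U. f x = y} \<le> 2)
        \<Longrightarrow> bilinear_law U P d fs v \<le> B" and B0: "B \<ge> 0"
  shows "(\<Sum>\<pi> | \<pi> permutes U. real (list_energy (\<lambda>p. d p * \<bar>a (\<pi> (s' p)) - a (\<pi> (s p))\<bar>) P r))
     \<le> fact n * 2 ^ (4 * r) * real (card P) ^ (2 * r) * B"
proof -
  define q where "q = 2 * r"
  define \<sigma> :: "real list" where "\<sigma> = replicate r 1 @ replicate r (-1)"
  define fs where "fs ys = map (\<lambda>(c, y) x. c * \<bar>a y - a x\<bar>) (zip \<sigma> ys)" for ys
  define Z where "Z = {zs \<in> lists_of q P. distinct zs}"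
  define ev where "ev \<pi> zs \<longleftrightarrow> sum_list (map (\<lambda>p. d p * \<bar>a (\<pi> (s' p)) - a (\<pi> (s p))\<bar>) (take r zs))
      = sum_list (map (\<lambda>p. d p * \<bar>a (\<pi> (s' p)) - a (\<pi> (s p))\<bar>) (drop r zs))" for \<pi> zs
  define T where "T ys zs = {xs \<in> lists_of q U. bilinear_sum d (fs ys) xs zs = 0}" for ys zs
  define Pi where "Pi = {\<pi>. \<pi> permutes U}"
  have finPi: "finite Pi" unfolding Pi_def by (rule finite_permutations[OF U(1)])
  have finZ: "finite Z" using P by (simp add: Z_def)
  have finT: "finite (T ys zs)" for ys zs using U by (simp add: T_def)
  have lfs: "length (fs ys) = q" if "length ys = q" for ys using that by (simp add: fs_def \<sigma>_def q_def)
  \<comment> \<open>\<open>a\<close> is injective on U, and the absolute value merges at most two of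
    its values.\<close>
  have fiber: "card {x \<in> U. f x = c} \<le> 2" if "f \<in> set (fs ys)" for f c ys
  proof -
    from that obtain e y where f: "f = (\<lambda>x. e * \<bar>a y - a x\<bar>)" and "e \<in> set \<sigma>"
      by (auto simp: fs_def dest: set_zip_leftD)
    then have e: "e = 1 \<or> e = -1" by (auto simp: \<sigma>_def)
    have "card {x \<in> U. f x = c} = card (a ` {x \<in> U. f x = c})"
      by (rule card_image[symmetric]) (rule inj_on_subset[OF a], auto)
    also have "\<dots> \<le> card {a y - c, a y + c}"
      by (rule card_mono) (use e in \<open>auto simp: f abs_if split: if_splits\<close>)
    also have "\<dots> \<le> 2" by (simp add: card_insert_if)
    finally show ?thesis .
  qed
  have ev_imp: "bilinear_sum d (fs (map (\<pi> \<circ> s') zs)) (map (\<pi> \<circ> s) zs) zs = 0" if "ev \<pi> zs" "zs \<in> Z" for \<pi> zs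
  proof -
    have l: "length (take r zs) = r" "length (drop r zs) = r" using that by (auto simp: Z_def lists_of_def q_def)
    have "bilinear_sum d (fs (map (\<pi> \<circ> s') (take r zs @ drop r zs))) (map (\<pi> \<circ> s) (take r zs @ drop r zs)) (take r zs @ drop r zs) = 0"
      unfolding fs_def by (subst signed_bilinear_sum) (use that(1) l in \<open>auto simp: \<sigma>_def ev_def\<close>)
    then show ?thesis by simp
  qed
  have count: "card {\<pi> \<in> Pi. ev \<pi> zs} \<le> (\<Sum>ys\<in>lists_of q U. card (T ys zs)) * fact (n - 2 * q)" if zs: "zs \<in> Z" for zs
  proof -
    define D where "D = (SIGMA ys:lists_of q U. T ys zs)"
    define G where "G = (\<lambda>(ys, xs). {\<pi> \<in> Pi. map (\<pi> \<circ> s') zs = ys \<and> map (\<pi> \<circ> s) zs = xs})"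
    have zP: "set zs \<subseteq> P" "length zs = q" "distinct zs" using zs by (auto simp: Z_def lists_of_def)
    have "{\<pi> \<in> Pi. ev \<pi> zs} \<subseteq> (\<Union>t\<in>D. G t)"
    proof
      fix \<pi> assume p: "\<pi> \<in> {\<pi> \<in> Pi. ev \<pi> zs}"
      have pU: "\<pi> i \<in> U" if "i \<in> U" for i using p that permutes_in_image[of \<pi> U i] by (auto simp: Pi_def)
      have "map (\<pi> \<circ> s') zs \<in> lists_of q U" "map (\<pi> \<circ> s) zs \<in> lists_of q U"
        using zP s s' pU by (auto simp: lists_of_def)
      then have "(map (\<pi> \<circ> s') zs, map (\<pi> \<circ> s) zs) \<in> D"
        using ev_imp[of \<pi> zs] p zs by (auto simp: D_def T_def)
      moreover have "\<pi> \<in> G (map (\<pi> \<circ> s') zs, map (\<pi> \<circ> s) zs)" using p by (auto simp: G_def)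
      ultimately show "\<pi> \<in> (\<Union>t\<in>D. G t)" by blast
    qed
    moreover have finD: "finite D" using finT U by (auto simp: D_def)
    moreover have "finite (G t)" for t using finPi by (auto simp: G_def split: prod.split)
    ultimately have "card {\<pi> \<in> Pi. ev \<pi> zs} \<le> card (\<Union>t\<in>D. G t)" by (intro card_mono) auto
    also have "\<dots> \<le> (\<Sum>t\<in>D. card (G t))" by (rule card_UN_le[OF finD])
    also have "\<dots> \<le> (\<Sum>t\<in>D. fact (n - 2 * q))"
    proof (rule sum_mono)
      fix t assume "t \<in> D"
      show "card (G t) \<le> fact (n - 2 * q)"
      proof (cases "G t = {}")
        case False
        then obtain \<rho> where \<rho>: "\<rho> \<in> G t" by auto
        define K where "K = s ` set zs \<union> s' ` set zs"
        have "card K = card (s ` set zs) + card (s' ` set zs)"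
          unfolding K_def using disj zP by (intro card_Un_disjoint) auto
        also have "\<dots> = 2 * q"
          using card_image[OF inj_on_subset[OF s(1) zP(1)]] card_image[OF inj_on_subset[OF s'(1) zP(1)]]
            distinct_card[OF zP(3)] zP(2) by simp
        finally have cK: "card K = 2 * q" .
        have "G t \<subseteq> {\<pi>. \<pi> permutes U \<and> (\<forall>i\<in>K. \<pi> i = \<rho> i)}"
        proof
          fix \<pi> assume "\<pi> \<in> G t"
          then have "\<pi> permutes U" "map (\<pi> \<circ> s') zs = map (\<rho> \<circ> s') zs" "map (\<pi> \<circ> s) zs = map (\<rho> \<circ> s) zs"
            using \<rho> by (auto simp: G_def Pi_def split: prod.splits)
          then show "\<pi> \<in> {\<pi>. \<pi> permutes U \<and> (\<forall>i\<in>K. \<pi> i = \<rho> i)}" by (auto simp: K_def)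
        qed
        then have "card (G t) \<le> card {\<pi>. \<pi> permutes U \<and> (\<forall>i\<in>K. \<pi> i = \<rho> i)}"
          by (rule card_mono[rotated]) (rule finite_subset[OF _ finPi], auto simp: Pi_def)
        also have "\<dots> \<le> fact (card U - card K)"
          by (rule card_permutations_fixed_values[OF U(1)]) (use zP s s' in \<open>auto simp: K_def\<close>)
        finally show ?thesis using cK U by simp
      next
        case True
        show ?thesis unfolding True by simp
      qed
    qed
    also have "\<dots> = card D * fact (n - 2 * q)" by simp
    also have "card D = (\<Sum>ys\<in>lists_of q U. card (T ys zs))"
      unfolding D_def using finT U by (intro card_SigmaI) auto
    finally show ?thesis .
  qed
  have le: "list_energy (\<lambda>p. d p * \<bar>a (\<pi> (s' p)) - a (\<pi> (s p))\<bar>) P r = (\<Sum>zs\<in>Z. of_bool (ev \<pi> zs))" for \<pi>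
  proof -
    have "(\<Sum>zs\<in>Z. of_bool (ev \<pi> zs)) = card (Z \<inter> {zs. ev \<pi> zs})"
      using finZ by (simp add: sum_of_bool_eq)
    also have "Z \<inter> {zs. ev \<pi> zs} = {zs \<in> lists_of (2 * r) P. distinct zs \<and> ev \<pi> zs}"
      by (auto simp: Z_def q_def)
    finally show ?thesis by (simp add: list_energy_def ev_def)
  qed
  have "(\<Sum>\<pi>\<in>Pi. list_energy (\<lambda>p. d p * \<bar>a (\<pi> (s' p)) - a (\<pi> (s p))\<bar>) P r)
      = (\<Sum>zs\<in>Z. \<Sum>\<pi>\<in>Pi. of_bool (ev \<pi> zs))"
    unfolding le by (rule sum.swap)
  also have "\<dots> = (\<Sum>zs\<in>Z. card {\<pi> \<in> Pi. ev \<pi> zs})"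
    using finPi by (intro sum.cong refl) (simp add: sum_of_bool_eq Int_def)
  also have "\<dots> \<le> (\<Sum>zs\<in>Z. (\<Sum>ys\<in>lists_of q U. card (T ys zs)) * fact (n - 2 * q))"
    by (intro sum_mono count)
  \<comment> \<open>Distinctness of \<open>zs\<close> has served for counting permutations; giving
    it up now makes the entries independent.\<close>
  also have "\<dots> \<le> (\<Sum>zs\<in>lists_of q P. (\<Sum>ys\<in>lists_of q U. card (T ys zs)) * fact (n - 2 * q))"
    by (rule sum_mono2) (use P in \<open>auto simp: Z_def\<close>)
  also have "\<dots> = (\<Sum>ys\<in>lists_of q U. \<Sum>zs\<in>lists_of q P. card (T ys zs)) * fact (n - 2 * q)"
    by (subst sum.swap) (simp add: sum_distrib_right)
  finally have nat_le: "(\<Sum>\<pi>\<in>Pi. list_energy (\<lambda>p. d p * \<bar>a (\<pi> (s' p)) - a (\<pi> (s p))\<bar>) P r)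
      \<le> (\<Sum>ys\<in>lists_of q U. \<Sum>zs\<in>lists_of q P. card (T ys zs)) * fact (n - 2 * q)" .
  have each: "real (\<Sum>zs\<in>lists_of q P. card (T ys zs)) \<le> (real n * real (card P)) ^ q * B" if ys: "ys \<in> lists_of q U" for ys
  proof -
    have l: "length (fs ys) = q" by (rule lfs) (use ys in \<open>simp add: lists_of_def\<close>)
    have "(\<Sum>zs\<in>lists_of q P. card (T ys zs)) = card (SIGMA zs:lists_of q P. T ys zs)"
      using P finT by (simp add: card_SigmaI)
    also have "\<dots> = card {(xs, ps). xs \<in> lists_of q U \<and> ps \<in> lists_of q P \<and> bilinear_sum d (fs ys) xs ps = 0}"
      by (rule bij_betw_same_card[of "\<lambda>(x, y). (y, x)"], rule bij_betwI[where g = "\<lambda>(x, y). (y, x)"])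
        (auto simp: T_def)
    finally have "real (\<Sum>zs\<in>lists_of q P. card (T ys zs)) = (real n * real (card P)) ^ q * bilinear_law U P d (fs ys) 0"
      using card_bilinear_sum_eq[OF U(1) P(1) U(4) P(2), of "fs ys" d 0] l U by simp
    also have "\<dots> \<le> (real n * real (card P)) ^ q * B"
      by (intro mult_left_mono B) (use l fiber in \<open>auto simp: q_def\<close>)
    finally show ?thesis .
  qed
  have "real (\<Sum>\<pi>\<in>Pi. list_energy (\<lambda>p. d p * \<bar>a (\<pi> (s' p)) - a (\<pi> (s p))\<bar>) P r)
      \<le> real ((\<Sum>ys\<in>lists_of q U. \<Sum>zs\<in>lists_of q P. card (T ys zs)) * fact (n - 2 * q))"
    using nat_le by (simp only: of_nat_le_iff)
  also have "\<dots> = (\<Sum>ys\<in>lists_of q U. real (\<Sum>zs\<in>lists_of q P. card (T ys zs))) * fact (n - 2 * q)"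
    by simp
  also have "\<dots> \<le> (\<Sum>ys\<in>lists_of q U. (real n * real (card P)) ^ q * B) * fact (n - 2 * q)"
    by (intro mult_right_mono sum_mono each) auto
  also have "\<dots> = real (n ^ (2 * q) * fact (n - 2 * q)) * (real (card P) ^ q * B)"
    using U by (simp add: power_mult_distrib power_add mult_2)
  also have "\<dots> \<le> real (2 ^ (2 * q) * fact n) * (real (card P) ^ q * B)"
    by (intro mult_right_mono, unfold of_nat_le_iff, rule half_power_fact_le) (use U B0 in \<open>auto simp: q_def\<close>)
  finally show ?thesis by (simp add: Pi_def q_def mult_ac)
qed

text \<open>For X in \<open>Pow P\<close>, \<open>sw X\<close> exchanges the two positions of every
  pair in X. Composition with it maps the set of all permutations onto itself, so the count may be
  averaged over all X; for a fixed permutation this average counts subset sums of the weights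
  \<open>w \<pi>\<close>, and \<open>card_equal_sums\<close> applies. The two summands of the last
  factor stem from pairs of k-subsets that differ in few and in many elements.\<close>

lemma permutation_sum_count_bound:
  fixes a b :: "nat \<Rightarrow> real" and x :: real and s s' :: "'p \<Rightarrow> nat" and U :: "nat set"
  defines "d \<equiv> \<lambda>p. b (s p) - b (s' p)"
  assumes a: "inj_on a U" and U: "finite U" "card U = n" and P: "finite P" "card P = N"
    and s: "inj_on s P" "s ` P \<subseteq> U" and s': "inj_on s' P" "s' ` P \<subseteq> U" and disj: "s ` P \<inter> s' ` P = {}"
    and d: "\<And>p. p \<in> P \<Longrightarrow> d p > 0"
    and B: "\<And>fs v. length fs \<ge> R \<Longrightarrow> (\<And>f y. f \<in> set fs \<Longrightarrow> card {x \<in> U. f x = y} \<le> 2)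
        \<Longrightarrow> bilinear_law U P d fs v \<le> B" and B0: "B \<ge> 0"
    and k: "k \<ge> 1" "N \<ge> 4 * k"
  shows "card {\<pi>. \<pi> permutes U \<and> (\<Sum>j\<in>U. b j * a (\<pi> j)) = x}
    \<le> 4 * (real k + 1) ^ 2 * (8 * real k) ^ (2 * k) / sqrt N * fact n
       * (real N ^ (k + R) / real N ^ (2 * k) + 2 ^ (4 * k) * B)"
proof -
  define Pi where "Pi = {\<pi>. \<pi> permutes U}"
  define S where "S \<pi> = (\<Sum>j\<in>U. b j * a (\<pi> j))" for \<pi>
  define w where "w \<pi> p = d p * (a (\<pi> (s' p)) - a (\<pi> (s p)))" for \<pi> p
  define sw where "sw X j = (if j \<in> s ` X then s' (inv_into P s j)
     else if j \<in> s' ` X then s (inv_into P s' j) else j)" for X j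
  have finPi: "finite Pi" unfolding Pi_def by (rule finite_permutations[OF U(1)])
  have cPi: "card Pi = fact n" unfolding Pi_def using card_permutations[OF U(2,1)] .
  have N1: "N \<ge> 1" using k by simp
  have ne: "P \<noteq> {}" using P N1 by auto
  have Une: "U \<noteq> {}" using ne s by auto
  \<comment> \<open>Together with \<open>N \<ge> 4 * k\<close> this provides
    \<open>8 * r \<le> n\<close> for all r up to k.\<close>
  have n2: "2 * N \<le> n"
  proof -
    have "card (s ` P \<union> s' ` P) = 2 * N"
      using card_Un_disjoint[OF _ _ disj] P card_image[OF s(1)] card_image[OF s'(1)] by simp
    moreover have "card (s ` P \<union> s' ` P) \<le> card U" by (rule card_mono) (use U s s' in auto)
    ultimately show ?thesis using U by simp
  qed
  have sw_s: "sw X (s p) = s' p" and sw_s': "sw X (s' p) = s p" if "p \<in> X" "X \<subseteq> P" for X p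
  proof -
    have "p \<in> P" using that by auto
    moreover from this have "s' p \<notin> s ` X" using disj that by blast
    ultimately show "sw X (s p) = s' p" "sw X (s' p) = s p"
      using that s s' by (auto simp: sw_def)
  qed
  have sw_other: "sw X j = j" if "j \<notin> s ` X" "j \<notin> s' ` X" for X j using that by (simp add: sw_def)
  have sw_sw: "sw X (sw X j) = j" if "X \<subseteq> P" for X j
  proof -
    consider p where "p \<in> X" "j = s p" | p where "p \<in> X" "j = s' p" | "j \<notin> s ` X" "j \<notin> s' ` X" by blast
    then show ?thesis
    proof cases
      case 1 then show ?thesis by (simp add: sw_s[OF _ that] sw_s'[OF _ that])
    next
      case 2 then show ?thesis by (simp add: sw_s[OF _ that] sw_s'[OF _ that])
    next
      case 3 then show ?thesis by (simp add: sw_other)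
    qed
  qed
  have sw_perm: "sw X permutes U" if X: "X \<subseteq> P" for X
  proof (rule bij_imp_permutes)
    have im: "sw X ` U \<subseteq> U"
    proof
      fix i assume "i \<in> sw X ` U"
      then obtain j where j: "j \<in> U" "i = sw X j" by auto
      consider p where "p \<in> X" "j = s p" | p where "p \<in> X" "j = s' p" | "j \<notin> s ` X" "j \<notin> s' ` X" by blast
      then show "i \<in> U"
      proof cases
        case (1 p) then have "i = s' p" "p \<in> P" using j sw_s[OF _ X] X by auto
        then show ?thesis using s'(2) by blast
      next
        case (2 p) then have "i = s p" "p \<in> P" using j sw_s'[OF _ X] X by auto
        then show ?thesis using s(2) by blast
      next
        case 3 then show ?thesis using j sw_other by simp
      qed
    qed
    have inj: "inj_on (sw X) U" by (rule inj_on_inverseI[of _ "sw X"]) (simp add: sw_sw X)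
    show "bij_betw (sw X) U U"
      using endo_inj_surj[OF U(1) im inj] inj by (simp add: bij_betw_def)
    show "sw X i = i" if "i \<notin> U" for i
      using that X s s' by (intro sw_other) auto
  qed
  have S_sw: "S (\<pi> \<circ> sw X) = S \<pi> + sum (w \<pi>) X" if X: "X \<subseteq> P" for \<pi> X
  proof -
    have finX: "finite X" using finite_subset[OF X P(1)] .
    have "S (\<pi> \<circ> sw X) - S \<pi> = (\<Sum>j\<in>U. b j * a (\<pi> (sw X j)) - b j * a (\<pi> j))"
      by (simp add: S_def sum_subtractf)
    also have "\<dots> = (\<Sum>j\<in>s ` X \<union> s' ` X. b j * a (\<pi> (sw X j)) - b j * a (\<pi> j))"
    proof (rule sum.mono_neutral_right)
      show "s ` X \<union> s' ` X \<subseteq> U" using X s s' by auto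
    qed (use U sw_other in auto)
    also have "\<dots> = (\<Sum>j\<in>s ` X. b j * a (\<pi> (sw X j)) - b j * a (\<pi> j)) + (\<Sum>j\<in>s' ` X. b j * a (\<pi> (sw X j)) - b j * a (\<pi> j))"
      by (rule sum.union_disjoint) (use finX disj X in auto)
    also have "(\<Sum>j\<in>s ` X. b j * a (\<pi> (sw X j)) - b j * a (\<pi> j)) = (\<Sum>p\<in>X. b (s p) * a (\<pi> (s' p)) - b (s p) * a (\<pi> (s p)))"
      by (subst sum.reindex[OF inj_on_subset[OF s(1) X]]) (simp add: sw_s[OF _ X])
    also have "(\<Sum>j\<in>s' ` X. b j * a (\<pi> (sw X j)) - b j * a (\<pi> j)) = (\<Sum>p\<in>X. b (s' p) * a (\<pi> (s p)) - b (s' p) * a (\<pi> (s' p)))"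
      by (subst sum.reindex[OF inj_on_subset[OF s'(1) X]]) (simp add: sw_s'[OF _ X])
    also have "(\<Sum>p\<in>X. b (s p) * a (\<pi> (s' p)) - b (s p) * a (\<pi> (s p))) + (\<Sum>p\<in>X. b (s' p) * a (\<pi> (s p)) - b (s' p) * a (\<pi> (s' p))) = sum (w \<pi>) X"
      unfolding sum.distrib[symmetric] w_def d_def by (intro sum.cong refl) (simp add: algebra_simps)
    finally show ?thesis by linarith
  qed
  have same: "card {\<pi>\<in>Pi. S (\<pi> \<circ> sw X) = x} = card {\<pi>\<in>Pi. S \<pi> = x}" if X: "X \<subseteq> P" for X
  proof (rule bij_betw_same_card[of "\<lambda>\<pi>. \<pi> \<circ> sw X"], rule bij_betwI[where g = "\<lambda>\<pi>. \<pi> \<circ> sw X"])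
    have id: "\<pi> \<circ> sw X \<circ> sw X = \<pi>" for \<pi> :: "nat \<Rightarrow> nat" using sw_sw[OF X] by (auto simp: fun_eq_iff)
    show "(\<lambda>\<pi>. \<pi> \<circ> sw X) \<in> {\<pi>\<in>Pi. S (\<pi> \<circ> sw X) = x} \<rightarrow> {\<pi>\<in>Pi. S \<pi> = x}"
      using permutes_compose[OF sw_perm[OF X]] by (auto simp: Pi_def)
    show "(\<lambda>\<pi>. \<pi> \<circ> sw X) \<in> {\<pi>\<in>Pi. S \<pi> = x} \<rightarrow> {\<pi>\<in>Pi. S (\<pi> \<circ> sw X) = x}"
      using permutes_compose[OF sw_perm[OF X]] by (auto simp: Pi_def id)
  qed (use sw_sw[OF X] in \<open>auto simp: fun_eq_iff\<close>)
  have "2 ^ N * card {\<pi>\<in>Pi. S \<pi> = x} = (\<Sum>X\<in>Pow P. card {\<pi>\<in>Pi. S \<pi> = x})"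
    using P by (simp add: card_Pow)
  also have "\<dots> = (\<Sum>X\<in>Pow P. card {\<pi>\<in>Pi. S (\<pi> \<circ> sw X) = x})"
    by (intro sum.cong refl) (simp add: same)
  also have "\<dots> = (\<Sum>X\<in>Pow P. \<Sum>\<pi>\<in>Pi. of_bool (S \<pi> + sum (w \<pi>) X = x))"
    using finPi by (intro sum.cong refl) (simp add: sum_of_bool_eq Int_def S_sw)
  also have "\<dots> = (\<Sum>\<pi>\<in>Pi. \<Sum>X\<in>Pow P. of_bool (S \<pi> + sum (w \<pi>) X = x))" by (rule sum.swap)
  also have "\<dots> = (\<Sum>\<pi>\<in>Pi. card {X. X \<subseteq> P \<and> sum (w \<pi>) X = x - S \<pi>})"
  proof (intro sum.cong refl)
    fix \<pi>
    have "Pow P \<inter> {X. S \<pi> + sum (w \<pi>) X = x} = {X. X \<subseteq> P \<and> sum (w \<pi>) X = x - S \<pi>}" by auto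
    then show "(\<Sum>X\<in>Pow P. of_bool (S \<pi> + sum (w \<pi>) X = x)) = card {X. X \<subseteq> P \<and> sum (w \<pi>) X = x - S \<pi>}"
      using P by (simp add: sum_of_bool_eq)
  qed
  finally have double: "2 ^ N * card {\<pi>\<in>Pi. S \<pi> = x} = (\<Sum>\<pi>\<in>Pi. card {X. X \<subseteq> P \<and> sum (w \<pi>) X = x - S \<pi>})" .
  define K where "K = 4 * (real k + 1) * (8 * real k) ^ (2 * k) / sqrt N"
  have K0: "K \<ge> 0" by (simp add: K_def)
  have absw: "\<bar>w \<pi> p\<bar> = d p * \<bar>a (\<pi> (s' p)) - a (\<pi> (s p))\<bar>" if "p \<in> P" for \<pi> p
    using d[OF that] by (simp add: w_def abs_mult)
  have energy: "(\<Sum>\<pi>\<in>Pi. real (subset_energy (\<lambda>p. \<bar>w \<pi> p\<bar>) P k))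
     \<le> (real k + 1) * fact n * (real N ^ (k + R) + real N ^ (2 * k) * (2 ^ (4 * k) * B))"
  proof -
    define u where "u \<pi> p = d p * \<bar>a (\<pi> (s' p)) - a (\<pi> (s p))\<bar>" for \<pi> p
    have se: "subset_energy (\<lambda>p. \<bar>w \<pi> p\<bar>) P k = subset_energy (u \<pi>) P k" for \<pi>
    proof -
      have "(\<Sum>p\<in>X. \<bar>w \<pi> p\<bar>) = sum (u \<pi>) X" if "X \<subseteq> P" for X
        using that by (intro sum.cong refl) (auto simp: absw u_def)
      then show ?thesis unfolding subset_energy_def by (intro arg_cong[of _ _ card]) auto
    qed
    have "(\<Sum>\<pi>\<in>Pi. subset_energy (\<lambda>p. \<bar>w \<pi> p\<bar>) P k) \<le> (\<Sum>\<pi>\<in>Pi. \<Sum>r\<le>k. card P ^ (k - r) * list_energy (u \<pi>) P r)"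
      unfolding se by (intro sum_mono subset_energy_le_list_energy P)
    also have "\<dots> = (\<Sum>r\<le>k. N ^ (k - r) * (\<Sum>\<pi>\<in>Pi. list_energy (u \<pi>) P r))"
      using P by (subst sum.swap) (simp add: sum_distrib_left)
    finally have "real (\<Sum>\<pi>\<in>Pi. subset_energy (\<lambda>p. \<bar>w \<pi> p\<bar>) P k) \<le> real (\<Sum>r\<le>k. N ^ (k - r) * (\<Sum>\<pi>\<in>Pi. list_energy (u \<pi>) P r))"
      by (simp only: of_nat_le_iff)
    then have "(\<Sum>\<pi>\<in>Pi. real (subset_energy (\<lambda>p. \<bar>w \<pi> p\<bar>) P k)) \<le> (\<Sum>r\<le>k. real N ^ (k - r) * (\<Sum>\<pi>\<in>Pi. real (list_energy (u \<pi>) P r)))"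
      by simp
    also have "\<dots> \<le> (\<Sum>r\<le>k. fact n * (real N ^ (k + R) + real N ^ (2 * k) * (2 ^ (4 * k) * B)))"
    proof (rule sum_mono)
      fix r assume "r \<in> {..k}"
      then have r: "r \<le> k" by simp
      have e1: "real N ^ (k - r) * real N ^ (2 * r) = real N ^ (k + r)"
        using r by (simp add: add.commute flip: power_add)
      show "real N ^ (k - r) * (\<Sum>\<pi>\<in>Pi. real (list_energy (u \<pi>) P r))
         \<le> fact n * (real N ^ (k + R) + real N ^ (2 * k) * (2 ^ (4 * k) * B))"
      \<comment> \<open>Order r leads to bilinear sums of 2r terms, while \<open>B\<close> is
        available only from R terms on. Below that the trivial count
        \<open>N^(k - r) * N^(2 r) = N^(k + r)\<close> is used, which is at most
        \<open>N^(k + R)\<close>.\<close>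
      proof (cases "2 * r < R")
        case True
        have "(\<Sum>\<pi>\<in>Pi. real (list_energy (u \<pi>) P r)) \<le> (\<Sum>\<pi>\<in>Pi. real N ^ (2 * r))"
          using list_energy_le[OF P(1)] P(2) by (intro sum_mono) (metis of_nat_le_iff of_nat_power)
        also have "\<dots> = fact n * real N ^ (2 * r)" using cPi by simp
        finally have "real N ^ (k - r) * (\<Sum>\<pi>\<in>Pi. real (list_energy (u \<pi>) P r)) \<le> real N ^ (k - r) * (fact n * real N ^ (2 * r))"
          by (rule mult_left_mono) simp
        also have "\<dots> = fact n * real N ^ (k + r)" using e1 by (simp add: algebra_simps)
        also have "\<dots> \<le> fact n * real N ^ (k + R)"
          using True N1 by (intro mult_left_mono power_increasing) auto
        also have "\<dots> \<le> fact n * (real N ^ (k + R) + real N ^ (2 * k) * (2 ^ (4 * k) * B))"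
          using B0 by (intro mult_left_mono) auto
        finally show ?thesis .
      next
        case False
        have "(\<Sum>\<pi>\<in>Pi. real (list_energy (u \<pi>) P r)) \<le> fact n * 2 ^ (4 * r) * real (card P) ^ (2 * r) * B"
          unfolding Pi_def u_def
          by (rule sum_over_permutations_list_energy[OF a U _ Une P(1) ne s s' disj _ B0])
            (use n2 k r False B in auto)
        then have "real N ^ (k - r) * (\<Sum>\<pi>\<in>Pi. real (list_energy (u \<pi>) P r)) \<le> real N ^ (k - r) * (fact n * 2 ^ (4 * r) * real N ^ (2 * r) * B)"
          unfolding P(2) by (rule mult_left_mono) simp
        also have "\<dots> = fact n * (real N ^ (k + r) * (2 ^ (4 * r) * B))" using e1 by (simp add: algebra_simps)
        also have "\<dots> \<le> fact n * (real N ^ (2 * k) * (2 ^ (4 * k) * B))"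
          using r N1 B0 by (intro mult_left_mono mult_mono mult_right_mono power_increasing) auto
        also have "\<dots> \<le> fact n * (real N ^ (k + R) + real N ^ (2 * k) * (2 ^ (4 * k) * B))"
          by (intro mult_left_mono) auto
        finally show ?thesis .
      qed
    qed
    also have "\<dots> = (real k + 1) * fact n * (real N ^ (k + R) + real N ^ (2 * k) * (2 ^ (4 * k) * B))" by (simp add: algebra_simps)
    finally show ?thesis .
  qed
  have "2 ^ N * real (card {\<pi>\<in>Pi. S \<pi> = x}) = (\<Sum>\<pi>\<in>Pi. real (card {X. X \<subseteq> P \<and> sum (w \<pi>) X = x - S \<pi>}))"
    using arg_cong[OF double, of real] by simp
  also have "\<dots> \<le> (\<Sum>\<pi>\<in>Pi. K * 2 ^ N / real N ^ (2 * k) * real (subset_energy (\<lambda>p. \<bar>w \<pi> p\<bar>) P k))"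
  proof (rule sum_mono)
    fix \<pi> assume pi: "\<pi> \<in> Pi"
    have "w \<pi> p \<noteq> 0" if p: "p \<in> P" for p
    proof -
      have "s p \<noteq> s' p" using disj p by blast
      moreover have "s p \<in> U" "s' p \<in> U" using p s s' by auto
      ultimately have "\<pi> (s p) \<noteq> \<pi> (s' p)" "\<pi> (s p) \<in> U" "\<pi> (s' p) \<in> U"
        using pi permutes_inj[of \<pi> U] permutes_in_image[of \<pi> U] by (auto simp: Pi_def inj_def)
      then have "a (\<pi> (s' p)) \<noteq> a (\<pi> (s p))" using a by (auto simp: inj_on_def)
      then show ?thesis using d[OF p] by (simp add: w_def)
    qed
    then have "real (card {X. X \<subseteq> P \<and> sum (w \<pi>) X = x - S \<pi>})
       \<le> 4 * (real k + 1) * (8 * real k) ^ (2 * k) * 2 ^ N / sqrt N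
        * (subset_energy (\<lambda>p. \<bar>w \<pi> p\<bar>) P k / real N ^ (2 * k))"
      by (rule card_equal_sums[OF P k(2,1)])
    also have "\<dots> = K * 2 ^ N / real N ^ (2 * k) * real (subset_energy (\<lambda>p. \<bar>w \<pi> p\<bar>) P k)" by (simp add: K_def)
    finally show "real (card {X. X \<subseteq> P \<and> sum (w \<pi>) X = x - S \<pi>})
       \<le> K * 2 ^ N / real N ^ (2 * k) * real (subset_energy (\<lambda>p. \<bar>w \<pi> p\<bar>) P k)" .
  qed
  also have "\<dots> = K * 2 ^ N / real N ^ (2 * k) * (\<Sum>\<pi>\<in>Pi. real (subset_energy (\<lambda>p. \<bar>w \<pi> p\<bar>) P k))"
    by (simp add: sum_distrib_left)
  also have "\<dots> \<le> K * 2 ^ N / real N ^ (2 * k) * ((real k + 1) * fact n * (real N ^ (k + R) + real N ^ (2 * k) * (2 ^ (4 * k) * B)))"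
    by (rule mult_left_mono[OF energy]) (use K0 in simp)
  also have "\<dots> = 2 ^ N * (K * (real k + 1) * fact n * ((real N ^ (k + R) + real N ^ (2 * k) * (2 ^ (4 * k) * B)) / real N ^ (2 * k)))"
    by simp
  finally have "real (card {\<pi>\<in>Pi. S \<pi> = x}) \<le> K * (real k + 1) * fact n * ((real N ^ (k + R) + real N ^ (2 * k) * (2 ^ (4 * k) * B)) / real N ^ (2 * k))"
    by (rule mult_left_le_imp_le) simp
  also have "(real N ^ (k + R) + real N ^ (2 * k) * (2 ^ (4 * k) * B)) / real N ^ (2 * k) = real N ^ (k + R) / real N ^ (2 * k) + 2 ^ (4 * k) * B"
    using N1 by (simp add: add_divide_distrib)
  also have "K * (real k + 1) = 4 * (real k + 1) ^ 2 * (8 * real k) ^ (2 * k) / sqrt N"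
    by (simp add: K_def power2_eq_square)
  finally show ?thesis by (simp add: Pi_def S_def)
qed

section \<open>Multiplicity profiles\<close>

lemma harmonic_sum_le: "n \<ge> 1 \<Longrightarrow> (\<Sum>i\<in>{1..n}. 1 / real i) \<le> 1 + ln (real n)"
proof (induction n rule: nat_induct_at_least)
  case (Suc n)
  have np: "real n > 0" using Suc by simp
  have "ln (real n / real (Suc n)) \<le> real n / real (Suc n) - 1" by (rule ln_le_minus_one) (use np in simp)
  then have "1 / real (Suc n) \<le> ln (real (Suc n)) - ln (real n)"
    using np by (simp add: ln_div field_simps)
  then show ?case using Suc by simp
qed simp

lemma sum_inverse_le_powr:
  assumes "n \<ge> 1" "e > 0"
  shows "(\<Sum>i\<in>{1..n}. 1 / real i) \<le> (1 + 1 / e) * real n powr e"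
proof -
  have "1 + ln (real n) \<le> real n powr e + real n powr e / e"
    by (intro add_mono ln_powr_bound ge_one_powr_ge_zero) (use assms in auto)
  then show ?thesis using harmonic_sum_le[OF assms(1)] by (simp add: algebra_simps)
qed

lemma length_filter_mult_profile:
  fixes B :: "'a :: linorder multiset"
  shows "length (filter p (mult_profile B)) = card {y \<in> set_mset B. p (count B y)}"
proof -
  let ?xs = "sorted_list_of_set (set_mset B)"
  have "length (filter p (mult_profile B)) = size (filter_mset p (mset (mult_profile B)))" by (simp flip: mset_filter)
  also have "mset (mult_profile B) = mset (map (count B) ?xs)" by (simp add: mult_profile_def)
  also have "size (filter_mset p (mset (map (count B) ?xs))) = length (filter (p \<circ> count B) ?xs)"
    by (metis mset_filter size_mset filter_map length_map)
  also have "\<dots> = card ({y. (p \<circ> count B) y} \<inter> set ?xs)" by (rule distinct_length_filter) simp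
  also have "{y. (p \<circ> count B) y} \<inter> set ?xs = {y \<in> set_mset B. p (count B y)}" by auto
  finally show ?thesis .
qed

lemma mult_profile_nth_antimono:
  "i \<le> j \<Longrightarrow> j < length (mult_profile B) \<Longrightarrow> mult_profile B ! j \<le> mult_profile B ! i"
  by (rule sorted_rev_nth_mono) (auto simp: mult_profile_def)

text \<open>Entries 0 to i of the nonincreasing profile are all at least entry i, and each belongs
  to a value of its own.\<close>

lemma card_frequent_values:
  assumes "i < length (mult_profile B)"
  shows "i + 1 \<le> card {y \<in> set_mset B. mult_profile B ! i \<le> count B y}"
proof -
  let ?\<mu> = "mult_profile B"
  let ?p = "\<lambda>c. ?\<mu> ! i \<le> c"
  have "filter ?p (take (Suc i) ?\<mu>) = take (Suc i) ?\<mu>"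
  proof (rule filter_True, rule ballI)
    fix c assume "c \<in> set (take (Suc i) ?\<mu>)"
    then obtain j where "j < Suc i" "c = ?\<mu> ! j" using assms by (auto simp: in_set_conv_nth)
    then show "?\<mu> ! i \<le> c" using mult_profile_nth_antimono[of j i B] assms by simp
  qed
  then have "i + 1 = length (filter ?p (take (Suc i) ?\<mu>))" using assms by simp
  also have "\<dots> \<le> length (filter ?p (take (Suc i) ?\<mu> @ drop (Suc i) ?\<mu>))" by (subst filter_append) simp
  finally show ?thesis by (simp add: length_filter_mult_profile)
qed

lemma set_mult_profile: "set (mult_profile B) = count B ` set_mset B"
  by (auto simp: mult_profile_def)

lemma length_mult_profile: "length (mult_profile B) = card (set_mset B)"
  by (simp add: mult_profile_def)

lemma sum_list_mult_profile: "sum_list (mult_profile B) = size B"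
proof -
  have "sum_list (mult_profile B) = sum_list (map (count B) (sorted_list_of_set (set_mset B)))"
    unfolding mult_profile_def by (metis mset_rev mset_sort sum_mset_sum_list)
  then show ?thesis by (simp add: sum_list_distinct_conv_sum_set size_multiset_overloaded_eq)
qed

text \<open>Write \<open>i^2 \<mu>_i\<close> as \<open>i^3 \<mu>_i\<close> times 1/i and take out
  the largest \<open>i^3 \<mu>_i\<close>; a harmonic sum remains. Index 0 drops out because its
  weight in M is 0.\<close>

lemma M_le_max_cube:
  assumes "M B > 0" "size B = n" "n \<ge> 1"
  obtains i where "1 \<le> i" "i < length (mult_profile B)" "mult_profile B ! i \<ge> 1"
    "M B \<le> real i ^ 3 * real (mult_profile B ! i) * (\<Sum>j\<in>{1..n}. 1 / real j)"
proof -
  let ?\<mu> = "mult_profile B"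
  let ?L = "length ?\<mu>"
  have MB: "M B = (\<Sum>i\<in>{1..<?L}. (real i)^2 * real (?\<mu> ! i))"
    unfolding M_def by (rule sum.mono_neutral_right) (auto simp: not_less_eq_eq)
  have L: "{1..<?L} \<noteq> {}"
  proof
    assume "{1..<?L} = {}"
    then show False using assms(1) unfolding MB by (metis less_irrefl sum.empty)
  qed
  define f where "f i = real i ^ 3 * real (?\<mu> ! i)" for i
  have "Max (f ` {1..<?L}) \<in> f ` {1..<?L}" using L by (intro Max_in) auto
  then obtain i where i: "i \<in> {1..<?L}" "f i = Max (f ` {1..<?L})" by auto
  have Ln: "?L \<le> n"
  proof -
    have "(\<Sum>y\<in>set_mset B. 1) \<le> (\<Sum>y\<in>set_mset B. count B y)"
      by (rule sum_mono) (simp add: Suc_le_eq)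
    then have "?L \<le> size B" by (simp add: length_mult_profile size_multiset_overloaded_eq)
    then show ?thesis using assms(2) by simp
  qed
  have "M B = (\<Sum>j\<in>{1..<?L}. f j * (1 / real j))"
    unfolding MB f_def by (intro sum.cong refl) (simp add: power2_eq_square power3_eq_cube)
  also have "\<dots> \<le> (\<Sum>j\<in>{1..<?L}. f i * (1 / real j))"
    by (intro sum_mono mult_right_mono) (use i in \<open>auto intro: Max_ge\<close>)
  also have "\<dots> = f i * (\<Sum>j\<in>{1..<?L}. 1 / real j)" by (simp add: sum_distrib_left)
  also have "\<dots> \<le> f i * (\<Sum>j\<in>{1..n}. 1 / real j)"
    by (intro mult_left_mono sum_mono2) (use Ln in \<open>auto simp: f_def\<close>)
  finally have "M B \<le> f i * (\<Sum>j\<in>{1..n}. 1 / real j)" .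
  moreover have "?\<mu> ! i \<ge> 1"
  proof -
    have "?\<mu> ! i \<in> set ?\<mu>" using i by simp
    then show ?thesis by (auto simp: set_mult_profile Suc_le_eq)
  qed
  ultimately show ?thesis using that[of i] i by (simp add: f_def)
qed

text \<open>All entries of B outside one most frequent value enter M with weight at least 1. A small
  M therefore forces a majority value.\<close>

lemma size_minus_max_le_M:
  assumes "length (mult_profile B) \<ge> 1"
  shows "real (size B) - real (mult_profile B ! 0) \<le> M B"
proof -
  let ?\<mu> = "mult_profile B"
  have "real (size B) = (\<Sum>i<length ?\<mu>. real (?\<mu> ! i))"
    unfolding sum_list_mult_profile[symmetric] sum_list_sum_nth by (simp add: atLeast0LessThan)
  also have "\<dots> \<le> (\<Sum>i<length ?\<mu>. (if i = 0 then real (?\<mu> ! 0) else 0) + (real i)^2 * real (?\<mu> ! i))"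
  proof (rule sum_mono)
    fix i
    show "real (?\<mu> ! i) \<le> (if i = 0 then real (?\<mu> ! 0) else 0) + (real i)^2 * real (?\<mu> ! i)"
    proof (cases "i = 0")
      case False
      then have "1 * real (?\<mu> ! i) \<le> (real i)^2 * real (?\<mu> ! i)" by (intro mult_right_mono) auto
      then show ?thesis by simp
    qed simp
  qed
  also have "\<dots> = real (?\<mu> ! 0) + M B"
    using assms by (subst sum.distrib) (simp add: M_def sum.delta Suc_le_eq)
  finally show ?thesis by simp
qed

text \<open>Of 2l values taken at least m times, the j-th largest is paired with the j-th smallest; then the
  l differences are distinct.\<close>
lemma exists_index_pairs:
  fixes b :: "nat \<Rightarrow> real"
  assumes U: "finite U" and V: "finite V" "card V \<ge> 2 * l" "\<And>y. y \<in> V \<Longrightarrow> card {i \<in> U. b i = y} \<ge> m"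
  defines "P \<equiv> {..<l} \<times> {..<m}"
  obtains s s' :: "nat \<times> nat \<Rightarrow> nat" where
    "inj_on s P" "s ` P \<subseteq> U" "inj_on s' P" "s' ` P \<subseteq> U" "s ` P \<inter> s' ` P = {}"
    "\<forall>p\<in>P. b (s p) - b (s' p) > 0"
    "card ((\<lambda>p. b (s p) - b (s' p)) ` P) \<le> l"
    "\<forall>y. card {p \<in> P. b (s p) - b (s' p) = y} \<le> m"
proof -
  define vs where "vs = sorted_list_of_set V"
  define L where "L = length vs"
  have L: "L \<ge> 2 * l" and vs: "set vs = V" "sorted_wrt (<) vs"
    using V by (auto simp: L_def vs_def strict_sorted_list_of_set)
  have lt: "vs ! i < vs ! j" if "i < j" "j < L" for i j
    using sorted_wrt_nth_less[OF vs(2)] that by (simp add: L_def)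
  have inj: "i = j" if "vs ! i = vs ! j" "i < L" "j < L" for i j
    using lt[of i j] lt[of j i] that by (cases i j rule: linorder_cases) auto
  have "\<exists>f. f ` {..<m} \<subseteq> {i \<in> U. b i = y} \<and> inj_on f {..<m}" if "y \<in> V" for y
    using card_le_inj[of "{..<m}" "{i \<in> U. b i = y}"] V(3)[OF that] U by simp
  then obtain e where e: "\<And>y. y \<in> V \<Longrightarrow> e y ` {..<m} \<subseteq> {i \<in> U. b i = y} \<and> inj_on (e y) {..<m}" by metis
  have nthV: "vs ! j \<in> V" if "j < L" for j using that vs by (auto simp: L_def)
  have eU: "e (vs ! j) t \<in> U" and be: "b (e (vs ! j) t) = vs ! j" if "j < L" "t < m" for j t
    using e[OF nthV[OF that(1)]] that by auto
  have einj: "j = j' \<and> t = t'" if "e (vs ! j) t = e (vs ! j') t'" "j < L" "j' < L" "t < m" "t' < m" for j j' t t'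
  proof -
    have "vs ! j = vs ! j'" using be[of j t] be[of j' t'] that by simp
    then have "j = j'" using inj that by blast
    then show ?thesis using that e[OF nthV[of j]] by (auto simp: inj_on_def)
  qed
  define s where "s = (\<lambda>(j, t). e (vs ! (L - 1 - j)) t)"
  define s' where "s' = (\<lambda>(j, t). e (vs ! j) t)"
  \<comment> \<open>The pairs are nested in the sorted list, so these differences strictly decrease
    in j; \<open>2 * l \<le> L\<close> keeps the two sides apart.\<close>
  define \<delta> where "\<delta> j = vs ! (L - 1 - j) - vs ! j" for j
  have b\<delta>: "b (s p) - b (s' p) = \<delta> (fst p)" if pP: "p \<in> P" for p
  proof -
    obtain j t where p: "p = (j, t)" "j < l" "t < m" using pP by (auto simp: P_def)
    then have "L - 1 - j < L" "j < L" using L by linarith+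
    then show ?thesis using p be by (simp add: s_def s'_def \<delta>_def)
  qed
  have \<delta>: "\<delta> j < \<delta> i" if "i < j" "j < l" for i j
  proof -
    have "vs ! (L - 1 - j) < vs ! (L - 1 - i)" using that L by (intro lt) linarith+
    moreover have "vs ! i < vs ! j" using that L by (intro lt) linarith+
    ultimately show ?thesis by (simp add: \<delta>_def)
  qed
  show thesis
  proof (rule that[of s s'])
    show "inj_on s P"
    proof (rule inj_onI)
      fix p q assume p: "p \<in> P" and q: "q \<in> P" and eq: "s p = s q"
      obtain j t where p': "p = (j, t)" "j < l" "t < m" using p by (auto simp: P_def)
      obtain j' t' where q': "q = (j', t')" "j' < l" "t' < m" using q by (auto simp: P_def)
      have b: "L - 1 - j < L" "L - 1 - j' < L" using L p' q' by linarith+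
      have "L - 1 - j = L - 1 - j' \<and> t = t'"
        by (rule einj) (use eq p' q' b in \<open>auto simp: s_def\<close>)
      moreover have "j \<le> L - 1" "j' \<le> L - 1" using L p' q' by linarith+
      ultimately show "p = q" using p' q' by auto
    qed
    show "inj_on s' P"
    proof (rule inj_onI)
      fix p q assume p: "p \<in> P" and q: "q \<in> P" and eq: "s' p = s' q"
      obtain j t where p': "p = (j, t)" "j < l" "t < m" using p by (auto simp: P_def)
      obtain j' t' where q': "q = (j', t')" "j' < l" "t' < m" using q by (auto simp: P_def)
      have b: "j < L" "j' < L" using L p' q' by linarith+
      have "j = j' \<and> t = t'"
        by (rule einj) (use eq p' q' b in \<open>auto simp: s'_def\<close>)
      then show "p = q" using p' q' by auto
    qed
    show "s ` P \<subseteq> U" "s' ` P \<subseteq> U" using L by (auto simp: s_def s'_def P_def intro!: eU)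
    show "s ` P \<inter> s' ` P = {}"
    proof (rule equals0I)
      fix i assume "i \<in> s ` P \<inter> s' ` P"
      then obtain j t j' t' where p: "j < l" "t < m" "j' < l" "t' < m" "e (vs ! (L - 1 - j)) t = e (vs ! j') t'"
        by (auto simp: s_def s'_def P_def)
      have "L - 1 - j = j' \<and> t = t'" by (rule einj) (use p L in auto)
      then show False using p L by linarith
    qed
    show "\<forall>p\<in>P. b (s p) - b (s' p) > 0"
    proof
      fix p assume pP: "p \<in> P"
      then have j: "fst p < l" by (auto simp: P_def)
      have "vs ! fst p < vs ! (L - 1 - fst p)" using j L by (intro lt) linarith+
      then show "b (s p) - b (s' p) > 0" unfolding b\<delta>[OF pP] by (simp add: \<delta>_def)
    qed
    have "(\<lambda>p. b (s p) - b (s' p)) ` P \<subseteq> \<delta> ` {..<l}" using b\<delta> by (force simp: P_def)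
    then have "card ((\<lambda>p. b (s p) - b (s' p)) ` P) \<le> card (\<delta> ` {..<l})" by (intro card_mono) auto
    also have "\<dots> \<le> l" using card_image_le[of "{..<l}" \<delta>] by simp
    finally show "card ((\<lambda>p. b (s p) - b (s' p)) ` P) \<le> l" .
    show "\<forall>y. card {p \<in> P. b (s p) - b (s' p) = y} \<le> m"
    proof
      fix y
      have "card {p \<in> P. b (s p) - b (s' p) = y} \<le> card {..<m}"
      proof (rule card_inj_on_le[of snd])
        show "inj_on snd {p \<in> P. b (s p) - b (s' p) = y}"
        proof (rule inj_onI)
          fix p q assume p: "p \<in> {p \<in> P. b (s p) - b (s' p) = y}" and q: "q \<in> {p \<in> P. b (s p) - b (s' p) = y}"
            and eq: "snd p = snd q"
          have "\<delta> (fst p) = \<delta> (fst q)" "fst p < l" "fst q < l" using p q b\<delta>[of p] b\<delta>[of q] by (auto simp: P_def)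
          then have "fst p = fst q" using \<delta>[of "fst p" "fst q"] \<delta>[of "fst q" "fst p"]
            by (cases "fst p" "fst q" rule: linorder_cases) auto
          then show "p = q" using eq by (simp add: prod_eq_iff)
        qed
      qed (auto simp: P_def)
      then show "card {p \<in> P. b (s p) - b (s' p) = y} \<le> m" by simp
    qed
  qed
qed

text \<open>Swapping a fixed index outside the majority class with a varying index inside it produces
  pairwise distinct sums.\<close>
lemma majority_count_bound:
  fixes a b :: "nat \<Rightarrow> real"
  assumes a: "inj_on a U" and U: "finite U" and s: "s \<in> U" "b s \<noteq> y"
  shows "card {t \<in> U. b t = y} * card {\<pi>. \<pi> permutes U \<and> (\<Sum>j\<in>U. b j * a (\<pi> j)) = x} \<le> fact (card U)"
proof -
  define T where "T = {t \<in> U. b t = y}"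
  define Pi where "Pi = {\<pi>. \<pi> permutes U}"
  define S where "S \<pi> = (\<Sum>j\<in>U. b j * a (\<pi> j))" for \<pi>
  have finPi: "finite Pi" unfolding Pi_def by (rule finite_permutations[OF U])
  have finT: "finite T" using U by (simp add: T_def)
  have sw: "S (\<pi> \<circ> Transposition.transpose s t) = S \<pi> + (b s - y) * (a (\<pi> t) - a (\<pi> s))" if t: "t \<in> T" for \<pi> t
  proof -
    have st: "s \<noteq> t" "t \<in> U" "b t = y" using t s by (auto simp: T_def)
    have "S (\<pi> \<circ> Transposition.transpose s t) - S \<pi> = (\<Sum>j\<in>U. b j * a (\<pi> (Transposition.transpose s t j)) - b j * a (\<pi> j))"
      by (simp add: S_def sum_subtractf)
    also have "\<dots> = (\<Sum>j\<in>{s, t}. b j * a (\<pi> (Transposition.transpose s t j)) - b j * a (\<pi> j))"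
      by (rule sum.mono_neutral_right) (use U s st in \<open>auto simp: Transposition.transpose_def\<close>)
    also have "\<dots> = (b s - y) * (a (\<pi> t) - a (\<pi> s))" using st by (simp add: algebra_simps)
    finally show ?thesis by linarith
  qed
  have same: "card {\<pi>\<in>Pi. S (\<pi> \<circ> Transposition.transpose s t) = x} = card {\<pi>\<in>Pi. S \<pi> = x}" if t: "t \<in> T" for t
  proof (rule bij_betw_same_card[of "\<lambda>\<pi>. \<pi> \<circ> Transposition.transpose s t"], rule bij_betwI[where g = "\<lambda>\<pi>. \<pi> \<circ> Transposition.transpose s t"])
    have pt: "Transposition.transpose s t permutes U" by (rule permutes_swap_id) (use s t in \<open>auto simp: T_def\<close>)
    have id: "\<pi> \<circ> Transposition.transpose s t \<circ> Transposition.transpose s t = \<pi>" for \<pi> :: "nat \<Rightarrow> nat" by (simp add: comp_assoc)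
    show "(\<lambda>\<pi>. \<pi> \<circ> Transposition.transpose s t) \<in> {\<pi>\<in>Pi. S (\<pi> \<circ> Transposition.transpose s t) = x} \<rightarrow> {\<pi>\<in>Pi. S \<pi> = x}"
      using permutes_compose[OF pt] by (auto simp: Pi_def)
    show "(\<lambda>\<pi>. \<pi> \<circ> Transposition.transpose s t) \<in> {\<pi>\<in>Pi. S \<pi> = x} \<rightarrow> {\<pi>\<in>Pi. S (\<pi> \<circ> Transposition.transpose s t) = x}"
      using permutes_compose[OF pt] by (auto simp: Pi_def id)
  qed (simp_all add: comp_assoc)
  \<comment> \<open>Double counting: every t contributes the same number of permutations, while a
    fixed permutation reaches the value x for at most one t.\<close>
  have "card T * card {\<pi>\<in>Pi. S \<pi> = x} = (\<Sum>t\<in>T. card {\<pi>\<in>Pi. S (\<pi> \<circ> Transposition.transpose s t) = x})"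
    by (simp add: same)
  also have "\<dots> = (\<Sum>t\<in>T. \<Sum>\<pi>\<in>Pi. of_bool (S (\<pi> \<circ> Transposition.transpose s t) = x))"
    using finPi by (intro sum.cong refl) (simp add: sum_of_bool_eq Int_def)
  also have "\<dots> = (\<Sum>\<pi>\<in>Pi. \<Sum>t\<in>T. of_bool (S (\<pi> \<circ> Transposition.transpose s t) = x))" by (rule sum.swap)
  also have "\<dots> \<le> (\<Sum>\<pi>\<in>Pi. 1)"
  proof (rule sum_mono)
    fix \<pi> assume pi: "\<pi> \<in> Pi"
    have "(\<Sum>t\<in>T. of_bool (S (\<pi> \<circ> Transposition.transpose s t) = x)) = card {t \<in> T. S (\<pi> \<circ> Transposition.transpose s t) = x}"
      using finT by (simp add: sum_of_bool_eq Int_def)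
    also have "\<dots> \<le> 1"
    proof (rule ccontr)
      assume "\<not> card {t \<in> T. S (\<pi> \<circ> Transposition.transpose s t) = x} \<le> 1"
      then obtain t t' where t: "t \<in> T" "t' \<in> T" "t \<noteq> t'" "S (\<pi> \<circ> Transposition.transpose s t) = x" "S (\<pi> \<circ> Transposition.transpose s t') = x"
        using finT by (auto simp: card_le_Suc0_iff_eq)
      then have "(b s - y) * (a (\<pi> t) - a (\<pi> s)) = (b s - y) * (a (\<pi> t') - a (\<pi> s))"
        using sw[OF t(1), of \<pi>] sw[OF t(2), of \<pi>] by linarith
      then have "a (\<pi> t) = a (\<pi> t')" using s by simp
      moreover have "\<pi> t \<in> U" "\<pi> t' \<in> U" using pi t permutes_in_image[of \<pi> U] by (auto simp: Pi_def T_def)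
      ultimately have "\<pi> t = \<pi> t'" using a by (auto simp: inj_on_def)
      then show False using t pi permutes_inj[of \<pi> U] by (auto simp: Pi_def inj_def)
    qed
    finally show "(\<Sum>t\<in>T. of_bool (S (\<pi> \<circ> Transposition.transpose s t) = x)) \<le> (1 :: nat)" .
  qed
  also have "\<dots> = fact (card U)" unfolding Pi_def using card_permutations[OF refl U] by simp
  finally show ?thesis by (simp add: T_def Pi_def S_def)
qed

text \<open>Passing to the inverse permutation preserves the uniform distribution and lets the
  permutation act on the indices of \<open>a\<close>. An exchange of two indices of \<open>b\<close>
  is now a composition on the right.\<close>

lemma pmf_perm_sum:
  "pmf (perm_sum_pmf n a b) x
     = card {\<pi>. \<pi> permutes {1..n} \<and> (\<Sum>j\<in>{1..n}. b j * a (\<pi> j)) = x} / fact n"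
proof -
  define Pi where "Pi = {\<pi>. \<pi> permutes {1..n}}"
  have fin: "finite Pi" and c: "card Pi = fact n" unfolding Pi_def
    by (rule finite_permutations) (simp_all add: card_permutations)
  have ne: "Pi \<noteq> {}" using permutes_id[of "{1..n}"] unfolding Pi_def by blast
  have "pmf (perm_sum_pmf n a b) x = card (Pi \<inter> {\<pi>. (\<Sum>i=1..n. a i * b (\<pi> i)) = x}) / fact n"
    unfolding perm_sum_pmf_def pmf_map Pi_def[symmetric]
    by (subst measure_pmf_of_set[OF ne fin]) (simp add: c vimage_def)
  also have "card (Pi \<inter> {\<pi>. (\<Sum>i=1..n. a i * b (\<pi> i)) = x}) = card {\<pi>\<in>Pi. (\<Sum>j\<in>{1..n}. b j * a (\<pi> j)) = x}"
  proof (rule bij_betw_same_card[of inv], rule bij_betwI[where g = inv])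
    have s: "(\<Sum>j\<in>{1..n}. b j * a (inv \<pi> j)) = (\<Sum>i=1..n. a i * b (\<pi> i))" if "\<pi> \<in> Pi" for \<pi>
    proof -
      have p: "\<pi> permutes {1..n}" using that by (simp add: Pi_def)
      have "(\<Sum>j\<in>{1..n}. b j * a (inv \<pi> j)) = (\<Sum>i\<in>{1..n}. b (\<pi> i) * a (inv \<pi> (\<pi> i)))"
        using sum.permute[OF p, of "\<lambda>j. b j * a (inv \<pi> j)"] by (simp add: o_def)
      then show ?thesis using permutes_inverses(2)[OF p] by (simp add: mult.commute)
    qed
    have i: "inv \<pi> \<in> Pi" "inv (inv \<pi>) = \<pi>" if "\<pi> \<in> Pi" for \<pi>
      using that permutes_inv permutes_inv_inv by (auto simp: Pi_def)
    show "inv \<in> Pi \<inter> {\<pi>. (\<Sum>i=1..n. a i * b (\<pi> i)) = x} \<rightarrow> {\<pi>\<in>Pi. (\<Sum>j\<in>{1..n}. b j * a (\<pi> j)) = x}"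
      using s i by auto
    show "inv \<in> {\<pi>\<in>Pi. (\<Sum>j\<in>{1..n}. b j * a (\<pi> j)) = x} \<rightarrow> Pi \<inter> {\<pi>. (\<Sum>i=1..n. a i * b (\<pi> i)) = x}"
      using s[OF i(1)] i by auto
    show "inv (inv \<pi>) = \<pi>" if "\<pi> \<in> Pi \<inter> {\<pi>. (\<Sum>i=1..n. a i * b (\<pi> i)) = x}" for \<pi> using that i by auto
    show "inv (inv \<pi>) = \<pi>" if "\<pi> \<in> {\<pi>\<in>Pi. (\<Sum>j\<in>{1..n}. b j * a (\<pi> j)) = x}" for \<pi> using that i by auto
  qed
  finally show ?thesis by (simp add: Pi_def)
qed

section \<open>Choice of the parameters and conclusion\<close>

theorem theorem1p2:
  fixes \<epsilon> :: real
  assumes "\<epsilon> > 0"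
  shows "\<exists>C::real. \<forall>(n::nat) (a::nat \<Rightarrow> real) (b::nat \<Rightarrow> real).
           n \<ge> 1 \<longrightarrow> inj_on a {1..n} \<longrightarrow>
           M (image_mset b (mset_set {1..n})) > 0 \<longrightarrow>
           Q (perm_sum_pmf n a b)
             \<le> C * real n powr (-1 + \<epsilon>) / sqrt (M (image_mset b (mset_set {1..n})))"
proof -
  \<comment> \<open>What is used later: \<open>-1 + 2 * e\<close> is at most
    \<open>-1 + \<epsilon>\<close> in the final exponent, and \<open>4 * e\<close> is at most 1/2 in
    the majority case.\<close>
  define e where "e = min \<epsilon> 1 / 16"
  have e: "0 < e" "e \<le> 1" "16 * e \<le> \<epsilon>" "16 * e \<le> 1" using assms by (auto simp: e_def)
  show ?thesis
  proof (rule bilinear_law_bound[OF e(1,2), where 'x = nat and 'p = "nat \<times> nat"])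
    fix R :: nat and C :: real
    assume R: "R \<ge> 1" and C: "C > 0" and law:
      "\<And>(X :: nat set) (P :: (nat \<times> nat) set) n l m d (fs :: (nat \<Rightarrow> real) list) v.
        finite X \<Longrightarrow> finite P \<Longrightarrow> card X = n \<Longrightarrow> card P = l * m \<Longrightarrow> m \<ge> 1 \<Longrightarrow> l \<ge> 1 \<Longrightarrow> l \<le> n \<Longrightarrow>
        card (d ` P) \<le> l \<Longrightarrow> (\<And>y. card {p \<in> P. d p = y} \<le> m) \<Longrightarrow> (\<And>p. p \<in> P \<Longrightarrow> d p > 0) \<Longrightarrow>
        (\<And>f y. f \<in> set fs \<Longrightarrow> card {x \<in> X. f x = y} \<le> 2) \<Longrightarrow> length fs \<ge> R \<Longrightarrow>
        bilinear_law X P d fs v \<le> C * real n powr e / (real n * real l)"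
    \<comment> \<open>For \<open>N \<ge> n powr e\<close> the trivially counted part
      \<open>N^(k + R) / N^(2 k)\<close> of the energy is then at most
      \<open>n^(-2)\<close>.\<close>
    define k where "k = R + nat \<lceil>2 / e\<rceil>"
    have k: "k \<ge> 1" "real (k - R) \<ge> 2 / e" "R \<le> k" using R by (auto simp: k_def) linarith
    define h where "h = 1 + 1 / e"
    have h: "h \<ge> 1" using e by (simp add: h_def)
    define K1 where "K1 = 4 * (real k + 1) ^ 2 * (8 * real k) ^ (2 * k) * (1 + 2 ^ (4 * k) * C)"
    define C1 where "C1 = K1 * (8 * h)"
    define C2 where "C2 = 8 * h * (4 * real k) ^ 3"
    \<comment> \<open>One summand for each case: averaged subset sums, bounded n, and a majority
      value.\<close>
    define C3 where "C3 = C1 + C2 * (2 * C2) ^ 2 + 2 * C2"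
    have K1: "K1 \<ge> 0" using C by (simp add: K1_def)
    have C2: "C2 \<ge> 1"
    proof -
      have "1 * 1 \<le> (8 * h) * (4 * real k) ^ 3" using h k by (intro mult_mono one_le_power) auto
      then show ?thesis by (simp add: C2_def)
    qed
    have C3: "C1 \<le> C3" "C2 * (2 * C2) ^ 2 \<le> C3" "2 * C2 \<le> C3" using K1 h C2 by (auto simp: C3_def C1_def)
    have main: "pmf (perm_sum_pmf n a b) x * sqrt (M (image_mset b (mset_set {1..n}))) \<le> C3 * real n powr (-1 + \<epsilon>)"
      if n: "n \<ge> 1" and a: "inj_on a {1..n}" and MB: "M (image_mset b (mset_set {1..n})) > 0"
      for n :: nat and a b :: "nat \<Rightarrow> real" and x
    proof -
      define U where "U = {1..n}"
      define B where "B = image_mset b (mset_set U)"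
      define p where "p = pmf (perm_sum_pmf n a b) x"
      have U: "finite U" "card U = n" by (auto simp: U_def)
      have np: "real n \<ge> 1" using n by simp
      have p: "0 \<le> p" "p \<le> 1" by (auto simp: p_def pmf_le_1)
      have p_eq: "p = card {\<pi>. \<pi> permutes U \<and> (\<Sum>j\<in>U. b j * a (\<pi> j)) = x} / fact n"
        unfolding p_def U_def by (rule pmf_perm_sum)
      have size: "size B = n" using U by (simp add: B_def)
      have cnt: "count B y = card {i \<in> U. b i = y}" for y
        unfolding B_def by (rule count_image_mset_eq_card_vimage[OF U(1)])
      have MB': "M B > 0" using MB by (simp add: B_def U_def)
      let ?\<mu> = "mult_profile B"
      obtain i where i: "1 \<le> i" "i < length ?\<mu>" "?\<mu> ! i \<ge> 1"
        "M B \<le> real i ^ 3 * real (?\<mu> ! i) * (\<Sum>j\<in>{1..n}. 1 / real j)"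
        using M_le_max_cube[OF MB' size n] .
      define m where "m = ?\<mu> ! i"
      \<comment> \<open>The index i is 0-based, so there are at least i + 1 frequent values;
        rounding down to whole pairs still leaves \<open>i \<le> 2 * l\<close>.\<close>
      define l where "l = (i + 1) div 2"
      define N where "N = l * m"
      have m1: "m \<ge> 1" using i by (simp add: m_def)
      have l1: "l \<ge> 1" "2 * l \<le> i + 1" "i \<le> 2 * l" using i(1) unfolding l_def by linarith+
      \<comment> \<open>\<open>i^3 m\<close> is at most \<open>8 l^3 m = 8 l^2 N\<close>, and the
        harmonic sum costs the factor \<open>h * n powr e\<close>.\<close>
      have MN: "M B \<le> (8 * h) * (real l ^ 2 * real N) * real n powr e"
      proof -
        have "real i ^ 3 * real m \<le> (2 * real l) ^ 3 * real m"
          using l1(3) by (intro mult_right_mono power_mono) auto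
        also have "\<dots> = 8 * (real l ^ 2 * real N)" by (simp add: N_def power2_eq_square power3_eq_cube)
        finally have im: "real i ^ 3 * real m \<le> 8 * (real l ^ 2 * real N)" .
        have "real i ^ 3 * real m * (\<Sum>j\<in>{1..n}. 1 / real j) \<le> 8 * (real l ^ 2 * real N) * (h * real n powr e)"
          unfolding h_def by (rule mult_mono[OF im sum_inverse_le_powr[OF n e(1)]]) (simp_all add: sum_nonneg)
        then show ?thesis using i(4) by (simp add: m_def mult_ac)
      qed
      define V where "V = {y \<in> set_mset B. m \<le> count B y}"
      have V: "finite V" "card V \<ge> 2 * l" "\<And>y. y \<in> V \<Longrightarrow> card {i \<in> U. b i = y} \<ge> m"
        using card_frequent_values[OF i(2)] l1 by (auto simp: V_def m_def cnt)
      define P where "P = {..<l} \<times> {..<m}"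
      have P: "finite P" "card P = N" by (auto simp: P_def N_def)
      obtain s s' :: "nat \<times> nat \<Rightarrow> nat" where s: "inj_on s P" "s ` P \<subseteq> U" and s': "inj_on s' P" "s' ` P \<subseteq> U"
        and disj: "s ` P \<inter> s' ` P = {}" and d0: "\<forall>p\<in>P. b (s p) - b (s' p) > 0"
        and dcard: "card ((\<lambda>p. b (s p) - b (s' p)) ` P) \<le> l" and dfib0: "\<forall>y. card {p \<in> P. b (s p) - b (s' p) = y} \<le> m"
        by (rule exists_index_pairs[OF U(1) V, folded P_def])
      have d: "\<And>p. p \<in> P \<Longrightarrow> b (s p) - b (s' p) > 0" and dfib: "\<And>y. card {p \<in> P. b (s p) - b (s' p) = y} \<le> m"
        using d0 dfib0 by auto
      have N1: "N \<ge> 1" "l \<le> N" using l1 m1 by (auto simp: N_def Suc_le_eq)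
      have Nn: "N \<le> n"
      proof -
        have "card (s ` P) \<le> card U" by (rule card_mono) (use U s in auto)
        then show ?thesis using card_image[OF s(1)] P U by simp
      qed
      have ne: "real n powr e \<ge> 1" using np e by (simp add: ge_one_powr_ge_zero)
      have goal: "p * sqrt (M B) \<le> C3 * real n powr (-1 + 2 * e)"
      proof (cases "N \<ge> 4 * k \<and> real N \<ge> real n powr e")
        case True
        define E where "E = real n powr e / (real n * real l)"
        have E0: "E \<ge> 0" by (simp add: E_def)
        have lp: "real l \<ge> 1" "real N \<ge> 1" using l1 N1 by auto
        have "real (card {\<pi>. \<pi> permutes U \<and> (\<Sum>j\<in>U. b j * a (\<pi> j)) = x})
           \<le> 4 * (real k + 1) ^ 2 * (8 * real k) ^ (2 * k) / sqrt N * fact n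
             * (real N ^ (k + R) / real N ^ (2 * k) + 2 ^ (4 * k) * (C * E))"
        proof (rule permutation_sum_count_bound[OF _ U P s s' disj d])
          show "inj_on a U" using a by (simp add: U_def)
          show "bilinear_law U P (\<lambda>p. b (s p) - b (s' p)) fs v \<le> C * E"
            if "length fs \<ge> R" "\<And>f y. f \<in> set fs \<Longrightarrow> card {x \<in> U. f x = y} \<le> 2" for fs v
            using law[OF U(1) P(1) U(2) P(2)[unfolded N_def] m1 l1(1) _ dcard dfib d that(2,1)] N1 Nn
            by (simp add: E_def)
          show "C * E \<ge> 0" using C E0 by simp
        qed (use k True in auto)
        then have "p \<le> 4 * (real k + 1) ^ 2 * (8 * real k) ^ (2 * k) / sqrt N
             * (real N ^ (k + R) / real N ^ (2 * k) + 2 ^ (4 * k) * (C * E))"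
          unfolding p_eq by (simp add: pos_divide_le_eq mult_ac)
        also have "\<dots> \<le> 4 * (real k + 1) ^ 2 * (8 * real k) ^ (2 * k) / sqrt N * (E + 2 ^ (4 * k) * (C * E))"
        proof (intro mult_left_mono add_right_mono)
          have "real N ^ (2 * k) = real N ^ (k + R) * real N ^ (k - R)" using k(3) by (simp add: mult_2 flip: power_add)
          then have "real N ^ (k + R) / real N ^ (2 * k) = 1 / real N ^ (k - R)" using lp by simp
          also have "\<dots> \<le> 1 / real n ^ 2"
          proof (intro divide_left_mono)
            have "real n ^ 2 = real n powr 2" using np by (simp add: powr_numeral)
            also have "\<dots> \<le> real n powr (e * real (k - R))"
            proof (rule powr_mono[OF _ np])
              show "2 \<le> e * real (k - R)" using k(2) e(1) by (simp only: pos_divide_le_eq mult.commute)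
            qed
            also have "\<dots> = (real n powr e) ^ (k - R)" using np by (simp add: powr_power mult.commute)
            also have "\<dots> \<le> real N ^ (k - R)" using True by (intro power_mono) auto
            finally show "real n ^ 2 \<le> real N ^ (k - R)" .
          qed (use np lp in auto)
          also have "\<dots> \<le> 1 / (real n * real l)"
            using N1 Nn np lp by (intro divide_left_mono) (auto simp: power2_eq_square intro!: mult_left_mono)
          also have "\<dots> \<le> E" unfolding E_def using ne np lp by (intro divide_right_mono) auto
          finally show "real N ^ (k + R) / real N ^ (2 * k) \<le> E" .
        qed auto
        also have "\<dots> = K1 / sqrt N * E" by (simp add: K1_def algebra_simps)
        finally have p1: "p \<le> K1 / sqrt N * E" .
        \<comment> \<open>The prefactor \<open>8 * h * n powr e\<close> is at least 1, so its root
          may be replaced by itself. The factor \<open>l * sqrt N\<close> is what cancels the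
          denominators in \<open>p1\<close>.\<close>
        have M1: "sqrt (M B) \<le> (8 * h) * real n powr e * (real l * sqrt N)"
        proof (rule real_le_lsqrt)
          have "M B \<le> ((8 * h) * real n powr e) * (real l ^ 2 * real N)" using MN by (simp add: mult_ac)
          also have "\<dots> \<le> ((8 * h) * real n powr e) ^ 2 * (real l ^ 2 * real N)"
          proof (rule mult_right_mono)
            have "1 * 1 \<le> (8 * h) * real n powr e" using h ne by (intro mult_mono) auto
            then show "(8 * h) * real n powr e \<le> ((8 * h) * real n powr e) ^ 2"
              using self_le_power[of "(8 * h) * real n powr e" 2] by simp
          qed simp
          also have "\<dots> = ((8 * h) * real n powr e * (real l * sqrt N)) ^ 2" by (simp add: power_mult_distrib)
          finally show "M B \<le> ((8 * h) * real n powr e * (real l * sqrt N)) ^ 2" .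
        qed (use h MB' in auto)
        have "p * sqrt (M B) \<le> (K1 / sqrt N * E) * ((8 * h) * real n powr e * (real l * sqrt N))"
          by (intro mult_mono p1 M1) (use K1 E0 MB' in auto)
        also have "\<dots> = C1 * (real n powr e * real n powr e / real n)"
          using lp by (simp add: C1_def E_def)
        also have "real n powr e * real n powr e / real n = real n powr (-1 + 2 * e)"
        proof -
          have "real n powr (-1 + 2 * e) = real n powr (-1) * real n powr (e + e)"
            unfolding powr_add[symmetric] by simp
          also have "real n powr (-1) = 1 / real n" using np by (simp add: powr_minus_divide)
          finally show ?thesis unfolding powr_add[of "real n" e e, symmetric] by simp
        qed
        also have "C1 * real n powr (-1 + 2 * e) \<le> C3 * real n powr (-1 + 2 * e)"
          by (rule mult_right_mono[OF C3(1)]) simp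
        finally show ?thesis .
      next
        case False
        have k1: "real k \<ge> 1" using k by simp
        \<comment> \<open>Whichever part of the condition fails, N stays below this common bound; as
          l is at most N, M is then at most a constant times a small power of n.\<close>
        have Nb: "real N \<le> 4 * real k * real n powr e"
        proof (cases "N \<ge> 4 * k")
          case True
          then have "real N \<le> real n powr e" using False by simp
          also have "\<dots> \<le> 4 * real k * real n powr e" using k1 by (simp add: mult_le_cancel_right1)
          finally show ?thesis .
        next
          case False
          then have "real N \<le> 4 * real k" by linarith
          also have "\<dots> \<le> 4 * real k * real n powr e" using ne k1 by (simp add: mult_le_cancel_left1)
          finally show ?thesis .
        qed
        have MC: "M B \<le> C2 * real n powr (4 * e)"
        proof -
          have "real l ^ 2 * real N \<le> real N ^ 2 * real N" using N1 by (intro mult_right_mono power_mono) auto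
          also have "\<dots> = real N ^ 3" by (simp add: power2_eq_square power3_eq_cube)
          also have "\<dots> \<le> (4 * real k * real n powr e) ^ 3" by (intro power_mono Nb) simp
          finally have "(8 * h) * (real l ^ 2 * real N) * real n powr e \<le> (8 * h) * (4 * real k * real n powr e) ^ 3 * real n powr e"
            using h by (intro mult_right_mono mult_left_mono) auto
          also have "\<dots> = C2 * (real n powr e) ^ 4" by (simp add: C2_def power_mult_distrib power_numeral_reduce algebra_simps)
          also have "(real n powr e) ^ 4 = real n powr (4 * e)" using np by (simp add: powr_power mult.commute)
          finally show ?thesis using MN by linarith
        qed
        have M2: "sqrt (M B) \<le> C2 * real n powr (2 * e)"
        proof (rule real_le_lsqrt)
          have "C2 * real n powr (4 * e) \<le> C2 ^ 2 * real n powr (4 * e)"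
            using self_le_power[of C2 2] C2 by (intro mult_right_mono) auto
          also have "\<dots> = (C2 * real n powr (2 * e)) ^ 2" using np by (simp add: power_mult_distrib powr_power)
          finally show "M B \<le> (C2 * real n powr (2 * e)) ^ 2" using MC by linarith
        qed (use C2 MB' in auto)
        have split: "real n powr (2 * e) = real n * real n powr (-1 + 2 * e)"
          using np unfolding powr_add by (simp add: powr_minus_divide)
        show ?thesis
        proof (cases "real n \<le> (2 * C2) ^ 2")
          \<comment> \<open>Here n is bounded, and \<open>p \<le> 1\<close> is enough.\<close>
          case True
          have "p * sqrt (M B) \<le> 1 * (C2 * real n powr (2 * e))" by (intro mult_mono p M2) (use MB' in auto)
          also have "\<dots> = C2 * real n * real n powr (-1 + 2 * e)" using split by simp
          also have "\<dots> \<le> C2 * (2 * C2) ^ 2 * real n powr (-1 + 2 * e)"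
            using True C2 by (intro mult_right_mono mult_left_mono) auto
          also have "\<dots> \<le> C3 * real n powr (-1 + 2 * e)" by (rule mult_right_mono[OF C3(2)]) simp
          finally show ?thesis .
        next
          case big: False
          have len: "length ?\<mu> \<ge> 2" using i by linarith
          have "?\<mu> ! 0 \<in> set ?\<mu>" using len by (intro nth_mem) linarith
          then obtain y where y: "y \<in> set_mset B" "?\<mu> ! 0 = count B y" by (auto simp: set_mult_profile)
          have "real n - real (count B y) \<le> M B"
            using size_minus_max_le_M[of B] len size y(2) by simp
          also have "\<dots> \<le> C2 * real n powr (4 * e)" by (rule MC)
          also have "\<dots> \<le> C2 * sqrt (real n)"
          proof (rule mult_left_mono)
            have "real n powr (4 * e) \<le> real n powr (1 / 2)" using np e by (intro powr_mono) auto
            then show "real n powr (4 * e) \<le> sqrt (real n)" by (simp add: powr_half_sqrt)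
          qed (use C2 in simp)
          \<comment> \<open>This is where n has to exceed the square of
            \<open>2 * C2\<close>.\<close>
          also have "\<dots> \<le> real n / 2"
          proof -
            have "2 * C2 \<le> sqrt (real n)" using big by (intro real_le_rsqrt) simp
            then have "2 * C2 * sqrt (real n) \<le> sqrt (real n) * sqrt (real n)" by (rule mult_right_mono) simp
            then show ?thesis by simp
          qed
          finally have maj: "real n / 2 \<le> real (count B y)" by simp
          \<comment> \<open>A profile of length at least 2 has a second value, which supplies the
            fixed index outside the majority class for \<open>majority_count_bound\<close>.\<close>
          have "\<exists>y'\<in>set_mset B. y' \<noteq> y"
          proof (rule ccontr)
            assume "\<not> (\<exists>y'\<in>set_mset B. y' \<noteq> y)"
            then have "set_mset B \<subseteq> {y}" by auto
            then have "card (set_mset B) \<le> 1" using card_mono[of "{y}" "set_mset B"] by simp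
            then show False using len by (simp add: length_mult_profile)
          qed
          then obtain u where u: "u \<in> U" "b u \<noteq> y" using U by (auto simp: B_def)
          have "count B y * card {\<pi>. \<pi> permutes U \<and> (\<Sum>j\<in>U. b j * a (\<pi> j)) = x} \<le> fact n"
            using majority_count_bound[of a U u b y x] a U u by (simp add: cnt U_def)
          then have "real (count B y * card {\<pi>. \<pi> permutes U \<and> (\<Sum>j\<in>U. b j * a (\<pi> j)) = x}) \<le> real (fact n)"
            by (simp only: of_nat_le_iff)
          then have "real (count B y) * p \<le> 1" unfolding p_eq by simp
          moreover have "real n / 2 * p \<le> real (count B y) * p" by (rule mult_right_mono[OF maj p(1)])
          ultimately have "real n / 2 * p \<le> 1" by linarith
          then have p2: "p \<le> 2 / real n" using np by (simp add: field_simps)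
          have "p * sqrt (M B) \<le> 2 / real n * (C2 * real n powr (2 * e))" by (intro mult_mono p2 M2) (use MB' in auto)
          also have "\<dots> = 2 * C2 * real n powr (-1 + 2 * e)" unfolding split using np by simp
          also have "\<dots> \<le> C3 * real n powr (-1 + 2 * e)" by (rule mult_right_mono[OF C3(3)]) simp
          finally show ?thesis .
        qed
      qed
      also have "C3 * real n powr (-1 + 2 * e) \<le> C3 * real n powr (-1 + \<epsilon>)"
        using np e C3 C2 by (intro mult_left_mono powr_mono) auto
      finally show ?thesis by (simp add: p_def B_def U_def)
    qed
    show ?thesis
    proof (intro exI[of _ C3] allI impI)
      fix n and a b :: "nat \<Rightarrow> real"
      assume n: "n \<ge> 1" "inj_on a {1..n}" "M (image_mset b (mset_set {1..n})) > 0"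
      show "Q (perm_sum_pmf n a b) \<le> C3 * real n powr (-1 + \<epsilon>) / sqrt (M (image_mset b (mset_set {1..n})))"
        unfolding Q_def
      proof (rule cSUP_least)
        fix x
        show "pmf (perm_sum_pmf n a b) x \<le> C3 * real n powr (-1 + \<epsilon>) / sqrt (M (image_mset b (mset_set {1..n})))"
          using main[OF n, of x] n(3) by (simp add: pos_le_divide_eq)
      qed simp
    qed
  qed
qed

end
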